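(* There are exactly $2^3-1=7$ equivalence classes of differentiable $(\mathsf R^3,\mathsf R)$-knots.
   Context: The (closed) long ray $\mathsf R$ is the set $W(\omega_1)\times[0,1)$, where $W(\omega_1)$ is the set of ordinals $<\omega_1$, with the lexicographic order and the order topology; it is a non-metrizable $1$-manifold with boundary point $0=(0,0)$. A $C^\infty$ structure on $\mathsf R$ is fixed, given by a fixed maximal atlas $\{U_j,\psi_j\}$ of charts $\psi_j:U_j\to\mathbb R$ with $0\in U_j$ for all $j$; $\mathsf R^3$ carries the third power structure, with atlas $\{(U_j)^3,(\psi_j,\psi_j,\psi_j)\}$. Let $\mathsf R'=(\{-1\}\times[0,1))\sqcup\mathsf R$ with the order topology (every element of $\{-1\}\times[0,1)$ precedes every element of $\mathsf R$), so $\mathsf R\subset\mathsf R'$. A differentiable $(\mathsf R^3,\mathsf R)$-knot is a smooth embedding $\mathsf R\to\mathsf R^3$ (homeomorphism onto its image, $C^\infty$, with nowhere vanishing derivative in charts). An isotopy $\phi_t$ ($t\in[0,1]$) of a space $Y$ is a continuous map $Y\times[0,1]\to Y$, $(y,t)\mapsto\phi_t(y)$, with every $\phi_t$ a homeomorphism of $Y$. Two $(\mathsf R^3,\mathsf R)$-knots $f,g$ are equivalent if there is an isotopy $\phi_t$ of $(\mathsf R')^3$ with $\phi_0=\mathrm{id}$ and $\phi_1\circ f=g$. *)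

theory Defs
  imports "HOL-Analysis.Analysis" "HOL-Library.Option_ord" "HOL-Library.Countable_Set_Type"
begin

section \<open>The countable ordinals\<close>

text \<open>A model of $W(\omega_1)$: the field of the initial well-order \<open>cardSuc natLeq\<close>, whose order
  type is $\omega_1$.  The two lemmas at the end of this section characterise that order type.\<close>

typedef omega1 = "Field (cardSuc natLeq)"
  using Field_cardSuc_not_empty[OF natLeq_Card_order] by blast

instantiation omega1 :: linorder
begin

definition less_eq_omega1 :: "omega1 \<Rightarrow> omega1 \<Rightarrow> bool" where
  "less_eq_omega1 a b \<longleftrightarrow> (Rep_omega1 a, Rep_omega1 b) \<in> cardSuc natLeq"

definition less_omega1 :: "omega1 \<Rightarrow> omega1 \<Rightarrow> bool" where
  "less_omega1 a b \<longleftrightarrow> a \<le> b \<and> a \<noteq> b"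

instance
proof -
  have W: "Well_order (cardSuc natLeq)"
    using cardSuc_Card_order[OF natLeq_Card_order] by (simp add: card_order_on_def)
  then have r: "Refl (cardSuc natLeq)" and t: "trans (cardSuc natLeq)"
    and a: "antisym (cardSuc natLeq)" and tot: "Total (cardSuc natLeq)"
    by (auto simp: order_on_defs)
  have eq: "x = y" if "x \<le> y" "y \<le> x" for x y :: omega1
    using that a unfolding less_eq_omega1_def antisym_def Rep_omega1_inject[symmetric] by blast
  show "OFCLASS(omega1, linorder_class)"
  proof
    fix x y z :: omega1
    show "x < y \<longleftrightarrow> x \<le> y \<and> \<not> y \<le> x"
      using eq r by (auto simp: less_omega1_def less_eq_omega1_def refl_on_def Rep_omega1)
    show "x \<le> x"
      using r by (auto simp: less_eq_omega1_def refl_on_def Rep_omega1)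
    show "x \<le> y \<Longrightarrow> y \<le> z \<Longrightarrow> x \<le> z"
      using t unfolding less_eq_omega1_def trans_def by blast
    show "x \<le> y \<Longrightarrow> y \<le> x \<Longrightarrow> x = y" by (rule eq)
    show "x \<le> y \<or> y \<le> x"
    proof (cases "x = y")
      case True
      then show ?thesis using r by (auto simp: less_eq_omega1_def refl_on_def Rep_omega1)
    next
      case False
      then show ?thesis
        using tot Rep_omega1[of x] Rep_omega1[of y]
        unfolding less_eq_omega1_def total_on_def by (auto simp: Rep_omega1_inject)
    qed
  qed
qed

end

instance omega1 :: wellorder
proof
  fix P :: "omega1 \<Rightarrow> bool" and a
  assume step: "\<And>x. (\<And>y. y < x \<Longrightarrow> P y) \<Longrightarrow> P x"
  have wf: "wf (cardSuc natLeq - Id)"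
    using cardSuc_Card_order[OF natLeq_Card_order]
    by (simp add: card_order_on_def well_order_on_def)
  have "wf (inv_image (cardSuc natLeq - Id) Rep_omega1)"
    using wf by (rule wf_inv_image)
  moreover have "inv_image (cardSuc natLeq - Id) Rep_omega1 = {(x, y). x < y}"
    by (auto simp: inv_image_def less_omega1_def less_eq_omega1_def Rep_omega1_inject)
  ultimately have "wf {(x::omega1, y). x < y}" by simp
  then show "P a"
    by (induction a rule: wf_induct_rule) (use step in auto)
qed

context
  includes cardinal_syntax
begin

lemma countable_lessThan_omega1: "countable {..<a::omega1}"
proof -
  let ?r = "cardSuc natLeq"
  have C: "Card_order ?r" by (rule cardSuc_Card_order[OF natLeq_Card_order])
  have "|underS ?r (Rep_omega1 a)| <o ?r"
    by (rule card_of_underS[OF C Rep_omega1])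
  then have "|underS ?r (Rep_omega1 a)| \<le>o natLeq"
    using cardSuc_ordLess_ordLeq C card_of_Card_order natLeq_Card_order
      cardSuc_ordLeq_ordLess not_ordLess_ordLeq
    by (metis card_of_Well_order natLeq_Well_order not_ordLess_iff_ordLeq)
  then have "countable (underS ?r (Rep_omega1 a))"
    by (simp add: countable_card_le_natLeq)
  moreover have "Rep_omega1 ` {..<a} \<subseteq> underS ?r (Rep_omega1 a)"
    by (auto simp: underS_def less_omega1_def less_eq_omega1_def Rep_omega1_inject)
  ultimately have "countable (Rep_omega1 ` {..<a})"
    using countable_subset by blast
  then show ?thesis
    by (rule countable_image_inj_on) (simp add: inj_on_def Rep_omega1_inject)
qed

lemma uncountable_UNIV_omega1: "uncountable (UNIV :: omega1 set)"
proof
  assume "countable (UNIV :: omega1 set)"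
  then have "countable (range Rep_omega1)" by (rule countable_image)
  moreover have "range Rep_omega1 = Field (cardSuc natLeq)"
    using type_definition.Rep_range[OF type_definition_omega1] .
  ultimately have "|Field (cardSuc natLeq)| \<le>o natLeq"
    by (simp add: countable_card_le_natLeq)
  moreover have "natLeq <o |Field (cardSuc natLeq)|"
    using cardSuc_greater[OF natLeq_Card_order]
      card_of_Field_ordIso[OF cardSuc_Card_order[OF natLeq_Card_order]]
    by (meson ordIso_symmetric ordLess_ordIso_trans)
  ultimately show False
    using not_ordLess_ordLeq by blast
qed

end


section \<open>The long ray and its extension by a collar\<close>

typedef 'w ray = "{(a::'w, t::real). 0 \<le> t \<and> t < 1}"
  by (rule exI[of _ "(undefined, 0)"]) simp

instantiation ray :: (linorder) linorder
begin

definition less_ray :: "'a ray \<Rightarrow> 'a ray \<Rightarrow> bool" where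
  "less_ray x y \<longleftrightarrow>
     fst (Rep_ray x) < fst (Rep_ray y) \<or>
     fst (Rep_ray x) = fst (Rep_ray y) \<and> snd (Rep_ray x) < snd (Rep_ray y)"

definition less_eq_ray :: "'a ray \<Rightarrow> 'a ray \<Rightarrow> bool" where
  "less_eq_ray x y \<longleftrightarrow> x < y \<or> x = y"

instance
  by standard (auto simp: less_eq_ray_def less_ray_def Rep_ray_inject[symmetric] prod_eq_iff)

end

instantiation ray :: (linorder) linorder_topology
begin

definition open_ray :: "'a ray set \<Rightarrow> bool" where
  "open_ray = generate_topology (range lessThan \<union> range greaterThan)"

instance by standard (rule open_ray_def)

end

type_synonym long_ray = "omega1 ray"

text \<open>In \<open>omega1 option\<close> the element \<open>None\<close> lies below every \<open>Some a\<close>; it plays the role of the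
  ordinal $-1$.\<close>

type_synonym long_ray' = "omega1 option ray"

definition origin :: long_ray where
  "origin = Abs_ray (LEAST a. True, 0)"

definition incl :: "long_ray \<Rightarrow> long_ray'" where
  "incl x = Abs_ray (Some (fst (Rep_ray x)), snd (Rep_ray x))"

definition cube :: "('a \<Rightarrow> 'b) \<Rightarrow> 'a \<times> 'a \<times> 'a \<Rightarrow> 'b \<times> 'b \<times> 'b" where
  "cube f = (\<lambda>(x, y, z). (f x, f y, f z))"


section \<open>Smooth structures\<close>

text \<open>At a boundary point of \<open>S\<close> the derivatives are one-sided.  In all uses below \<open>S\<close> is the image
  of an open subset of the long ray under a chart, so it has no isolated points and the
  derivatives are unique.\<close>

definition C_infinity_on :: "real set \<Rightarrow> (real \<Rightarrow> 'a::real_normed_vector) \<Rightarrow> bool" where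
  "C_infinity_on S h \<longleftrightarrow>
     (\<exists>D. D 0 = h \<and>
        (\<forall>k. \<forall>x\<in>S. (D k has_vector_derivative D (Suc k) x) (at x within S)))"

text \<open>A chart is a pair \<open>(U, \<psi>)\<close>; the values of \<open>\<psi>\<close> outside \<open>U\<close> are irrelevant.  Since \<open>U\<close> contains
  the boundary point, \<open>\<psi>\<close> is a homeomorphism onto its image, which is not open in the real line.\<close>

type_synonym chart = "long_ray set \<times> (long_ray \<Rightarrow> real)"

definition is_chart :: "chart \<Rightarrow> bool" where
  "is_chart = (\<lambda>(U, \<psi>). open U \<and> origin \<in> U \<and> (\<exists>\<psi>'. homeomorphism U (\<psi> ` U) \<psi> \<psi>'))"

definition compatible :: "chart \<Rightarrow> chart \<Rightarrow> bool" where
  "compatible = (\<lambda>(U, \<psi>) (V, \<eta>).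
     C_infinity_on (\<psi> ` (U \<inter> V)) (\<eta> \<circ> inv_into U \<psi>) \<and>
     C_infinity_on (\<eta> ` (U \<inter> V)) (\<psi> \<circ> inv_into V \<eta>))"

definition is_atlas :: "chart set \<Rightarrow> bool" where
  "is_atlas \<A> \<longleftrightarrow>
     (\<forall>c\<in>\<A>. is_chart c) \<and> (\<Union>(U, \<psi>)\<in>\<A>. U) = UNIV \<and> (\<forall>c\<in>\<A>. \<forall>d\<in>\<A>. compatible c d)"

definition maximal_atlas :: "chart set \<Rightarrow> bool" where
  "maximal_atlas \<A> \<longleftrightarrow> is_atlas \<A> \<and> (\<forall>\<B>. is_atlas \<B> \<and> \<A> \<subseteq> \<B> \<longrightarrow> \<B> = \<A>)"


section \<open>Knots and their equivalence\<close>

text \<open>The condition on derivatives is imposed in every pair of charts \<open>(U, \<psi>)\<close> of the source and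
  \<open>(V \<times> V \<times> V, cube \<eta>)\<close> of the third power.\<close>

definition smooth_embedding :: "chart set \<Rightarrow> (long_ray \<Rightarrow> long_ray \<times> long_ray \<times> long_ray) \<Rightarrow> bool" where
  "smooth_embedding \<A> f \<longleftrightarrow>
     (\<exists>f'. homeomorphism UNIV (range f) f f') \<and>
     (\<forall>(U, \<psi>)\<in>\<A>. \<forall>(V, \<eta>)\<in>\<A>.
        let S = \<psi> ` (U \<inter> f -` (V \<times> V \<times> V));
            h = cube \<eta> \<circ> f \<circ> inv_into U \<psi>
        in C_infinity_on S h \<and> (\<forall>x\<in>S. vector_derivative h (at x within S) \<noteq> 0))"

definition knots :: "chart set \<Rightarrow> (long_ray \<Rightarrow> long_ray \<times> long_ray \<times> long_ray) set" where
  "knots \<A> = {f. smooth_embedding \<A> f}"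

definition isotopy :: "(real \<Rightarrow> 'y::topological_space \<Rightarrow> 'y) \<Rightarrow> bool" where
  "isotopy \<phi> \<longleftrightarrow>
     continuous_on (UNIV \<times> {0..1}) (\<lambda>(y, t). \<phi> t y) \<and>
     (\<forall>t\<in>{0..1}. \<exists>g. homeomorphism UNIV UNIV (\<phi> t) g)"

definition knot_equiv :: "chart set \<Rightarrow>
    ((long_ray \<Rightarrow> long_ray \<times> long_ray \<times> long_ray) \<times> (long_ray \<Rightarrow> long_ray \<times> long_ray \<times> long_ray)) set" where
  "knot_equiv \<A> = {(f, g). f \<in> knots \<A> \<and> g \<in> knots \<A> \<and>
     (\<exists>\<phi> :: real \<Rightarrow> long_ray' \<times> long_ray' \<times> long_ray' \<Rightarrow> long_ray' \<times> long_ray' \<times> long_ray'.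
        isotopy \<phi> \<and> \<phi> 0 = id \<and> \<phi> 1 \<circ> (cube incl \<circ> f) = cube incl \<circ> g)}"

lemma equiv_knot_equiv: "equiv (knots \<A>) (knot_equiv \<A>)"
proof (rule equivI)
  show "knot_equiv \<A> \<subseteq> knots \<A> \<times> knots \<A>"
    by (auto simp: knot_equiv_def)
  have "isotopy (\<lambda>t::real. id :: 'y::topological_space \<Rightarrow> 'y)"
    by (auto simp: isotopy_def case_prod_unfold id_def homeomorphism_def
        intro!: continuous_intros exI[of _ "\<lambda>x. x"])
  then show "refl_on (knots \<A>) (knot_equiv \<A>)"
    unfolding refl_on_def knot_equiv_def by (auto intro!: exI[of _ "\<lambda>t. id"])
  show "sym (knot_equiv \<A>)"
  proof (rule symI)
    fix f g assume "(f, g) \<in> knot_equiv \<A>"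
    then obtain \<phi> :: "real \<Rightarrow> long_ray' \<times> long_ray' \<times> long_ray' \<Rightarrow> long_ray' \<times> long_ray' \<times> long_ray'"
      where fg: "f \<in> knots \<A>" "g \<in> knots \<A>" and iso: "isotopy \<phi>"
        and 0: "\<phi> 0 = id" and 1: "\<phi> 1 \<circ> (cube incl \<circ> f) = cube incl \<circ> g"
      by (auto simp: knot_equiv_def)
    obtain k where k: "homeomorphism UNIV UNIV (\<phi> 1) k"
      using iso unfolding isotopy_def by (metis atLeastAtMost_iff order_refl zero_le_one)
    have k1: "k (\<phi> 1 y) = y" "\<phi> 1 (k y) = y" for y
      using k unfolding homeomorphism_def by blast+
    let ?\<theta> = "\<lambda>t. \<phi> (1 - t) \<circ> k"
    have "isotopy ?\<theta>"
      unfolding isotopy_def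
    proof
      have c: "continuous_on (UNIV \<times> {0..1}) (\<lambda>(y, t). \<phi> t y)"
        using iso by (simp add: isotopy_def)
      have ck: "continuous_on (UNIV \<times> {0..1::real}) (\<lambda>p. k (fst p))"
        using k by (auto simp: homeomorphism_def
            intro!: continuous_on_compose2[of UNIV k] continuous_intros)
      have "continuous_on (UNIV \<times> {0..1}) ((\<lambda>(y, t). \<phi> t y) \<circ> (\<lambda>p. (k (fst p), 1 - snd p)))"
        by (rule continuous_on_compose)
          (auto intro!: continuous_intros ck continuous_on_subset[OF c])
      then show "continuous_on (UNIV \<times> {0..1}) (\<lambda>(y, t). ?\<theta> t y)"
        by (simp add: o_def case_prod_unfold)
      show "\<forall>t\<in>{0..1}. \<exists>h. homeomorphism UNIV UNIV (?\<theta> t) h"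
      proof
        fix t :: real assume "t \<in> {0..1}"
        then obtain h where "homeomorphism UNIV UNIV (\<phi> (1 - t)) h"
          using iso unfolding isotopy_def by (metis atLeastAtMost_iff diff_ge_0_iff_ge diff_le_eq
              le_add_same_cancel1)
        then show "\<exists>h. homeomorphism UNIV UNIV (?\<theta> t) h"
          using homeomorphism_compose[OF homeomorphism_symD[OF k]] by blast
      qed
    qed
    moreover have "?\<theta> 0 = id" by (auto simp: k1)
    moreover have "?\<theta> 1 \<circ> (cube incl \<circ> g) = cube incl \<circ> f"
      unfolding 1[symmetric] by (auto simp: 0 k1)
    ultimately show "(g, f) \<in> knot_equiv \<A>"
      using fg unfolding knot_equiv_def by blast
  qed
  show "trans (knot_equiv \<A>)"
  proof (rule transI)
    fix f g h assume "(f, g) \<in> knot_equiv \<A>" "(g, h) \<in> knot_equiv \<A>"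
    then obtain \<phi> \<theta> :: "real \<Rightarrow> long_ray' \<times> long_ray' \<times> long_ray' \<Rightarrow> long_ray' \<times> long_ray' \<times> long_ray'"
      where fh: "f \<in> knots \<A>" "h \<in> knots \<A>" and iso: "isotopy \<phi>" "isotopy \<theta>"
        and 0: "\<phi> 0 = id" "\<theta> 0 = id" and 1: "\<phi> 1 \<circ> (cube incl \<circ> f) = cube incl \<circ> g"
          "\<theta> 1 \<circ> (cube incl \<circ> g) = cube incl \<circ> h"
      by (auto simp: knot_equiv_def)
    have "isotopy (\<lambda>t. \<theta> t \<circ> \<phi> t)"
      unfolding isotopy_def
    proof
      have c: "continuous_on (UNIV \<times> {0..1}) (\<lambda>(y, t). \<phi> t y)"
        "continuous_on (UNIV \<times> {0..1}) (\<lambda>(y, t). \<theta> t y)"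
        using iso by (simp_all add: isotopy_def)
      have "continuous_on (UNIV \<times> {0..1}) ((\<lambda>(y, t). \<theta> t y) \<circ> (\<lambda>p. ((\<lambda>(y, t). \<phi> t y) p, snd p)))"
        by (rule continuous_on_compose)
          (auto intro!: continuous_on_Pair c continuous_intros intro: continuous_on_subset[OF c(2)])
      then show "continuous_on (UNIV \<times> {0..1}) (\<lambda>(y, t). (\<theta> t \<circ> \<phi> t) y)"
        by (simp add: o_def case_prod_unfold)
      show "\<forall>t\<in>{0..1}. \<exists>h. homeomorphism UNIV UNIV (\<theta> t \<circ> \<phi> t) h"
        using iso homeomorphism_compose unfolding isotopy_def by blast
    qed
    moreover have "\<theta> 1 \<circ> \<phi> 1 \<circ> (cube incl \<circ> f) = cube incl \<circ> h"
      using 1 by (metis comp_assoc)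
    ultimately show "(f, h) \<in> knot_equiv \<A>"
      using fh 0 unfolding knot_equiv_def by (auto intro!: exI[of _ "\<lambda>t. \<theta> t \<circ> \<phi> t"])
  qed
qed

end

theory Submission
  imports Defs
begin

text \<open>The class of a knot is determined by the set of its unbounded coordinates, a nonempty subset of
  a three-element set.

  A bounded coordinate is eventually constant. An unbounded coordinate \<open>u\<close> has unboundedly many fixed
  points; at a limit of them its derivative, read in one chart for source and target, is one, so
  \<open>u\<close> is increasing nearby. Hence the points where \<open>u\<close> is not locally increasing are bounded, for
  otherwise they would accumulate at a limit of fixed points. Beyond some \<open>s\<close>, therefore, each
  coordinate of a knot is increasing or constant.

  Since some coordinate has nonzero derivative at each point, a knot is locally a graph over a
  coordinate axis, and its free end can be pulled a little along this graph by an ambient isotopy.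
  By connectedness of the long ray the free end can be pulled up to \<open>s\<close>. Two such tails with the same
  unbounded coordinates are related by a product of three order automorphisms of the collared ray,
  each of which is isotopic to the identity, because its fixed points are unbounded and it can be
  interpolated linearly between consecutive ones.

  Conversely, suppose an isotopy made an unbounded coordinate bounded. Choose \<open>z\<close> beyond all the bounds
  such that, at every rational time at which the coordinate is unbounded, it sends \<open>z\<close> to \<open>z\<close>. The path
  of \<open>z\<close> under the isotopy would then connect \<open>z\<close> to a small value while avoiding all values in
  between.\<close>

section \<open>Long rays over well-orders of type $\omega_1$\<close>

text \<open>No knotting survives because the knot has a free end: the parameter domain is order
  isomorphic to each of its final segments, so the whole image can be swallowed into a tail.
  Smoothness enters in two ways. A nonvanishing derivative keeps the knot tame, since a local graph
  can be pulled; and the existence of a derivative at a limit of fixed points stops an unbounded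
  coordinate from oscillating. The isotopies themselves are merely continuous. The collar gives
  every point of the knot a neighbourhood that is a product of open intervals, also where the knot
  touches the boundary of the cube, so local moves can be made in Euclidean space. Both
  \<open>long_ray\<close> and \<open>long_ray'\<close> need the same facts, hence an abstract class
  of index orders. The recurring obstacle is that only countably many requirements can be met at a
  single point of a ray. For an isotopy this leads to rational times; the other times are recovered
  from a closed set of admissible values.\<close>

class omega_one = wellorder +
  assumes countable_lessThan: "countable {..<a}"
    and uncountable_UNIV: "uncountable UNIV"

instance omega1 :: omega_one
  by standard (rule countable_lessThan_omega1 uncountable_UNIV_omega1)+

text \<open>Prepending one element keeps initial segments countable, so whatever is proved for the
  long ray holds for its collared extension too.\<close>

instance option :: (omega_one) omega_one
proof
  fix a :: "'a option"
  have "{..<a} \<subseteq> insert None (Some ` {..<the a})"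
  proof
    fix x assume "x \<in> {..<a}"
    then show "x \<in> insert None (Some ` {..<the a})"
      by (cases x; cases a) auto
  qed
  then show "countable {..<a}"
    by (rule countable_subset) (simp add: countable_lessThan)
  show "uncountable (UNIV :: 'a option set)"
  proof
    assume "countable (UNIV :: 'a option set)"
    then have "countable (range (Some :: 'a \<Rightarrow> _))"
      by (rule countable_subset[rotated]) simp
    then have "countable (UNIV :: 'a set)"
      by (rule countable_image_inj_on) simp
    then show False using uncountable_UNIV by blast
  qed
qed

text \<open>Regularity of omega_1: a countable union of countable initial segments cannot exhaust an
  uncountable order.\<close>

lemma countable_bounded_omega_one:
  fixes X :: "'a::omega_one set"
  assumes "countable X"
  shows "\<exists>b. \<forall>x\<in>X. x < b"
proof -
  have "countable {..x}" for x :: 'a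
    using countable_lessThan[of x] by (metis countable_insert ivl_disj_un_singleton(2) Un_insert_right
        sup_bot.right_neutral)
  then have "countable (\<Union>x\<in>X. {..x})" using assms by auto
  then obtain b where "b \<notin> (\<Union>x\<in>X. {..x})" using uncountable_UNIV by (metis UNIV_eq_I)
  then show ?thesis by (auto simp: not_le)
qed

section \<open>Order, completeness and compactness of rays\<close>

lemma Abs_ray_inverse': "0 \<le> t \<Longrightarrow> t < 1 \<Longrightarrow> Rep_ray (Abs_ray (a, t)) = (a, t)"
  by (simp add: Abs_ray_inverse)

lemma Rep_ray_bounds: "0 \<le> snd (Rep_ray x)" "snd (Rep_ray x) < 1"
  using Rep_ray[of x] by auto

lemma ray_cases:
  obtains a t where "x = Abs_ray (a, t)" "0 \<le> t" "t < 1"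
  by (rule Abs_ray_cases[of x]) (use that in auto)

lemma Abs_ray_less_iff:
  assumes "0 \<le> s" "s < 1" "0 \<le> t" "t < 1"
  shows "Abs_ray (a, s) < Abs_ray (b, t) \<longleftrightarrow> a < b \<or> a = b \<and> s < t"
  using assms by (simp add: less_ray_def Abs_ray_inverse')

lemma Abs_ray_eq_iff:
  assumes "0 \<le> s" "s < 1" "0 \<le> t" "t < 1"
  shows "Abs_ray (a, s) = Abs_ray (b, t) \<longleftrightarrow> a = b \<and> s = t"
  using assms by (subst Abs_ray_inject) auto

lemma Abs_ray_le_iff:
  assumes "0 \<le> s" "s < 1" "0 \<le> t" "t < 1"
  shows "Abs_ray (a, s) \<le> Abs_ray (b, t) \<longleftrightarrow> a < b \<or> a = b \<and> s \<le> t"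
  using assms by (auto simp: le_less Abs_ray_less_iff Abs_ray_eq_iff)

instance ray :: (linorder) dense_order
proof
  fix x y :: "'a ray" assume "x < y"
  show "\<exists>z. x < z \<and> z < y"
  proof (cases x rule: ray_cases)
    case x: (1 a s)
    show ?thesis
    proof (cases y rule: ray_cases)
      case y: (1 b t)
      define r where "r = (if a = b then (s + t) / 2 else (s + 1) / 2)"
      have "0 \<le> r" "r < 1" "x < Abs_ray (a, r)" "Abs_ray (a, r) < y"
        using x y \<open>x < y\<close> by (auto simp: Abs_ray_less_iff r_def)
      then show ?thesis by blast
    qed
  qed
qed

text \<open>Well-ordering yields infima: the first coordinates of a nonempty set have a least
  element, and over it the second coordinates have a real infimum, which stays below 1. Suprema are
  infima of upper bounds. Together with density this makes intervals connected and the intermediate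
  value theorem available.\<close>

instantiation ray :: (wellorder) linear_continuum_topology
begin

definition inf_ray :: "'a ray \<Rightarrow> 'a ray \<Rightarrow> 'a ray" where "inf_ray = min"

definition sup_ray :: "'a ray \<Rightarrow> 'a ray \<Rightarrow> 'a ray" where "sup_ray = max"

definition Inf_ray :: "'a ray set \<Rightarrow> 'a ray" where
  "Inf_ray X = (let a = (LEAST a. a \<in> fst ` Rep_ray ` X) in Abs_ray (a, Inf {t. (a, t) \<in> Rep_ray ` X}))"

definition Sup_ray :: "'a ray set \<Rightarrow> 'a ray" where
  "Sup_ray X = Inf {u. \<forall>x\<in>X. x \<le> u}"

instance
proof -
  have Inf: "(\<forall>x\<in>X. Inf X \<le> x) \<and> (\<forall>z. (\<forall>x\<in>X. z \<le> x) \<longrightarrow> z \<le> Inf X)" if "X \<noteq> {}" for X :: "'a ray set"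
  proof -
    define a where "a = (LEAST a. a \<in> fst ` Rep_ray ` X)"
    define T where "T = {t. (a, t) \<in> Rep_ray ` X}"
    have a: "a \<in> fst ` Rep_ray ` X"
      unfolding a_def using that by (metis (mono_tags) LeastI_ex image_is_empty ex_in_conv)
    have al: "a \<le> fst (Rep_ray x)" if "x \<in> X" for x
      unfolding a_def by (rule Least_le) (use that in auto)
    obtain t where "(a, t) \<in> Rep_ray ` X" using a by (metis (no_types, lifting) imageE image_eqI prod.collapse)
    then have T: "T \<noteq> {}" by (auto simp: T_def)
    have T01: "\<forall>t\<in>T. 0 \<le> t \<and> t < 1"
    proof
      fix t assume "t \<in> T"
      then obtain x where "Rep_ray x = (a, t)" by (auto simp: T_def)
      then show "0 \<le> t \<and> t < 1" using Rep_ray_bounds[of x] by simp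
    qed
    then have bT: "bdd_below T" using T01 by (meson bdd_belowI)
    define r where "r = Inf T"
    have r: "0 \<le> r" "r < 1"
      unfolding r_def using T T01 cInf_greatest[of T 0] cInf_lower[OF _ bT] by (auto, meson ex_in_conv order_le_less_trans)
    have I: "Inf X = Abs_ray (a, r)" by (simp add: Inf_ray_def a_def T_def r_def Let_def)
    show ?thesis
    proof (intro conjI ballI allI impI)
      fix x assume x: "x \<in> X"
      show "Inf X \<le> x"
      proof (cases x rule: ray_cases)
        case (1 b t)
        have "a \<le> b" using al[OF x] 1 by (simp add: Abs_ray_inverse')
        moreover have "r \<le> t" if "a = b"
          unfolding r_def using that x 1 by (intro cInf_lower bT) (force simp: T_def Abs_ray_inverse' image_iff)
        ultimately show ?thesis using 1 r by (auto simp: I Abs_ray_le_iff)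
      qed
    next
      fix z assume z: "\<forall>x\<in>X. z \<le> x"
      show "z \<le> Inf X"
      proof (cases z rule: ray_cases)
        case (1 b t)
        have *: "b < a \<or> b = a \<and> t \<le> s" if sT: "s \<in> T" for s
        proof -
          obtain x where x: "x \<in> X" "Rep_ray x = (a, s)" using sT by (auto simp: T_def)
          then have "x = Abs_ray (a, s)" by (metis Rep_ray_inverse)
          then show ?thesis using x z 1 T01 sT by (auto simp: Abs_ray_le_iff)
        qed
        then have "b < a \<or> b = a \<and> t \<le> r"
          unfolding r_def using T by (metis all_not_in_conv cInf_greatest)
        then show ?thesis using 1 r by (auto simp: I Abs_ray_le_iff)
      qed
    qed
  qed
  show "OFCLASS('a ray, linear_continuum_topology_class)"
  proof
    fix x :: "'a ray" and X :: "'a ray set"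
    show "x \<in> X \<Longrightarrow> bdd_below X \<Longrightarrow> Inf X \<le> x" using Inf by blast
    show "X \<noteq> {} \<Longrightarrow> (\<And>y. y \<in> X \<Longrightarrow> x \<le> y) \<Longrightarrow> x \<le> Inf X" using Inf by blast
    show "x \<in> X \<Longrightarrow> bdd_above X \<Longrightarrow> x \<le> Sup X"
      unfolding Sup_ray_def using Inf[of "{u. \<forall>x\<in>X. x \<le> u}"] by (auto simp: bdd_above_def)
    show "X \<noteq> {} \<Longrightarrow> (\<And>y. y \<in> X \<Longrightarrow> y \<le> x) \<Longrightarrow> Sup X \<le> x"
      unfolding Sup_ray_def using Inf[of "{u. \<forall>x\<in>X. x \<le> u}"] by auto
    have "Abs_ray (undefined :: 'a, 0) \<noteq> Abs_ray (undefined, 1/2)"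
      by (subst Abs_ray_eq_iff) auto
    then show "\<exists>a b::'a ray. a \<noteq> b" by blast
  qed (auto simp: inf_ray_def sup_ray_def)
qed

end

instance ray :: (omega_one) no_top
proof
  fix x :: "'a ray"
  obtain b where b: "fst (Rep_ray x) < b" using countable_bounded_omega_one[of "{fst (Rep_ray x)}"] by auto
  then show "\<exists>y. x < y" by (intro exI[of _ "Abs_ray (b, 0)"]) (simp add: less_ray_def Abs_ray_inverse')
qed

lemma countable_bounded_ray:
  fixes X :: "'a::omega_one ray set"
  assumes "countable X"
  obtains b where "\<And>x. x \<in> X \<Longrightarrow> x < b"
proof -
  have "countable ((fst \<circ> Rep_ray) ` X)" using assms by simp
  from countable_bounded_omega_one[OF this] obtain b where b: "\<forall>x\<in>X. fst (Rep_ray x) < b" by auto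
  show thesis
    by (rule that[of "Abs_ray (b, 0)"]) (use b in \<open>simp add: less_ray_def Abs_ray_inverse'\<close>)
qed

text \<open>The countably many ordinals below the first coordinate of \<open>q\<close> get summable weights;
  \<open>m (c, t)\<close> is the total weight below \<open>c\<close> plus \<open>t\<close> times the weight of \<open>c\<close>.\<close>

lemma ray_initial_segment:
  fixes q :: "'a::omega_one ray"
  obtains m :: "'a ray \<Rightarrow> real" and T
    where "strict_mono_on {..<q} m" "m ` {..<q} = {0..<T}"
proof -
  define a where "a = fst (Rep_ray q)"
  \<comment> \<open>The injection into the naturals must also cover \<open>a\<close> itself, because
    the part of the fibre over \<open>a\<close> below \<open>q\<close> is measured as well.\<close>
  obtain b where ab: "a < b" using countable_bounded_omega_one[of "{a}"] by auto
  obtain e :: "'a \<Rightarrow> nat" where e: "inj_on e {..<b}"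
    using countable_lessThan[of b] by (auto simp: countable_def)
  define w where "w A = (\<Sum>n. if n \<in> e ` A then (1/2::real)^n else 0)" for A
  have sm: "summable (\<lambda>n. if n \<in> N then (1/2::real)^n else 0)" for N
    by (rule summable_comparison_test'[of "\<lambda>n. (1/2::real)^n" 0]) auto
  have w_mono: "w A \<le> w B" if "A \<subseteq> B" for A B
    unfolding w_def using that by (intro suminf_le sm) auto
  have w_empty: "w {} = 0" by (simp add: w_def)
  have w_insert: "w (insert c A) = w A + (1/2)^e c" if "c < b" "A \<subseteq> {..<b}" "c \<notin> A" for c A
  proof -
    have n: "e c \<notin> e ` A" using that e by (auto dest: inj_onD)
    have "(\<lambda>n. if n \<in> e ` insert c A then (1/2::real)^n else 0) =
      (\<lambda>n. (if n \<in> e ` A then (1/2)^n else 0) + (if n \<in> {e c} then (1/2)^n else 0))"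
      using n by auto
    then have "w (insert c A) = w A + (\<Sum>n. if n \<in> {e c} then (1/2::real)^n else 0)"
      unfolding w_def by (simp only: suminf_add[OF sm sm])
    also have "(\<Sum>n. if n \<in> {e c} then (1/2::real)^n else 0) = (1/2)^e c"
      by (subst suminf_finite[of "{e c}"]) auto
    finally show ?thesis .
  qed
  define m where "m x = w {..<fst (Rep_ray x)} + snd (Rep_ray x) * (1/2)^e (fst (Rep_ray x))" for x :: "'a ray"
  have w_Suc: "w {..c} = w {..<c} + (1/2)^e c" if "c < b" for c
    using w_insert[of c "{..<c}"] that by (auto simp: ivl_disj_un_singleton(2)[symmetric])
  have m_lt: "m x < w {..fst (Rep_ray x)}" if "fst (Rep_ray x) < b" for x
    using w_Suc[OF that] Rep_ray_bounds[of x] by (simp add: m_def mult_strict_right_mono)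
  have m_ge: "w {..<fst (Rep_ray x)} \<le> m x" for x
    using Rep_ray_bounds[of x] by (simp add: m_def)
  have mono: "m x < m y" if "x < y" "fst (Rep_ray y) < b" for x y
  proof (cases "fst (Rep_ray x) < fst (Rep_ray y)")
    case True
    then have "m x < w {..fst (Rep_ray x)}" using that by (intro m_lt) auto
    also have "\<dots> \<le> w {..<fst (Rep_ray y)}" using True by (intro w_mono) auto
    also have "\<dots> \<le> m y" by (rule m_ge)
    finally show ?thesis .
  next
    case False
    then show ?thesis using that by (auto simp: less_ray_def m_def)
  qed
  have qb: "fst (Rep_ray x) < b" if "x < q" for x
    using that ab unfolding a_def less_ray_def by auto
  have q: "fst (Rep_ray q) < b" using ab a_def by simp
  show thesis
  proof (rule that[of m "m q"])
    show "strict_mono_on {..<q} m" by (auto simp: strict_mono_on_def intro!: mono qb)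
    show "m ` {..<q} = {0..<m q}"
    proof (intro equalityI subsetI)
      fix r assume "r \<in> m ` {..<q}"
      then obtain x where x: "r = m x" "x < q" by auto
      have "0 \<le> m x" using m_ge[of x] w_mono[of "{}"] w_empty by (metis empty_subsetI order_trans)
      then show "r \<in> {0..<m q}" using x mono[OF x(2) q] by simp
    next
      fix r assume r: "r \<in> {0..<m q}"
      define c where "c = (LEAST c. r < w {..c})"
      have ex: "r < w {..a}" using m_lt[OF q] r by (auto simp: a_def)
      have rc: "r < w {..c}" unfolding c_def using ex by (rule LeastI)
      have ca: "c \<le> a" unfolding c_def using ex by (rule Least_le)
      have nc: "w {..d} \<le> r" if "d < c" for d using that not_less_Least[of d] unfolding c_def by force
      have cb: "c < b" using ca ab by simp
      \<comment> \<open>The case that matters is a limit \<open>c\<close>. The weight below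
        \<open>c\<close> is approached by finite partial sums, each supported at or below some
        \<open>d < c\<close>, and minimality of \<open>c\<close> bounds \<open>w {..d}\<close> by
        \<open>r\<close>.\<close>
      have wc: "w {..<c} \<le> r"
      proof (rule ccontr)
        assume "\<not> w {..<c} \<le> r"
        then have rw: "r < w {..<c}" by simp
        let ?f = "\<lambda>n. if n \<in> e ` {..<c} then (1/2::real)^n else 0"
        have "(\<lambda>n. sum ?f {..<n}) \<longlonglongrightarrow> w {..<c}"
          unfolding w_def using summable_LIMSEQ[OF sm] by simp
        then obtain n where n: "r < sum ?f {..<n}"
          using order_tendstoD(1)[OF _ rw] by (metis (mono_tags, lifting) eventually_sequentially order_refl)
        define D where "D = {d. d < c \<and> e d < n}"
        have "inj_on e D" using e cb by (auto simp: D_def inj_on_def)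
        moreover have "finite (e ` D)" by (rule finite_subset[of _ "{..<n}"]) (auto simp: D_def)
        ultimately have fD: "finite D" using finite_imageD by blast
        have "D \<noteq> {}"
        proof
          assume "D = {}"
          then have "sum ?f {..<n} = 0" by (intro sum.neutral) (auto simp: D_def)
          then show False using n r by simp
        qed
        define d where "d = Max D"
        have d: "d < c" using Max_in[OF fD \<open>D \<noteq> {}\<close>] by (simp add: d_def D_def)
        have "sum ?f {..<n} \<le> sum (\<lambda>k. if k \<in> e ` {..d} then (1/2::real)^k else 0) {..<n}"
        proof (rule sum_mono)
          fix k assume "k \<in> {..<n}"
          then have "k \<in> e ` {..d}" if "k \<in> e ` {..<c}"
            using that Max_ge[OF fD] by (auto simp: D_def d_def)
          then show "?f k \<le> (if k \<in> e ` {..d} then (1/2::real)^k else 0)" by auto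
        qed
        also have "\<dots> \<le> w {..d}" unfolding w_def by (intro sum_le_suminf sm) auto
        also have "\<dots> \<le> r" by (rule nc[OF d])
        finally show False using n by simp
      qed
      define t where "t = (r - w {..<c}) * 2^e c"
      have t: "0 \<le> t" "t < 1" using wc rc w_Suc[OF cb] by (auto simp: t_def field_simps)
      define x where "x = Abs_ray (c, t)"
      have Rx: "Rep_ray x = (c, t)" using t by (simp add: x_def Abs_ray_inverse')
      have mx: "m x = r" by (simp add: m_def Rx t_def field_simps)
      have "x < q"
      proof (rule ccontr)
        assume "\<not> x < q"
        then have "q < x \<or> x = q" by auto
        then have "m q \<le> m x" using mono[of q x] Rx cb by auto
        then show False using mx r by simp
      qed
      then show "r \<in> m ` {..<q}" using mx by auto
    qed
  qed
qed

text \<open>The interval is the image of a real one under the inverse of the measure from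
  \<open>ray_initial_segment\<close>. That inverse is monotone with open image, hence continuous
  without any computation with the weights.\<close>

lemma compact_Icc_ray: "compact {a..b::'a::omega_one ray}"
proof -
  obtain q where q: "b < q" using gt_ex by blast
  obtain m :: "'a ray \<Rightarrow> real" and T where m: "strict_mono_on {..<q} m" "m ` {..<q} = {0..<T}"
    by (rule ray_initial_segment)
  have inj: "inj_on m {..<q}" using m(1) by (rule strict_mono_on_imp_inj_on)
  define n where "n = inv_into {..<q} m"
  have nm: "n (m x) = x" if "x < q" for x using that inj by (simp add: n_def)
  have ni: "n ` {0..<T} = {..<q}"
    unfolding m(2)[symmetric] image_image using nm by (auto simp: image_iff)
  have mn: "m (n r) = r" if "r \<in> {0..<T}" for r using that m(2) by (metis f_inv_into_f n_def)
  have "continuous_on {0..<T} n"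
  proof (rule continuous_onI_mono)
    show "open (n ` {0..<T})" by (simp add: ni)
    fix x y assume xy: "x \<in> {0..<T}" "y \<in> {0..<T}" "x \<le> y"
    show "n x \<le> n y"
    proof (rule ccontr)
      assume "\<not> n x \<le> n y"
      moreover have "n x < q" "n y < q" using ni xy by auto
      ultimately have "m (n y) < m (n x)" using m(1) by (auto simp: strict_mono_on_def)
      then show False using mn xy by simp
    qed
  qed
  moreover have "{a..b} = n ` {m a..m b}" if "a \<le> b"
  proof -
    have sub: "m x \<in> {0..<T}" if "x < q" for x using that m(2) by auto
    show ?thesis
    proof (intro equalityI subsetI)
      fix x assume x: "x \<in> {a..b}"
      then have "x < q" using q by (meson atLeastAtMost_iff order_le_less_trans)
      then have "x = n (m x)" by (simp add: nm)
      moreover have "m x \<in> {m a..m b}"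
        using x q m(1) by (auto simp: strict_mono_on_leD)
      ultimately show "x \<in> n ` {m a..m b}" by blast
    next
      fix x assume "x \<in> n ` {m a..m b}"
      then obtain r where r: "x = n r" "m a \<le> r" "r \<le> m b" by auto
      then have rT: "r \<in> {0..<T}" using sub[of a] sub[of b] q that order_le_less_trans[of a b q] by auto
      then have xq: "x < q" using ni r by auto
      have "m x = r" using mn rT r by simp
      then have "m a \<le> m x" "m x \<le> m b" using r by simp_all
      then show "x \<in> {a..b}"
        using xq order_le_less_trans[OF that q] q strict_mono_on_less_eq[OF m(1)] by auto
    qed
  qed
  moreover have "{m a..m b} \<subseteq> {0..<T}" if "a \<le> b"
  proof -
    have "m a \<in> {0..<T}" "m b \<in> {0..<T}" using m(2) q order_le_less_trans[OF that q] by auto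
    then show ?thesis by auto
  qed
  ultimately show ?thesis
    by (cases "a \<le> b") (auto intro: compact_continuous_image continuous_on_subset)
qed

lemma ray_interval_real:
  fixes p q :: "'a::omega_one ray"
  assumes "p < q"
  obtains e :: "'a ray \<Rightarrow> real" and g
  where "homeomorphism {p<..<q} UNIV e g" "strict_mono_on {p<..<q} e" "strict_mono g"
proof -
  obtain q' where q': "q < q'" using gt_ex by blast
  obtain m :: "'a ray \<Rightarrow> real" and T where m: "strict_mono_on {..<q'} m" "m ` {..<q'} = {0..<T}"
    by (rule ray_initial_segment)
  have less: "m x < m y \<longleftrightarrow> x < y" if "x < q'" "y < q'" for x y
    using strict_mono_on_less[OF m(1)] that by simp
  define u v where "u = m p" and "v = m q"
  have uv: "u < v" using assms q' by (auto simp: u_def v_def less)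
  \<comment> \<open>The logit of the relative position between \<open>u\<close> and
    \<open>v\<close>, an increasing bijection of that interval onto the line; \<open>l_surj\<close>
    solves \<open>l r = y\<close> for \<open>r\<close>.\<close>
  define l where "l r = ln ((r - u) / (v - r))" for r
  have l_mono: "l r < l s" if "u < r" "r < s" "s < v" for r s
  proof -
    have "(r - u) / (v - r) < (s - u) / (v - s)"
      using that by (intro frac_less) auto
    then show ?thesis using that by (simp add: l_def)
  qed
  have l_surj: "\<exists>r. u < r \<and> r < v \<and> l r = y" for y
  proof (intro exI conjI)
    let ?r = "(u + v * exp y) / (1 + exp y)"
    have p: "0 < 1 + exp y" by (simp add: add_pos_pos)
    show "u < ?r" using uv p by (simp add: field_simps)
    show "?r < v" using uv p by (simp add: field_simps)
    have "?r - u = (v - u) * exp y / (1 + exp y)" "v - ?r = (v - u) / (1 + exp y)"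
      using p by (auto simp: field_simps)
    then have "(?r - u) / (v - ?r) = exp y" using uv p by simp
    then show "l ?r = y" by (simp add: l_def)
  qed
  define e where "e x = l (m x)" for x
  have range: "u < m x" "m x < v" if "x \<in> {p<..<q}" for x
    using that q' by (auto simp: u_def v_def less)
  have e_mono: "strict_mono_on {p<..<q} e"
    unfolding strict_mono_on_def e_def using q' by (auto intro!: l_mono range simp: less)
  have inj: "inj_on e {p<..<q}" using e_mono by (rule strict_mono_on_imp_inj_on)
  have surj: "e ` {p<..<q} = UNIV"
  proof (intro equalityI subsetI)
    fix y :: real
    obtain r where r: "u < r" "r < v" "l r = y" using l_surj by blast
    have "m p \<in> {0..<T}" "m q \<in> {0..<T}" using m(2) assms q' by auto
    then have "r \<in> {0..<T}" using r by (auto simp: u_def v_def)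
    then obtain x where x: "x < q'" "r = m x" using m(2) by (metis imageE lessThan_iff)
    then have "x \<in> {p<..<q}" using r assms q' by (auto simp: u_def v_def less)
    then show "y \<in> e ` {p<..<q}" using r x by (auto simp: e_def)
  qed simp
  define g where "g = inv_into {p<..<q} e"
  have ge: "g (e x) = x" if "x \<in> {p<..<q}" for x using that inj by (simp add: g_def)
  have eg: "e (g y) = y" for y using surj by (simp add: g_def f_inv_into_f)
  have gi: "g y \<in> {p<..<q}" for y using surj by (metis UNIV_I g_def inv_into_into)
  have g_mono: "strict_mono g"
  proof (rule strict_monoI)
    fix x y :: real assume "x < y"
    then show "g x < g y" using strict_mono_on_less[OF e_mono gi gi, of x y] eg by simp
  qed
  have gim: "g ` UNIV = {p<..<q}" using gi ge by (metis UNIV_I image_eqI image_subset_iff subsetI subset_antisym)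
  have "continuous_on {p<..<q} e"
    by (rule continuous_onI_mono) (use surj e_mono in \<open>auto simp: strict_mono_on_leD\<close>)
  moreover have "continuous_on UNIV g"
    by (rule continuous_onI_mono) (use gim g_mono in \<open>auto simp: strict_mono_less_eq\<close>)
  ultimately have "homeomorphism {p<..<q} UNIV e g"
    using surj gim ge eg by (auto simp: homeomorphism_def)
  then show thesis using e_mono g_mono that by blast
qed

text \<open>A substitute for intersecting countably many closed unbounded sets: \<open>z\<close> is the supremum of an
  increasing sequence in which each requirement is met infinitely often.\<close>

lemma interleave:
  fixes Q :: "nat \<Rightarrow> 'a::omega_one ray \<Rightarrow> 'a ray \<Rightarrow> bool" and x :: "'a ray"
  assumes "\<And>n x. \<exists>y>x. Q n x y"
  obtains z where "x < z"
    "\<And>n. \<exists>u v. u \<longlonglongrightarrow> z \<and> v \<longlonglongrightarrow> z \<and> (\<forall>k. x \<le> u k \<and> u k < v k \<and> v k < z \<and> Q n (u k) (v k))"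
proof -
  \<comment> \<open>The first component of the pairing function takes every value infinitely often.
    Requirement \<open>n\<close> is thus imposed at the stages \<open>prod_encode (n, j)\<close>,
    which are cofinal.\<close>
  define m where "m k = fst (prod_decode k)" for k
  define X where "X = rec_nat x (\<lambda>k y. SOME y'. y < y' \<and> Q (m k) y y')"
  have X0: "X 0 = x" by (simp add: X_def)
  have XS: "X k < X (Suc k) \<and> Q (m k) (X k) (X (Suc k))" for k
  proof -
    have "X (Suc k) = (SOME y'. X k < y' \<and> Q (m k) (X k) y')" by (simp add: X_def)
    then show ?thesis using someI_ex[OF assms[of "X k" "m k"]] by simp
  qed
  have sm: "strict_mono X" by (simp add: strict_mono_Suc_iff XS)
  obtain b where b: "\<And>x. x \<in> range X \<Longrightarrow> x < b" by (rule countable_bounded_ray[of "range X"]) auto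
  have bdd: "bdd_above (range X)" by (rule bdd_aboveI[of _ b]) (use b less_imp_le in blast)
  define z where "z = (SUP k. X k)"
  have lim: "X \<longlonglongrightarrow> z" unfolding z_def
    by (rule LIMSEQ_incseq_SUP[OF bdd strict_mono_mono[OF sm, THEN monoD, THEN incseq_def[THEN iffD2, OF allI, OF allI, OF impI]]])
  have lt: "X k < z" for k
  proof -
    have "X k < X (Suc k)" using XS by blast
    also have "\<dots> \<le> z" unfolding z_def by (rule cSUP_upper[OF _ bdd]) simp
    finally show ?thesis .
  qed
  show thesis
  proof
    show "x < z" using lt[of 0] X0 by simp
    fix n
    define s where "s j = prod_encode (n, j)" for j
    have ms: "m (s j) = n" for j by (simp add: m_def s_def)
    have ss: "strict_mono s"
      unfolding strict_mono_Suc_iff s_def prod_encode_def triangle_def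
      by (auto intro!: add_less_le_mono div_le_mono mult_le_mono)
    have "(X \<circ> s) \<longlonglongrightarrow> z" by (rule LIMSEQ_subseq_LIMSEQ[OF lim ss])
    moreover have "strict_mono (\<lambda>k. Suc (s k))" using ss by (simp add: strict_mono_def)
    then have "(X \<circ> (\<lambda>k. Suc (s k))) \<longlonglongrightarrow> z" by (rule LIMSEQ_subseq_LIMSEQ[OF lim])
    moreover have "x \<le> X (s k)" for k using sm X0 by (metis le0 strict_mono_less_eq)
    ultimately show "\<exists>u v. u \<longlonglongrightarrow> z \<and> v \<longlonglongrightarrow> z \<and> (\<forall>k. x \<le> u k \<and> u k < v k \<and> v k < z \<and> Q n (u k) (v k))"
      using XS[of "s _"] ms lt
      by (intro exI[of _ "X \<circ> s"] exI[of _ "X \<circ> (\<lambda>k. Suc (s k))"]) auto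
  qed
qed

section \<open>Isotopies\<close>

lemma isotopy_homeomorphism:
  assumes "isotopy \<phi>" "t \<in> {0..1}"
  obtains g where "homeomorphism UNIV UNIV (\<phi> t) g"
  using assms unfolding isotopy_def by blast

lemma isotopy_conjugate:
  assumes iso: "isotopy \<phi>" and st: "homeomorphism UNIV UNIV \<sigma> \<tau>"
  shows "isotopy (\<lambda>t. \<tau> \<circ> \<phi> t \<circ> \<sigma>)"
  unfolding isotopy_def
proof
  have c: "continuous_on (UNIV \<times> {0..1}) (\<lambda>(y, t). \<phi> t y)"
    using iso by (simp add: isotopy_def)
  have s: "continuous_on UNIV \<sigma>" "continuous_on UNIV \<tau>" using st by (auto simp: homeomorphism_def)
  have "continuous_on (UNIV \<times> {0..1}) (\<lambda>p. \<tau> ((\<lambda>(y, t). \<phi> t y) (\<sigma> (fst p), snd p)))"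
    by (intro continuous_on_compose2[OF s(2)] continuous_on_compose2[OF c]
        continuous_on_compose2[OF s(1)] continuous_intros) auto
  then show "continuous_on (UNIV \<times> {0..1}) (\<lambda>(y, t). (\<tau> \<circ> \<phi> t \<circ> \<sigma>) y)"
    by (simp add: case_prod_unfold)
  show "\<forall>t\<in>{0..1}. \<exists>g. homeomorphism UNIV UNIV (\<tau> \<circ> \<phi> t \<circ> \<sigma>) g"
    using iso st homeomorphism_compose homeomorphism_symD unfolding isotopy_def by meson
qed

lemma isotopy_compose:
  assumes "isotopy \<phi>" "isotopy \<theta>"
  shows "isotopy (\<lambda>t. \<theta> t \<circ> \<phi> t)"
  unfolding isotopy_def
proof
  have c: "continuous_on (UNIV \<times> {0..1}) (\<lambda>(y, t). \<phi> t y)"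
    "continuous_on (UNIV \<times> {0..1}) (\<lambda>(y, t). \<theta> t y)"
    using assms by (simp_all add: isotopy_def)
  have "continuous_on (UNIV \<times> {0..1}) (\<lambda>p. (\<lambda>(y, t). \<theta> t y) ((\<lambda>(y, t). \<phi> t y) p, snd p))"
    by (intro continuous_on_compose2[OF c(2)] continuous_on_Pair c continuous_intros) auto
  then show "continuous_on (UNIV \<times> {0..1}) (\<lambda>(y, t). (\<theta> t \<circ> \<phi> t) y)"
    by (simp add: case_prod_unfold)
  show "\<forall>t\<in>{0..1}. \<exists>g. homeomorphism UNIV UNIV (\<theta> t \<circ> \<phi> t) g"
    using assms homeomorphism_compose unfolding isotopy_def by blast
qed

text \<open>Time is reversed and the inverse of the end map is applied first. This avoids proving
  that the inverses of the maps \<open>\<phi> t\<close> depend continuously on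
  \<open>t\<close>.\<close>

lemma isotopy_inverse:
  assumes iso: "isotopy \<phi>" and "\<phi> 0 = id"
  obtains \<theta> where "isotopy \<theta>" "\<theta> 0 = id" "\<And>y. \<theta> 1 (\<phi> 1 y) = y"
proof -
  obtain k where k: "homeomorphism UNIV UNIV (\<phi> 1) k"
    using iso by (rule isotopy_homeomorphism[where t = 1]) auto
  have k1: "k (\<phi> 1 y) = y" "\<phi> 1 (k y) = y" for y
    using k unfolding homeomorphism_def by blast+
  have c: "continuous_on (UNIV \<times> {0..1}) (\<lambda>(y, t). \<phi> t y)"
    using iso by (simp add: isotopy_def)
  have ck: "continuous_on UNIV k" using k by (simp add: homeomorphism_def)
  have "isotopy (\<lambda>t. \<phi> (1 - t) \<circ> k)"
    unfolding isotopy_def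
  proof
    have "continuous_on (UNIV \<times> {0..1}) (\<lambda>p. (\<lambda>(y, t). \<phi> t y) (k (fst p), 1 - snd p))"
      by (intro continuous_on_compose2[OF c] continuous_intros continuous_on_compose2[OF ck]) auto
    then show "continuous_on (UNIV \<times> {0..1}) (\<lambda>(y, t). (\<phi> (1 - t) \<circ> k) y)"
      by (simp add: case_prod_unfold)
    have "\<exists>h. homeomorphism UNIV UNIV (\<phi> (1 - t)) h" if "t \<in> {0..1}" for t
      using iso that by (auto simp: isotopy_def)
    then show "\<forall>t\<in>{0..1}. \<exists>h. homeomorphism UNIV UNIV (\<phi> (1 - t) \<circ> k) h"
      using homeomorphism_compose[OF homeomorphism_symD[OF k]] by blast
  qed
  then show thesis
    by (rule that) (use k1 \<open>\<phi> 0 = id\<close> in auto)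
qed

lemma isotopy_map_prod:
  assumes "isotopy \<phi>" "isotopy \<theta>"
  shows "isotopy (\<lambda>t. map_prod (\<phi> t) (\<theta> t))"
  unfolding isotopy_def
proof
  have c: "continuous_on (UNIV \<times> {0..1}) (\<lambda>(y, t). \<phi> t y)"
    "continuous_on (UNIV \<times> {0..1}) (\<lambda>(y, t). \<theta> t y)"
    using assms by (simp_all add: isotopy_def)
  have "continuous_on (UNIV \<times> {0..1})
      (\<lambda>p. ((\<lambda>(y, t). \<phi> t y) (fst (fst p), snd p), (\<lambda>(y, t). \<theta> t y) (snd (fst p), snd p)))"
    by (intro continuous_on_Pair continuous_on_compose2[OF c(1)] continuous_on_compose2[OF c(2)] continuous_intros) auto
  then show "continuous_on (UNIV \<times> {0..1}) (\<lambda>(y, t). map_prod (\<phi> t) (\<theta> t) y)"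
    by (simp add: case_prod_unfold map_prod_def)
  show "\<forall>t\<in>{0..1}. \<exists>g. homeomorphism UNIV UNIV (map_prod (\<phi> t) (\<theta> t)) g"
  proof
    fix t :: real assume t: "t \<in> {0..1}"
    obtain g h where g: "homeomorphism UNIV UNIV (\<phi> t) g" and h: "homeomorphism UNIV UNIV (\<theta> t) h"
      using assms t by (meson isotopy_homeomorphism)
    have cont: "continuous_on UNIV (map_prod a b)"
      if "continuous_on UNIV a" "continuous_on UNIV b"
      for a :: "'c::topological_space \<Rightarrow> 'd::topological_space" and b :: "'e::topological_space \<Rightarrow> 'f::topological_space"
      unfolding map_prod_def case_prod_unfold
      by (intro continuous_on_Pair continuous_on_compose2[OF that(1)] continuous_on_compose2[OF that(2)] continuous_intros) auto
    have "homeomorphism UNIV UNIV (map_prod (\<phi> t) (\<theta> t)) (map_prod g h)"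
      by (rule homeomorphismI) (use g h in \<open>auto intro!: cont simp: homeomorphism_def\<close>)
    then show "\<exists>g. homeomorphism UNIV UNIV (map_prod (\<phi> t) (\<theta> t)) g" by blast
  qed
qed

text \<open>The open set \<open>B\<close> and the complement of the image of \<open>K\<close> under
  \<open>g\<close> cover the space, and the two descriptions of the map agree on the overlap.
  Compactness of \<open>K\<close> is what makes its image closed in the whole Hausdorff space and
  not only in \<open>B\<close>.\<close>

lemma extension_by_id_continuous:
  fixes j :: "'y::t2_space \<Rightarrow> 'e::topological_space"
  assumes B: "open B" and hom: "homeomorphism B UNIV j g"
    and c: "continuous_on (UNIV \<times> I) (\<lambda>(p, t). \<Phi> t p)"
    and K: "compact K" and id: "\<And>t p. t \<in> I \<Longrightarrow> p \<notin> K \<Longrightarrow> \<Phi> t p = p"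
  shows "continuous_on (UNIV \<times> I) (\<lambda>(y, t). if y \<in> B then g (\<Phi> t (j y)) else y)"
proof -
  have g: "continuous_on UNIV g" and j: "continuous_on B j" and im: "g ` UNIV = B"
    and inv: "\<And>y. y \<in> B \<Longrightarrow> g (j y) = y" "\<And>p. j (g p) = p"
    using hom by (auto simp: homeomorphism_def)
  have "compact (g ` K)" using g K by (meson compact_continuous_image continuous_on_subset subset_UNIV)
  then have cl: "closed (g ` K)" by (rule compact_imp_closed)
  let ?f = "\<lambda>(y, t). if y \<in> B then g (\<Phi> t (j y)) else y"
  let ?S = "B \<times> I" and ?T = "(- g ` K) \<times> I"
  have un: "UNIV \<times> I = ?S \<union> ?T" using im by auto
  have "continuous_on ?S (\<lambda>p. g ((\<lambda>(p, t). \<Phi> t p) (j (fst p), snd p)))"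
    by (intro continuous_on_compose2[OF g] continuous_on_compose2[OF c] continuous_intros
        continuous_on_compose2[OF j]) auto
  then have 1: "continuous_on ?S ?f"
    by (rule continuous_on_eq) auto
  have "continuous_on ?T fst" by (intro continuous_intros)
  then have 2: "continuous_on ?T ?f"
  proof (rule continuous_on_eq)
    fix x assume x: "x \<in> ?T"
    have "j (fst x) \<notin> K" if "fst x \<in> B" using inv(1)[OF that] x by force
    then show "fst x = ?f x" using x id inv by (auto split: prod.splits)
  qed
  have op: "openin (top_of_set (UNIV \<times> I)) (A \<times> I)" if "open A" for A :: "'y set"
  proof -
    have "A \<times> I = (UNIV \<times> I) \<inter> (A \<times> UNIV)" by auto
    then show ?thesis using that by (metis openin_open_Int open_Times open_UNIV)
  qed
  show ?thesis
    unfolding un by (rule continuous_on_Un_local_open)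
      (use 1 2 op B cl in \<open>auto simp: un[symmetric]\<close>)
qed

lemma isotopy_extension_by_id:
  fixes j :: "'y::t2_space \<Rightarrow> 'e::topological_space"
  assumes B: "open B" and hom: "homeomorphism B UNIV j g"
    and iso: "isotopy \<Phi>" and K: "compact K" and id: "\<And>t p. t \<in> {0..1} \<Longrightarrow> p \<notin> K \<Longrightarrow> \<Phi> t p = p"
  shows "isotopy (\<lambda>t y. if y \<in> B then g (\<Phi> t (j y)) else y)"
  unfolding isotopy_def
proof
  have c: "continuous_on (UNIV \<times> {0..1}) (\<lambda>(p, t). \<Phi> t p)"
    using iso by (simp add: isotopy_def)
  show "continuous_on (UNIV \<times> {0..1}) (\<lambda>(y, t). if y \<in> B then g (\<Phi> t (j y)) else y)"
    by (rule extension_by_id_continuous[OF B hom c K id])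
  have inv: "\<And>y. y \<in> B \<Longrightarrow> g (j y) = y" "\<And>p. j (g p) = p" "\<And>p. g p \<in> B"
    using hom by (auto simp: homeomorphism_def)
  show "\<forall>t\<in>{0..1}. \<exists>h. homeomorphism UNIV UNIV (\<lambda>y. if y \<in> B then g (\<Phi> t (j y)) else y) h"
  proof
    fix t :: real assume t: "t \<in> {0..1}"
    obtain \<Psi> where \<Psi>: "homeomorphism UNIV UNIV (\<Phi> t) \<Psi>" using iso t by (rule isotopy_homeomorphism)
    have \<Psi>1: "\<Psi> (\<Phi> t p) = p" "\<Phi> t (\<Psi> p) = p" for p using \<Psi> by (auto simp: homeomorphism_def)
    have idinv: "\<Psi> p = p" if "p \<notin> K" for p using \<Psi>1(1)[of p] id[OF t that] by simp
    let ?\<phi> = "\<lambda>y. if y \<in> B then g (\<Phi> t (j y)) else y" and ?\<psi> = "\<lambda>y. if y \<in> B then g (\<Psi> (j y)) else y"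
    \<comment> \<open>\<open>slice\<close> and \<open>unslice\<close> treat a single map as a family
      over the one-point index set \<open>{0}\<close>, so that
      \<open>extension_by_id_continuous\<close> also yields continuity of each map and of its
      inverse.\<close>
    have slice: "continuous_on UNIV f" if "continuous_on (UNIV \<times> {0::real}) (\<lambda>(y, t). f y)"
      for f :: "'z::topological_space \<Rightarrow> 'z"
    proof -
      have "continuous_on UNIV (\<lambda>y::'z. (y, 0::real))" by (intro continuous_intros)
      then show ?thesis using continuous_on_compose2[OF that, of UNIV "\<lambda>y. (y, 0)"] by auto
    qed
    have unslice: "continuous_on (UNIV \<times> {0::real}) (\<lambda>(y, t). f y)" if "continuous_on UNIV f"
      for f :: "'e \<Rightarrow> 'e"
      unfolding case_prod_unfold by (intro continuous_on_compose2[OF that] continuous_intros) auto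
    have "continuous_on UNIV ?\<phi>"
      by (rule slice, rule extension_by_id_continuous[OF B hom _ K])
        (use \<Psi> id[OF t] in \<open>auto simp: homeomorphism_def intro!: unslice\<close>)
    moreover have "continuous_on UNIV ?\<psi>"
      by (rule slice, rule extension_by_id_continuous[OF B hom _ K])
        (use \<Psi> idinv in \<open>auto simp: homeomorphism_def intro!: unslice\<close>)
    ultimately have "homeomorphism UNIV UNIV ?\<phi> ?\<psi>"
      by (intro homeomorphismI) (use inv \<Psi>1 in auto)
    then show "\<exists>h. homeomorphism UNIV UNIV ?\<phi> h" by blast
  qed
qed

section \<open>Order automorphisms are isotopic to the identity\<close>

text \<open>Monotonicity turns separate into joint continuity: a lower bound at one point
  \<open>x1\<close> to the left of \<open>x\<close> holds everywhere above \<open>x1\<close>, so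
  only continuity in \<open>t\<close> at \<open>x1\<close> remains to be used. Upper bounds are
  treated symmetrically, and at an end of the order \<open>x1\<close> is \<open>x\<close>
  itself.\<close>

lemma continuous_on_mono_separately:
  fixes G :: "'t::topological_space \<Rightarrow> 'a::{linorder_topology, dense_order} \<Rightarrow> 'b::linorder_topology"
  assumes mono: "\<And>t x y. t \<in> I \<Longrightarrow> x \<le> y \<Longrightarrow> G t x \<le> G t y"
    and cx: "\<And>t. t \<in> I \<Longrightarrow> continuous_on UNIV (G t)"
    and ct: "\<And>x. continuous_on I (\<lambda>t. G t x)"
  shows "continuous_on (UNIV \<times> I) (\<lambda>(x, t). G t x)"
  unfolding continuous_on_def
proof (clarify, rule order_tendstoI)
  fix x t l assume t: "t \<in> I" and l: "l < G t x"
  have o: "open {y. l < G t y}" using cx[OF t] by (intro open_Collect_less continuous_intros)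
  obtain N x1 where N: "open N" "x \<in> N" "\<forall>y\<in>N. x1 \<le> y" "l < G t x1"
  proof (cases "\<exists>y. y < x")
    case True
    then obtain b where b: "b < x" "{b<..x} \<subseteq> {y. l < G t y}" using open_left[OF o, of x] l by auto
    obtain x1 where "b < x1" "x1 < x" using dense b by blast
    then have "x1 \<in> {b<..x}" by simp
    then show ?thesis using \<open>x1 < x\<close> b by (intro that[of "{x1<..}" x1]) (auto intro: less_imp_le)
  next
    case False
    then show ?thesis using that[of UNIV x] l by (auto simp: not_less)
  qed
  have "\<forall>\<^sub>F t' in at t within I. l < G t' x1"
    using ct[of x1] t N(4) by (auto simp: continuous_on_def dest: order_tendstoD(1))
  then obtain T where T: "open T" "t \<in> T" "\<forall>t'\<in>T. t' \<noteq> t \<longrightarrow> t' \<in> I \<longrightarrow> l < G t' x1"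
    unfolding eventually_at_topological by auto
  have "l < G t' y" if "y \<in> N" "t' \<in> T" "t' \<in> I" for y t'
    using T(3) N(4) mono[OF that(3), of x1 y] N(3) that by (cases "t' = t") (auto intro: less_le_trans)
  then show "\<forall>\<^sub>F p in at (x, t) within UNIV \<times> I. l < (case p of (x, t) \<Rightarrow> G t x)"
    unfolding eventually_at_topological
    by (intro exI[of _ "N \<times> T"]) (use N T in \<open>auto intro: open_Times\<close>)
next
  fix x t l assume t: "t \<in> I" and l: "G t x < l"
  have o: "open {y. G t y < l}" using cx[OF t] by (intro open_Collect_less continuous_intros)
  obtain N x1 where N: "open N" "x \<in> N" "\<forall>y\<in>N. y \<le> x1" "G t x1 < l"
  proof (cases "\<exists>y. x < y")
    case True
    then obtain b where b: "x < b" "{x..<b} \<subseteq> {y. G t y < l}" using open_right[OF o, of x] l by auto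
    obtain x1 where "x < x1" "x1 < b" using dense b by blast
    then have "x1 \<in> {x..<b}" by simp
    then show ?thesis using \<open>x < x1\<close> b by (intro that[of "{..<x1}" x1]) (auto intro: less_imp_le)
  next
    case False
    then show ?thesis using that[of UNIV x] l by (auto simp: not_less)
  qed
  have "\<forall>\<^sub>F t' in at t within I. G t' x1 < l"
    using ct[of x1] t N(4) by (auto simp: continuous_on_def dest: order_tendstoD(2))
  then obtain T where T: "open T" "t \<in> T" "\<forall>t'\<in>T. t' \<noteq> t \<longrightarrow> t' \<in> I \<longrightarrow> G t' x1 < l"
    unfolding eventually_at_topological by auto
  have "G t' y < l" if "y \<in> N" "t' \<in> T" "t' \<in> I" for y t'
    using T(3) N(4) mono[OF that(3), of y x1] N(3) that by (cases "t' = t") (auto intro: le_less_trans)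
  then show "\<forall>\<^sub>F p in at (x, t) within UNIV \<times> I. (case p of (x, t) \<Rightarrow> G t x) < l"
    unfolding eventually_at_topological
    by (intro exI[of _ "N \<times> T"]) (use N T in \<open>auto intro: open_Times\<close>)
qed

lemma strict_mono_surj_homeomorphism:
  fixes H :: "'a::{linorder_topology, dense_order} \<Rightarrow> 'b::{linorder_topology, dense_order}"
  assumes H: "strict_mono H" "surj H"
  shows "homeomorphism UNIV UNIV H (inv H)" "strict_mono (inv H)" "surj (inv H)"
proof -
  have inj: "inj H" using H(1) by (rule strict_mono_imp_inj_on)
  have *: "H (inv H y) = y" "inv H (H x) = x" for x y using H(2) inj by (auto simp: surj_f_inv_f)
  show sm: "strict_mono (inv H)"
    by (rule strict_monoI) (metis *(1) H(1) strict_mono_less)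
  show s: "surj (inv H)" using inj by (rule inj_imp_surj_inv)
  have "continuous_on UNIV H" "continuous_on UNIV (inv H)"
    using H s sm by (auto intro!: continuous_onI_mono simp: strict_mono_less_eq)
  then show "homeomorphism UNIV UNIV H (inv H)"
    by (intro homeomorphismI) (use * in auto)
qed

lemma isotopy_order_automorphisms:
  fixes G :: "real \<Rightarrow> 'a::{linorder_topology, dense_order} \<Rightarrow> 'a"
  assumes "\<And>t. t \<in> {0..1} \<Longrightarrow> strict_mono (G t)" "\<And>t. t \<in> {0..1} \<Longrightarrow> surj (G t)"
    and "\<And>x. continuous_on {0..1} (\<lambda>t. G t x)"
  shows "isotopy G"
  unfolding isotopy_def
proof
  have h: "homeomorphism UNIV UNIV (G t) (inv (G t))" if "t \<in> {0..1}" for t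
    using assms that by (intro strict_mono_surj_homeomorphism)
  then show "\<forall>t\<in>{0..1}. \<exists>g. homeomorphism UNIV UNIV (G t) g" by blast
  show "continuous_on (UNIV \<times> {0..1}) (\<lambda>(y, t). G t y)"
    using assms h by (intro continuous_on_mono_separately) (auto simp: strict_mono_less_eq homeomorphism_def)
qed

text \<open>Each stage of the interleaving lies above the images of the previous one under
  \<open>H\<close> and \<open>inv H\<close>. In the limit neither map raises \<open>z\<close>, and
  for mutually inverse increasing maps this means that \<open>z\<close> is fixed.\<close>

lemma order_automorphism_fixed_point_above:
  fixes H :: "'a::omega_one ray \<Rightarrow> 'a ray"
  assumes H: "strict_mono H" "surj H"
  shows "\<exists>c\<ge>x. H c = c"
proof -
  note h = strict_mono_surj_homeomorphism[OF H]
  have inv: "inv H (H y) = y" "H (inv H y) = y" for y using h(1) by (auto simp: homeomorphism_def)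
  have ex: "\<exists>y>x. H x \<le> y \<and> inv H x \<le> y" for x :: "'a ray"
  proof -
    obtain b where "\<And>y. y \<in> {x, H x, inv H x} \<Longrightarrow> y < b" by (rule countable_bounded_ray[of "{x, H x, inv H x}"]) auto
    then show ?thesis by (intro exI[of _ b]) (auto intro: less_imp_le)
  qed
  obtain z where "x < z" and z: "\<And>n::nat. \<exists>u v. u \<longlonglongrightarrow> z \<and> v \<longlonglongrightarrow> z \<and>
      (\<forall>k. x \<le> u k \<and> u k < v k \<and> v k < z \<and> H (u k) \<le> v k \<and> inv H (u k) \<le> v k)"
    by (rule interleave[of "\<lambda>n x y. H x \<le> y \<and> inv H x \<le> y" x]) (use ex in auto)
  obtain u v where uv: "u \<longlonglongrightarrow> z" "v \<longlonglongrightarrow> z" "\<And>k. H (u k) \<le> v k" "\<And>k. inv H (u k) \<le> v k"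
    using z by blast
  have c: "isCont H z" "isCont (inv H) z" using h(1) by (auto simp: homeomorphism_def continuous_on_eq_continuous_at)
  have "H z \<le> z"
    by (rule LIMSEQ_le[OF isCont_tendsto_compose[OF c(1) uv(1)] uv(2)]) (use uv in auto)
  moreover have "inv H z \<le> z"
    by (rule LIMSEQ_le[OF isCont_tendsto_compose[OF c(2) uv(1)] uv(2)]) (use uv in auto)
  then have "z \<le> H z" using H(1) inv by (metis strict_mono_less_eq)
  ultimately show ?thesis using \<open>x < z\<close> by (intro exI[of _ z]) auto
qed

lemma ray_least: "Abs_ray (LEAST a. True, 0) \<le> (x :: 'a::wellorder ray)"
  by (cases x rule: ray_cases) (auto simp: Abs_ray_le_iff le_less[symmetric] intro: Least_le)

text \<open>The isotopy interpolates linearly, in a real coordinate, on each component of the complement of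
  the fixed point set, which is a bounded interval.\<close>

proposition order_automorphism_isotopy:
  fixes H :: "'a::omega_one ray \<Rightarrow> 'a ray"
  assumes H: "strict_mono H" "surj H"
  obtains G where "isotopy G" "G 0 = id" "G 1 = H"
proof -
  note h = strict_mono_surj_homeomorphism[OF H]
  have inv: "inv H (H y) = y" "H (inv H y) = y" for y using h(1) by (auto simp: homeomorphism_def)
  have Hle: "H x \<le> H y \<longleftrightarrow> x \<le> y" "H x < H y \<longleftrightarrow> x < y" for x y
    using H(1) by (auto simp: strict_mono_less_eq strict_mono_less)
  define C where "C = {c. H c = c}"
  define lo where "lo x = Sup {c\<in>C. c \<le> x}" for x
  define hi where "hi x = Inf {c\<in>C. x \<le> c}" for x
  \<comment> \<open>The least point of the ray is fixed because \<open>H\<close> is increasing and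
    onto, so there is always a fixed point below.\<close>
  have ne1: "{c\<in>C. c \<le> x} \<noteq> {}" for x
  proof -
    let ?b = "Abs_ray (LEAST a. True, 0) :: 'a ray"
    obtain y where "?b = H y" using H(2) by (metis surjD)
    then have "H ?b \<le> ?b" using Hle ray_least by metis
    then have "?b \<in> C" using ray_least by (auto simp: C_def intro: antisym)
    then show ?thesis using ray_least by auto
  qed
  have ne2: "{c\<in>C. x \<le> c} \<noteq> {}" for x
    using order_automorphism_fixed_point_above[OF H, of x] by (auto simp: C_def)
  have b1: "bdd_above {c\<in>C. c \<le> x}" and b2: "bdd_below {c\<in>C. x \<le> c}" for x by auto
  have lo: "lo x \<le> x" "\<And>c. c \<in> C \<Longrightarrow> c \<le> x \<Longrightarrow> c \<le> lo x" for x
    unfolding lo_def by (auto intro!: cSup_least[OF ne1] cSup_upper b1)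
  have hi: "x \<le> hi x" "\<And>c. c \<in> C \<Longrightarrow> x \<le> c \<Longrightarrow> hi x \<le> c" for x
    unfolding hi_def by (auto intro!: cInf_greatest[OF ne2] cInf_lower b2)
  have invle: "inv H x \<le> inv H y \<longleftrightarrow> x \<le> y" for x y using Hle inv by metis
  have Cinv: "inv H c = c" "H c = c" if "c \<in> C" for c using that inv(1)[of c] by (auto simp: C_def)
  have loC: "lo x \<in> C" for x
  proof -
    have "c \<le> H (lo x)" "c \<le> inv H (lo x)" if "c \<in> C" "c \<le> x" for c
      using lo(2)[OF that] Cinv[OF that(1)] Hle invle by metis+
    then have "lo x \<le> H (lo x)" "lo x \<le> inv H (lo x)"
      by (auto simp: lo_def[of x] intro!: cSup_least[OF ne1])
    then show ?thesis unfolding C_def using Hle inv by (metis (mono_tags) antisym mem_Collect_eq)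
  qed
  have hiC: "hi x \<in> C" for x
  proof -
    have "H (hi x) \<le> c" "inv H (hi x) \<le> c" if "c \<in> C" "x \<le> c" for c
      using hi(2)[OF that] Cinv[OF that(1)] Hle invle by metis+
    then have "H (hi x) \<le> hi x" "inv H (hi x) \<le> hi x"
      by (auto simp: hi_def[of x] intro!: cInf_greatest[OF ne2])
    then show ?thesis unfolding C_def using Hle inv by (metis (mono_tags) antisym mem_Collect_eq)
  qed
  define J where "J x = {lo x<..<hi x}" for x
  have J: "x \<in> J x" if "x \<notin> C" for x
    using lo(1)[of x] hi(1)[of x] loC[of x] hiC[of x] that by (auto simp: J_def order_less_le)
  have nC: "y \<notin> C" if "y \<in> J x" for x y
    using lo(2)[of y x] hi(2)[of y x] that le_cases[of x y] by (auto simp: J_def dest: leD)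
  have Jeq: "lo y = lo x" "hi y = hi x" if "y \<in> J x" for x y
  proof -
    have a: "lo x < y" "y < hi x" using that by (auto simp: J_def)
    have "lo y \<le> x" using nC[OF that] hi(2)[OF loC, of x y] lo(1)[of y] a by force
    then have "lo y \<le> lo x" by (rule lo(2)[OF loC])
    moreover have "lo x \<le> lo y" by (rule lo(2)[OF loC]) (use a in simp)
    ultimately show "lo y = lo x" by simp
    have "x \<le> hi y" using lo(2)[OF hiC, of y x] hi(1)[of y] a by force
    then have "hi x \<le> hi y" by (rule hi(2)[OF hiC])
    moreover have "hi y \<le> hi x" by (rule hi(2)[OF hiC]) (use a in simp)
    ultimately show "hi y = hi x" by simp
  qed
  have JJ: "J y = J x" if "y \<in> J x" for x y using Jeq[OF that] by (simp add: J_def)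
  have HJ: "H y \<in> J x" "inv H y \<in> J x" if "y \<in> J x" for x y
    using that Hle[of "lo x" y] Hle[of y "hi x"] Cinv[OF loC[of x]] Cinv[OF hiC[of x]]
      Hle[of "lo x" "inv H y"] Hle[of "inv H y" "hi x"] inv by (auto simp: J_def)
  \<comment> \<open>The coordinates are chosen as functions of the two end points, so that all
    points of one component share the same coordinate; \<open>ereq\<close> relies on this.\<close>
  have "\<exists>e g. p < q \<longrightarrow> homeomorphism {p<..<q} (UNIV::real set) e g \<and> strict_mono_on {p<..<q} e \<and> strict_mono g"
    for p q :: "'a ray"
    by (cases "p < q") (auto elim!: ray_interval_real)
  then obtain E R where ER: "\<And>p q :: 'a ray. p < q \<Longrightarrow> homeomorphism {p<..<q} (UNIV::real set) (E p q) (R p q) \<and>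
      strict_mono_on {p<..<q} (E p q) \<and> strict_mono (R p q)" by metis
  define e where "e x = E (lo x) (hi x)" for x
  define r where "r x = R (lo x) (hi x)" for x
  have er: "homeomorphism (J x) UNIV (e x) (r x)" "strict_mono_on (J x) (e x)" "strict_mono (r x)"
    if "x \<notin> C" for x
    using ER[of "lo x" "hi x"] J[OF that] by (auto simp: e_def r_def J_def)
  have er1: "r x (e x y) = y" if "x \<notin> C" "y \<in> J x" for x y using er(1)[OF that(1)] that(2) by (auto simp: homeomorphism_def)
  have er2: "e x (r x s) = s" "r x s \<in> J x" if "x \<notin> C" for x s using er(1)[OF that(1)] by (auto simp: homeomorphism_def)
  have ereq: "e y = e x" "r y = r x" if "y \<in> J x" for x y using Jeq[OF that] by (auto simp: e_def r_def)
  define G where "G t x = (if x \<in> C then x else r x ((1 - t) * e x x + t * e x (H x)))" for t x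
  have GJ: "G t x \<in> J x" if "x \<notin> C" for t x using that er2(2) by (simp add: G_def)
  have Gle: "c \<le> y \<Longrightarrow> c \<le> G t y" "y \<le> c \<Longrightarrow> G t y \<le> c" "c < y \<Longrightarrow> c < G t y" "y < c \<Longrightarrow> G t y < c"
    if "c \<in> C" for c t y
  proof -
    have "c \<le> lo y" if "c \<le> y" using lo(2) \<open>c \<in> C\<close> that by blast
    moreover have "hi y \<le> c" if "y \<le> c" using hi(2) \<open>c \<in> C\<close> that by blast
    moreover have "lo y < G t y" "G t y < hi y" if "y \<notin> C" using GJ[OF that] by (auto simp: J_def)
    moreover have "G t y = y" if "y \<in> C" using that by (simp add: G_def)
    ultimately show "c \<le> y \<Longrightarrow> c \<le> G t y" "y \<le> c \<Longrightarrow> G t y \<le> c" "c < y \<Longrightarrow> c < G t y" "y < c \<Longrightarrow> G t y < c"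
      using that by (cases "y \<in> C"; force)+
  qed
  have "strict_mono (G t)" if t: "t \<in> {0..1}" for t
  proof (rule strict_monoI)
    fix x y :: "'a ray" assume xy: "x < y"
    show "G t x < G t y"
    proof (cases "\<exists>c\<in>C. x \<le> c \<and> c \<le> y")
      case True
      then obtain c where c: "c \<in> C" "x \<le> c" "c \<le> y" by blast
      then show ?thesis
        using Gle[OF c(1), of x t] Gle[OF c(1), of y t] xy
        by (cases "x < c") (auto intro: less_le_trans)
    next
      case False
      have x: "x \<notin> C" and y: "y \<notin> C" using False xy by auto
      have "y < hi x" using False hiC[of x] hi(1)[of x] by (auto simp: not_le)
      moreover have "lo x < y" using lo(1)[of x] xy by (rule le_less_trans)
      ultimately have yJ: "y \<in> J x" by (simp add: J_def)
      have "e x x < e x y" "e x (H x) < e x (H y)"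
        using er(2)[OF x] xy yJ J[OF x] HJ Hle by (auto simp: strict_mono_on_def)
      then have "(1 - t) * e x x + t * e x (H x) < (1 - t) * e x y + t * e x (H y)"
        using t by (cases "t = 0") (auto intro!: add_le_less_mono mult_left_mono mult_strict_left_mono)
      then show ?thesis
        using x y er(3)[OF x] ereq[OF yJ] by (simp add: G_def strict_mono_def)
    qed
  qed
  moreover have "surj (G t)" if t: "t \<in> {0..1}" for t
  proof -
    have "\<exists>x. G t x = y" for y
    proof (cases "y \<in> C")
      case True
      then show ?thesis by (intro exI[of _ y]) (simp add: G_def)
    next
      case False
      \<comment> \<open>A preimage of \<open>y\<close> is sought in the component of
        \<open>y\<close> itself. Both the smaller of \<open>y\<close> and \<open>inv H y\<close> and
        its image under \<open>H\<close> are at most \<open>y\<close>, so \<open>f\<close> is at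
        most \<open>e y y\<close> there; at the larger one it is at least
        \<open>e y y\<close>.\<close>
      define f where "f x = (1 - t) * e y x + t * e y (H x)" for x
      have yJ: "y \<in> J y" by (rule J[OF False])
      define a b where "a = min y (inv H y)" and "b = max y (inv H y)"
      have ab: "a \<in> J y" "b \<in> J y" "a \<le> b" using yJ HJ(2)[OF yJ] by (auto simp: a_def b_def min_def max_def)
      then have sub: "{a..b} \<subseteq> J y" by (auto simp: J_def)
      have cH: "continuous_on UNIV H" using h(1) by (simp add: homeomorphism_def)
      have ce: "continuous_on (J y) (e y)" using er(1)[OF False] by (simp add: homeomorphism_def)
      have c: "continuous_on {a..b} f"
        unfolding f_def
        by (intro continuous_intros continuous_on_compose2[OF ce] continuous_on_subset[OF cH] continuous_on_subset[OF ce])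
          (use sub HJ in auto)
      have le: "e y x \<le> e y x'" if "x \<le> x'" "x \<in> J y" "x' \<in> J y" for x x'
        using er(2)[OF False] that by (simp add: strict_mono_on_leD)
      have Hab: "H a \<le> y" "y \<le> H b" "a \<le> y" "y \<le> b"
        using Hle(1)[of y "inv H y"] Hle(1)[of "inv H y" y]
        by (auto simp: a_def b_def min_def max_def inv)
      have ey: "(1 - t) * e y y + t * e y y = e y y" by (simp add: algebra_simps)
      have "f a \<le> (1 - t) * e y y + t * e y y"
        unfolding f_def by (intro add_mono mult_left_mono le) (use t Hab ab HJ yJ in auto)
      moreover have "(1 - t) * e y y + t * e y y \<le> f b"
        unfolding f_def by (intro add_mono mult_left_mono le) (use t Hab ab HJ yJ in auto)
      ultimately obtain x where x: "a \<le> x" "x \<le> b" "f x = e y y"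
        using IVT'[of f a "e y y" b] c ab ey by auto
      then have xJ: "x \<in> J y" using sub by auto
      have "G t x = r y (f x)" using nC[OF xJ] ereq[OF xJ] by (simp add: G_def f_def)
      then show ?thesis using x er1[OF False yJ] by auto
    qed
    then show ?thesis by (metis surjI)
  qed
  moreover have "continuous_on {0..1} (\<lambda>t. G t x)" for x
  proof (cases "x \<in> C")
    case True
    then show ?thesis by (simp add: G_def)
  next
    case False
    then have "continuous_on UNIV (r x)" using er(1)[OF False] by (simp add: homeomorphism_def)
    then show ?thesis
      using False by (auto simp: G_def intro!: continuous_on_compose2[of UNIV "r x"] continuous_intros)
  qed
  ultimately have "isotopy G" by (rule isotopy_order_automorphisms)
  moreover have "G 0 = id" using er1 J by (auto simp: G_def fun_eq_iff)
  moreover have "G 1 = H"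
  proof
    fix x
    show "G 1 x = H x"
    proof (cases "x \<in> C")
      case True
      then show ?thesis by (simp add: G_def C_def)
    next
      case False
      then show ?thesis using er1[OF False HJ(1)[OF J[OF False]]] by (simp add: G_def)
    qed
  qed
  ultimately show thesis by (rule that)
qed

section \<open>Pulling an arc along itself\<close>

text \<open>Only the arc from \<open>x\<close> on must slide along itself; what happens to the part
  before \<open>x\<close> is left free. Reparametrising one final segment onto another makes the
  relation symmetric and transitive.\<close>

definition slides :: "('x::linorder \<Rightarrow> 'y::topological_space) \<Rightarrow> 'x \<Rightarrow> 'x \<Rightarrow> bool" where
  "slides F x y \<longleftrightarrow> (\<exists>\<phi> k. isotopy \<phi> \<and> \<phi> 0 = id \<and> strict_mono_on {x..} k \<and> k ` {x..} = {y..} \<and>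
     (\<forall>z\<ge>x. \<phi> 1 (F z) = F (k z)))"

lemma slides_trans:
  assumes "slides F x y" "slides F y z"
  shows "slides F x z"
proof -
  obtain \<phi> k \<theta> l where 1: "isotopy \<phi>" "\<phi> 0 = id" "strict_mono_on {x..} k" "k ` {x..} = {y..}"
      "\<forall>z\<ge>x. \<phi> 1 (F z) = F (k z)"
    and 2: "isotopy \<theta>" "\<theta> 0 = id" "strict_mono_on {y..} l" "l ` {y..} = {z..}"
      "\<forall>z\<ge>y. \<theta> 1 (F z) = F (l z)"
    using assms unfolding slides_def by metis
  have ky: "y \<le> k w" if "x \<le> w" for w using 1(4) that by auto
  have "strict_mono_on {x..} (l \<circ> k)"
    using 1(3) 2(3) ky by (auto simp: strict_mono_on_def)
  moreover have "(l \<circ> k) ` {x..} = {z..}" using 1(4) 2(4) by (metis image_comp)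
  moreover have "\<forall>w\<ge>x. (\<theta> 1 \<circ> \<phi> 1) (F w) = F ((l \<circ> k) w)" using 1(5) 2(5) ky by simp
  ultimately show ?thesis
    unfolding slides_def using isotopy_compose[OF 1(1) 2(1)] 1(2) 2(2)
    by (intro exI[of _ "\<lambda>t. \<theta> t \<circ> \<phi> t"] exI[of _ "l \<circ> k"]) auto
qed

lemma slides_sym:
  assumes "slides F x y"
  shows "slides F y x"
proof -
  obtain \<phi> k where 1: "isotopy \<phi>" "\<phi> 0 = id" "strict_mono_on {x..} k" "k ` {x..} = {y..}"
      "\<forall>z\<ge>x. \<phi> 1 (F z) = F (k z)"
    using assms unfolding slides_def by metis
  obtain \<theta> where \<theta>: "isotopy \<theta>" "\<theta> 0 = id" "\<And>y. \<theta> 1 (\<phi> 1 y) = y"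
    by (rule isotopy_inverse[OF 1(1,2)]) blast
  define l where "l = inv_into {x..} k"
  have inj: "inj_on k {x..}" using 1(3) by (rule strict_mono_on_imp_inj_on)
  have l1: "l z \<in> {x..}" "k (l z) = z" if "y \<le> z" for z
  proof -
    have "z \<in> k ` {x..}" using that 1(4) by simp
    then show "l z \<in> {x..}" "k (l z) = z"
      unfolding l_def by (rule inv_into_into, rule f_inv_into_f)
  qed
  have l2: "l (k z) = z" if "x \<le> z" for z using inj that by (simp add: l_def)
  have "strict_mono_on {y..} l"
    unfolding strict_mono_on_def
  proof (intro allI impI)
    fix r s assume "r \<in> {y..} \<and> s \<in> {y..} \<and> r < s"
    then show "l r < l s"
      using strict_mono_on_less[OF 1(3), of "l r" "l s"] l1[of r] l1[of s] by auto
  qed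
  moreover have "l ` {y..} = {x..}"
    using l1(1) l2 1(4) by (auto simp: image_iff) (metis atLeast_iff image_eqI)
  moreover have "\<forall>z\<ge>y. \<theta> 1 (F z) = F (l z)"
    using l1 1(5) \<theta>(3) by (metis atLeast_iff)
  ultimately show ?thesis unfolding slides_def using \<theta> by blast
qed

lemma slides_conjugate:
  assumes "homeomorphism UNIV UNIV \<sigma> \<tau>" "slides (\<sigma> \<circ> F) x y"
  shows "slides F x y"
proof -
  obtain \<phi> k where 1: "isotopy \<phi>" "\<phi> 0 = id" "strict_mono_on {x..} k" "k ` {x..} = {y..}"
      "\<forall>z\<ge>x. \<phi> 1 (\<sigma> (F z)) = \<sigma> (F (k z))"
    using assms(2) unfolding slides_def by auto
  have i: "\<tau> (\<sigma> p) = p" for p using assms(1) by (auto simp: homeomorphism_def)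
  show ?thesis unfolding slides_def
    using 1 i isotopy_conjugate[OF 1(1) assms(1)]
    by (intro exI[of _ "\<lambda>t. \<tau> \<circ> \<phi> t \<circ> \<sigma>"] exI[of _ k]) auto
qed

text \<open>Any three points in order have values in order or in reverse order; comparing with the
  values at \<open>a\<close> and \<open>b\<close> shows that the direction is the same
  throughout.\<close>

lemma inj_on_Icc_monotone:
  fixes f :: "'a::linear_continuum_topology \<Rightarrow> 'b::linorder_topology"
  assumes c: "continuous_on {a..b} f" and i: "inj_on f {a..b}"
  shows "strict_mono_on {a..b} f \<or> strict_antimono_on {a..b} f"
proof -
  have three: "(f r < f s \<and> f s < f t) \<or> (f t < f s \<and> f s < f r)"
    if "a \<le> r" "r < s" "s < t" "t \<le> b" for r s t
    using that by (intro continuous_inj_imp_mono continuous_on_subset[OF c] inj_on_subset[OF i]) auto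
  show ?thesis
  proof (cases "a < b")
    case False
    then have "strict_mono_on {a..b} f" by (auto simp: strict_mono_on_def)
    then show ?thesis ..
  next
    case True
    then have "f a \<noteq> f b" using i by (auto dest: inj_onD)
    then consider "f a < f b" | "f b < f a" by (meson linorder_neqE)
    then show ?thesis
    proof cases
      case 1
      have "f x < f y" if "a \<le> x" "x < y" "y \<le> b" for x y
      proof -
        have "a < y" "x < b" using that by auto
        then show ?thesis
          using three[of a x y] three[of a y b] three[of a x b] that 1
          by (cases "x = a"; cases "y = b") (auto simp: order_le_less)
      qed
      then show ?thesis by (auto simp: strict_mono_on_def)
    next
      case 2
      have "f y < f x" if "a \<le> x" "x < y" "y \<le> b" for x y
      proof -
        have "a < y" "x < b" using that by auto
        then show ?thesis
          using three[of a x y] three[of a y b] three[of a x b] that 2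
          by (cases "x = a"; cases "y = b") (auto simp: order_le_less)
      qed
      then show ?thesis by (auto simp: monotone_on_def)
    qed
  qed
qed

text \<open>\<open>M\<close> omits the right end point \<open>b\<close>, so each point of
  \<open>M\<close> still has room on its right inside \<open>{a..b}\<close>. The left end point may
  belong to \<open>M\<close>, since \<open>s\<close> may be the least point.\<close>

lemma ray_neighbourhood:
  fixes s :: "'a::omega_one ray"
  assumes "open S" "s \<in> S"
  obtains a b M where "open M" "s \<in> M" "M \<subseteq> {a..<b}" "{a..b} \<subseteq> S"
proof -
  obtain b0 where b0: "s < b0" "{s..<b0} \<subseteq> S" using open_right[OF assms] gt_ex by blast
  obtain b where b: "s < b" "b < b0" using dense b0 by blast
  show thesis
  proof (cases "\<exists>y. y < s")
    case True
    then obtain a0 where a0: "a0 < s" "{a0<..s} \<subseteq> S" using open_left[OF assms] by blast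
    obtain a where a: "a0 < a" "a < s" using dense a0 by blast
    have "{a..b} \<subseteq> {a0<..s} \<union> {s..<b0}" using a b by auto
    then have "{a..b} \<subseteq> S" using a0 b0 by blast
    moreover have "{a<..<b} \<subseteq> {a..<b}" unfolding subset_iff by auto
    ultimately show thesis using that[of "{a<..<b}" a b] a b by simp
  next
    case False
    have "{s..b} \<subseteq> {s..<b0}" using b by auto
    then have "{s..b} \<subseteq> S" using b0 by blast
    moreover have "{..<b} \<subseteq> {s..<b}" using False unfolding subset_iff by (auto simp: not_less)
    ultimately show thesis using that[of "{..<b}" s b] b by simp
  qed
qed

lemma homeomorphism_Times:
  assumes "homeomorphism A A' f f'" "homeomorphism B B' g g'"
  shows "homeomorphism (A \<times> B) (A' \<times> B') (map_prod f g) (map_prod f' g')"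
proof -
  have c: "continuous_on (A \<times> B) (map_prod f g)" if "continuous_on A f" "continuous_on B g"
    for A B and f :: "'p::topological_space \<Rightarrow> 'q::topological_space" and g :: "'r::topological_space \<Rightarrow> 's::topological_space"
    unfolding map_prod_def case_prod_unfold
    by (intro continuous_on_Pair continuous_on_compose2[OF that(1)] continuous_on_compose2[OF that(2)] continuous_intros) auto
  show ?thesis
    using assms by (intro homeomorphismI c) (auto simp: homeomorphism_def)
qed

text \<open>Subtracting \<open>q\<close> straightens the graph to an axis, along which a bump is pushed with a strength
  fading out at distance one.\<close>

lemma graph_slide:
  fixes q :: "real \<Rightarrow> 'e::euclidean_space"
  assumes q: "continuous_on UNIV q" and u: "u0 \<le> u1" "u1 < u2"
  obtains \<Phi> :: "real \<Rightarrow> real \<times> 'e \<Rightarrow> real \<times> 'e" and h K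
  where "isotopy \<Phi>" "\<Phi> 0 = id" "compact K" "\<And>t p. p \<notin> K \<Longrightarrow> \<Phi> t p = p"
    "\<And>r w. (r, w) \<in> K \<Longrightarrow> r \<le> u2" "strict_mono h" "surj h" "h u0 = u1" "h u2 = u2"
    "\<And>r. \<Phi> 1 (r, q r) = (h r, q (h r))"
proof -
  \<comment> \<open>A tent rising from 0 at \<open>u0 - 1\<close> to 1 at \<open>u0\<close> and
    falling to 0 at \<open>u2\<close>. Its descent has slope \<open>1 / (u2 - u0)\<close>, so by
    \<open>u1 < u2\<close> the displacement \<open>(u1 - u0) * \<beta> r\<close> decreases more
    slowly than \<open>r\<close> grows, and \<open>H s\<close> stays strictly increasing.\<close>
  define \<beta> where "\<beta> r = max 0 (min (r - u0 + 1) ((u2 - r) / (u2 - u0)))" for r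
  define H where "H s r = r + s * ((u1 - u0) * \<beta> r)" for s r
  have D: "0 < u2 - u0" using u by simp
  have bc: "continuous_on S \<beta>" for S unfolding \<beta>_def by (intro continuous_intros) (use D in auto)
  have b0: "\<beta> r = 0" if "r \<le> u0 - 1 \<or> u2 \<le> r" for r
  proof -
    have "r - u0 + 1 \<le> 0 \<or> (u2 - r) / (u2 - u0) \<le> 0"
      using that D by (auto intro: divide_nonpos_pos)
    then show ?thesis by (auto simp: \<beta>_def)
  qed
  have H_mono: "strict_mono (H s)" if s: "0 \<le> s" "s \<le> 1" for s
  proof (rule strict_monoI)
    fix r r' :: real assume r: "r < r'"
    define d where "d = (r' - r) / (u2 - u0)"
    have d: "0 < d" using r D by (simp add: d_def)
    have "(u2 - r') / (u2 - u0) = (u2 - r) / (u2 - u0) - d"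
      by (simp add: d_def diff_divide_distrib[symmetric])
    then have "\<beta> r - \<beta> r' \<le> d" using d r by (auto simp: \<beta>_def max_def min_def)
    then have "s * ((u1 - u0) * (\<beta> r - \<beta> r')) \<le> s * ((u1 - u0) * d)"
      using s u by (intro mult_left_mono) auto
    also have "\<dots> \<le> (u1 - u0) * d" using s u d by (simp add: mult_left_le_one_le)
    also have "\<dots> < (u2 - u0) * d" using u d by (intro mult_strict_right_mono) auto
    also have "\<dots> = r' - r" using D by (simp add: d_def)
    finally show "H s r < H s r'" by (simp add: H_def algebra_simps)
  qed
  have H_surj: "\<exists>r. H s r = y" for s y
  proof -
    have "H s (min y (u0 - 1)) \<le> y" "y \<le> H s (max y u2)" by (simp_all add: H_def b0)
    moreover have "continuous_on {min y (u0 - 1)..max y u2} (H s)"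
      unfolding H_def by (intro continuous_intros bc)
    moreover have "min y (u0 - 1) \<le> max y u2" by simp
    ultimately show ?thesis using IVT'[of "H s" "min y (u0 - 1)" y "max y u2"] by blast
  qed
  define \<rho> where "\<rho> v = max 0 (1 - norm v)" for v :: 'e
  have \<rho>: "0 \<le> \<rho> v" "\<rho> v \<le> 1" for v by (auto simp: \<rho>_def)
  define \<Psi> where "\<Psi> t p = (H (t * \<rho> (snd p)) (fst p), snd p)" for t and p :: "real \<times> 'e"
  have \<Psi>: "isotopy \<Psi>"
    unfolding isotopy_def
  proof
    have "continuous_on (UNIV \<times> {0..1}) (\<lambda>z. \<Psi> (snd z) (fst z))"
      unfolding \<Psi>_def H_def \<rho>_def by (intro continuous_intros continuous_on_compose2[OF bc]) auto
    then show "continuous_on (UNIV \<times> {0..1}) (\<lambda>(y, t). \<Psi> t y)" by (simp add: case_prod_unfold)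
    show "\<forall>t\<in>{0..1}. \<exists>g. homeomorphism UNIV UNIV (\<Psi> t) g"
    proof
      fix t :: real assume t: "t \<in> {0..1}"
      have \<tau>: "0 \<le> t * \<rho> v" "t * \<rho> v \<le> 1" for v using t \<rho>[of v] by (auto simp: mult_le_one)
      have "inj (\<Psi> t)"
      proof (rule injI)
        fix p p' assume e: "\<Psi> t p = \<Psi> t p'"
        then have s: "snd p = snd p'" by (simp add: \<Psi>_def)
        then have "H (t * \<rho> (snd p)) (fst p) = H (t * \<rho> (snd p)) (fst p')" using e by (simp add: \<Psi>_def)
        then have "fst p = fst p'" using H_mono[OF \<tau>] by (metis strict_mono_eq)
        then show "p = p'" using s by (simp add: prod_eq_iff)
      qed
      moreover have "surj (\<Psi> t)"
      proof -
        have "\<exists>p. \<Psi> t p = p'" for p'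
        proof -
          obtain r where "H (t * \<rho> (snd p')) r = fst p'" using H_surj by blast
          then show ?thesis by (intro exI[of _ "(r, snd p')"]) (simp add: \<Psi>_def)
        qed
        then show ?thesis by (metis surjI)
      qed
      moreover have "continuous_on UNIV (\<Psi> t)"
        unfolding \<Psi>_def H_def \<rho>_def by (intro continuous_intros continuous_on_compose2[OF bc]) auto
      \<comment> \<open>A continuous bijection of a Euclidean space onto itself; invariance of
        domain supplies the continuity of the inverse.\<close>
      ultimately show "\<exists>g. homeomorphism UNIV UNIV (\<Psi> t) g"
        using invariance_of_domain_homeomorphism[of UNIV "\<Psi> t"] by (metis open_UNIV order_refl)
    qed
  qed
  define \<sigma> where "\<sigma> p = (fst p, snd p - q (fst p))" for p
  define \<tau> where "\<tau> p = (fst p, snd p + q (fst p))" for p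
  have c\<tau>: "continuous_on UNIV \<tau>" and c\<sigma>: "continuous_on UNIV \<sigma>"
    unfolding \<sigma>_def \<tau>_def by (intro continuous_intros continuous_on_compose2[OF q] subset_UNIV)+
  then have hom: "homeomorphism UNIV UNIV \<sigma> \<tau>"
    by (intro homeomorphismI) (auto simp: \<sigma>_def \<tau>_def)
  define \<Phi> where "\<Phi> t = \<tau> \<circ> \<Psi> t \<circ> \<sigma>" for t
  have "isotopy \<Phi>" unfolding \<Phi>_def by (rule isotopy_conjugate[OF \<Psi> hom])
  moreover have "\<Phi> 0 = id" by (auto simp: \<Phi>_def \<Psi>_def H_def \<sigma>_def \<tau>_def)
  moreover have "compact (\<tau> ` ({u0 - 1..u2} \<times> cball 0 1))"
    by (intro compact_continuous_image continuous_on_subset[OF c\<tau>] compact_Times) auto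
  moreover have "\<Phi> t p = p" if "p \<notin> \<tau> ` ({u0 - 1..u2} \<times> cball 0 1)" for t p
  proof -
    have "p = \<tau> (\<sigma> p)" by (simp add: \<sigma>_def \<tau>_def)
    then have "\<sigma> p \<notin> {u0 - 1..u2} \<times> cball 0 1" using that by (metis image_eqI)
    then consider "fst p \<le> u0 - 1 \<or> u2 \<le> fst p" | "1 \<le> norm (snd p - q (fst p))"
      by (auto simp: \<sigma>_def not_le less_imp_le)
    then have "\<rho> (snd p - q (fst p)) * \<beta> (fst p) = 0"
      by cases (auto simp: b0 \<rho>_def)
    then have "H (t * \<rho> (snd p - q (fst p))) (fst p) = fst p" by (auto simp: H_def)
    then show ?thesis by (simp add: \<Phi>_def \<Psi>_def \<sigma>_def \<tau>_def)
  qed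
  moreover have "r \<le> u2" if "(r, w) \<in> \<tau> ` ({u0 - 1..u2} \<times> cball 0 1)" for r w
    using that by (auto simp: \<tau>_def)
  moreover have "strict_mono (H 1)" using H_mono[of 1] by simp
  moreover have "surj (H 1)" using H_surj[of 1] by (metis surjI)
  moreover have "\<beta> u0 = 1" using D by (simp add: \<beta>_def)
  then have "H 1 u0 = u1" by (simp add: H_def)
  moreover have "H 1 u2 = u2" by (simp add: H_def b0)
  moreover have "\<Phi> 1 (r, q r) = (H 1 r, q (H 1 r))" for r
    by (simp add: \<Phi>_def \<Psi>_def \<sigma>_def \<tau>_def \<rho>_def)
  ultimately show thesis by (rule that)
qed

text \<open>As \<open>F\<close> is a homeomorphism onto its image, a small box \<open>B\<close>
  around \<open>F s\<close> meets the arc only in points with parameters near \<open>s\<close>, so a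
  move supported in \<open>B\<close> disturbs no other strand. In real coordinates on the box the
  arc is a graph over the first axis, and \<open>graph_slide\<close> applies. The bounds
  \<open>p1\<close>, \<open>p2\<close>, \<open>p3\<close> let the box extend below each coordinate,
  so that its sides are open intervals homeomorphic to the line.\<close>

lemma slides_local_fst:
  fixes F :: "'w::omega_one ray \<Rightarrow> 'v::omega_one ray \<times> 'v ray \<times> 'v ray"
  assumes F: "homeomorphism UNIV (range F) F F'"
    and N: "open N" "s \<in> N" "inj_on (fst \<circ> F) N"
    and low: "p1 < fst (F s)" "p2 < fst (snd (F s))" "p3 < snd (snd (F s))"
  obtains T where "open T" "s \<in> T" "\<And>x y. x \<in> T \<Longrightarrow> y \<in> T \<Longrightarrow> slides F x y"
proof -
  have cF: "continuous_on S F" for S using F by (meson continuous_on_subset homeomorphism_def subset_UNIV)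
  have injF: "F z = F z' \<longleftrightarrow> z = z'" for z z' using F by (metis UNIV_I homeomorphism_apply1)
  obtain a0 b0 M0 where M0: "open M0" "s \<in> M0" "M0 \<subseteq> {a0..<b0}" "{a0..b0} \<subseteq> N"
    using ray_neighbourhood[OF N(1,2)] .
  have mono0: "strict_mono_on {a0..b0} (fst \<circ> F) \<or> strict_antimono_on {a0..b0} (fst \<circ> F)"
    by (intro inj_on_Icc_monotone inj_on_subset[OF N(3)] M0 continuous_on_compose cF continuous_intros)
  have "openin (top_of_set (range F)) (F ` M0)"
    by (rule homeomorphism_imp_open_map[OF F]) (use M0 in simp)
  then obtain W where W: "open W" "F ` M0 = range F \<inter> W" by (auto simp: openin_open)
  have "F s \<in> W" using W M0 by auto
  then obtain A1 A' where A1: "open A1" "open A'" "F s \<in> A1 \<times> A'" "A1 \<times> A' \<subseteq> W"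
    by (rule open_prod_elim[OF W(1)])
  have "snd (F s) \<in> A'" using A1(3) by (simp add: mem_Times_iff)
  then obtain A2 A3 where A2: "open A2" "open A3" "snd (F s) \<in> A2 \<times> A3" "A2 \<times> A3 \<subseteq> A'"
    by (rule open_prod_elim[OF A1(2)])
  have interval: "\<exists>p q. p < c \<and> c < q \<and> {p<..<q} \<subseteq> A" if A: "open A" "c \<in> A" "l < c" for A and l c :: "'v ray"
  proof -
    obtain p where p: "p < c" "{p<..c} \<subseteq> A" using open_left[OF A(1,2,3)] by blast
    obtain r where r: "c < r" "{c..<r} \<subseteq> A" using open_right[OF A(1,2)] gt_ex by blast
    have "{p<..<r} \<subseteq> {p<..c} \<union> {c..<r}" by auto
    then show ?thesis using p r by blast
  qed
  have mem: "fst (F s) \<in> A1" "fst (snd (F s)) \<in> A2" "snd (snd (F s)) \<in> A3"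
    using A1(3) A2(3) by (auto simp: mem_Times_iff)
  obtain l1 r1 where I1: "l1 < fst (F s)" "fst (F s) < r1" "{l1<..<r1} \<subseteq> A1"
    using interval[OF A1(1) mem(1) low(1)] by blast
  obtain l2 r2 where I2: "l2 < fst (snd (F s))" "fst (snd (F s)) < r2" "{l2<..<r2} \<subseteq> A2"
    using interval[OF A2(1) mem(2) low(2)] by blast
  obtain l3 r3 where I3: "l3 < snd (snd (F s))" "snd (snd (F s)) < r3" "{l3<..<r3} \<subseteq> A3"
    using interval[OF A2(2) mem(3) low(3)] by blast
  define B where "B = {l1<..<r1} \<times> {l2<..<r2} \<times> {l3<..<r3}"
  have "B \<subseteq> A1 \<times> A2 \<times> A3" using I1(3) I2(3) I3(3) unfolding B_def by (intro Sigma_mono) auto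
  also have "\<dots> \<subseteq> W" using A1(4) A2(4) by blast
  finally have "B \<subseteq> W" .
  then have B: "open B" "F s \<in> B" "B \<subseteq> W"
    using I1(1,2) I2(1,2) I3(1,2) by (auto simp: B_def mem_Times_iff open_Times)
  define P where "P = F -` B"
  have P: "open P" "s \<in> P" using B cF[of UNIV] by (auto simp: P_def intro: open_vimage)
  have PM0: "P \<subseteq> M0"
  proof
    fix z assume "z \<in> P"
    then have "F z \<in> F ` M0" using B W(2) by (auto simp: P_def)
    then show "z \<in> M0" using injF by auto
  qed
  obtain a b M where M: "open M" "s \<in> M" "M \<subseteq> {a..<b}" "{a..b} \<subseteq> P"
    using ray_neighbourhood[OF P] .
  obtain e1 :: "'v ray \<Rightarrow> real" and g1 where e1: "homeomorphism {l1<..<r1} UNIV e1 g1" "strict_mono_on {l1<..<r1} e1"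
    by (rule ray_interval_real[of l1 r1]) (use I1 in auto)
  obtain e2 :: "'v ray \<Rightarrow> real" and g2 where e2: "homeomorphism {l2<..<r2} UNIV e2 g2"
    by (rule ray_interval_real[of l2 r2]) (use I2 in auto)
  obtain e3 :: "'v ray \<Rightarrow> real" and g3 where e3: "homeomorphism {l3<..<r3} UNIV e3 g3"
    by (rule ray_interval_real[of l3 r3]) (use I3 in auto)
  have P1: "fst (F z) \<in> {l1<..<r1}" if "z \<in> P" for z using that by (auto simp: P_def B_def mem_Times_iff)
  have P0: "z \<in> {a0..b0}" if "z \<in> P" for z
  proof -
    have "z \<in> {a0..<b0}" using that PM0 M0(3) by blast
    then show ?thesis by (simp add: less_imp_le)
  qed
  \<comment> \<open>Reflecting the first coordinate if necessary makes it increase along the arc, so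
    that later points of the arc in the box are those with larger first coordinate.\<close>
  have "\<exists>e g. homeomorphism {l1<..<r1} (UNIV::real set) e g \<and> (\<forall>z\<in>P. \<forall>z'\<in>P. z < z' \<longrightarrow> e (fst (F z)) < e (fst (F z')))"
    using mono0
  proof
    assume "strict_mono_on {a0..b0} (fst \<circ> F)"
    then have "\<forall>z\<in>P. \<forall>z'\<in>P. z < z' \<longrightarrow> e1 (fst (F z)) < e1 (fst (F z'))"
      using e1(2) P0 P1 by (simp add: strict_mono_on_def)
    then show ?thesis using e1(1) by blast
  next
    assume "strict_antimono_on {a0..b0} (fst \<circ> F)"
    then have "\<forall>z\<in>P. \<forall>z'\<in>P. z < z' \<longrightarrow> - e1 (fst (F z)) < - e1 (fst (F z'))"
      using e1(2) P0 P1 by (simp add: strict_mono_on_def monotone_on_def)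
    moreover have "homeomorphism (UNIV::real set) UNIV uminus uminus"
      by (intro homeomorphismI) (auto intro: continuous_intros)
    then have "homeomorphism {l1<..<r1} UNIV (uminus \<circ> e1) (g1 \<circ> uminus)"
      by (rule homeomorphism_compose[OF e1(1)])
    ultimately show ?thesis by (intro exI[of _ "uminus \<circ> e1"] exI[of _ "g1 \<circ> uminus"]) auto
  qed
  then obtain e g where e: "homeomorphism {l1<..<r1} (UNIV::real set) e g"
    and umono: "\<And>z z'. z \<in> P \<Longrightarrow> z' \<in> P \<Longrightarrow> z < z' \<Longrightarrow> e (fst (F z)) < e (fst (F z'))" by blast
  define E where "E = map_prod e (map_prod e2 e3)"
  define G where "G = map_prod g (map_prod g2 g3)"
  have EG: "homeomorphism B UNIV E G"
    using homeomorphism_Times[OF e homeomorphism_Times[OF e2 e3]] by (simp add: B_def E_def G_def)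
  have GE: "G (E y) = y" if "y \<in> B" for y using EG that by (simp add: homeomorphism_def)
  have cE: "continuous_on B E" using EG by (simp add: homeomorphism_def)
  have cEF: "continuous_on P (E \<circ> F)"
    by (intro continuous_on_compose cF continuous_on_subset[OF cE]) (auto simp: P_def)
  define u where "u z = fst (E (F z))" for z
  define Q where "Q z = snd (E (F z))" for z
  have EF: "E (F z) = (u z, Q z)" for z by (simp add: u_def Q_def)
  have cu: "continuous_on P u" and cQ: "continuous_on P Q"
    using cEF unfolding u_def Q_def o_def by (auto intro: continuous_intros)
  have u_less: "u z < u z'" if "z \<in> P" "z' \<in> P" "z < z'" for z z'
    using umono[OF that] by (simp add: u_def E_def)
  have u_iff: "u z < u z' \<longleftrightarrow> z < z'" "u z \<le> u z' \<longleftrightarrow> z \<le> z'" "u z = u z' \<longleftrightarrow> z = z'" if "z \<in> P" "z' \<in> P" for z z'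
    using u_less[OF that] u_less[OF that(2,1)] by (cases z z' rule: linorder_cases; simp)+
  have slide: "slides F x y" if "x \<in> M" "y \<in> M" "x \<le> y" for x y
  proof -
    have xyb: "a \<le> x" "x < b" "y < b" using that M by auto
    have "{x..b} \<subseteq> {a..b}" using xyb by auto
    then have sub: "{x..b} \<subseteq> P" using M(4) by blast
    have "x \<in> {x..b}" "y \<in> {x..b}" "b \<in> {x..b}" using xyb that by (auto simp: less_imp_le)
    then have xP: "x \<in> P" and yP: "y \<in> P" and bP: "b \<in> P" using sub by blast+
    have inj: "inj_on u {x..b}" by (rule inj_on_subset[OF _ sub]) (simp add: inj_on_def u_iff)
    have im: "u ` {x..b} = {u x..u b}"
    proof (intro equalityI subsetI)
      fix r assume "r \<in> u ` {x..b}"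
      then obtain z where z: "r = u z" "z \<in> {x..b}" by blast
      then have "z \<in> P" using sub by blast
      then show "r \<in> {u x..u b}" using z u_iff(2)[OF xP] u_iff(2)[OF _ bP] by simp
    next
      fix r assume "r \<in> {u x..u b}"
      then obtain z where "x \<le> z" "z \<le> b" "u z = r"
        using IVT'[of u x r b] continuous_on_subset[OF cu sub] xyb by (auto simp: less_imp_le)
      then show "r \<in> u ` {x..b}" by auto
    qed
    define v where "v = inv_into {x..b} u"
    have vu: "v (u z) = z" if "z \<in> {x..b}" for z using inj that by (simp add: v_def)
    have uv: "u (v r) = r" "v r \<in> {x..b}" if "r \<in> {u x..u b}" for r
    proof -
      have "r \<in> u ` {x..b}" using that im by simp
      then show "u (v r) = r" "v r \<in> {x..b}"
        unfolding v_def by (rule f_inv_into_f, rule inv_into_into)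
    qed
    have cv: "continuous_on {u x..u b} v"
      unfolding im[symmetric]
      by (rule continuous_on_inv) (use vu compact_Icc_ray continuous_on_subset[OF cu sub] in auto)
    \<comment> \<open>Clamping extends the graph function constantly to the whole line. Outside the
      interval from \<open>u x\<close> to \<open>u b\<close> the extended graph may leave the arc,
      and points of the arc before \<open>x\<close> may then be moved off it, which
      \<open>slides\<close> permits.\<close>
    define q where "q r = Q (v (max (u x) (min r (u b))))" for r
    have clamp: "max (u x) (min r (u b)) \<in> {u x..u b}" for r using u_less[OF xP bP] xyb by auto
    have cq: "continuous_on UNIV q"
      unfolding q_def
      by (intro continuous_on_compose2[OF cQ] continuous_on_compose2[OF cv] continuous_intros)
        (use clamp uv(2) sub in blast)+
    have qu: "q (u z) = Q z" if "z \<in> {x..b}" for z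
    proof -
      have "u z \<in> {u x..u b}" using im that by blast
      then have "max (u x) (min (u z) (u b)) = u z" by (simp add: max_def min_def)
      then show ?thesis using vu[OF that] by (simp add: q_def)
    qed
    have uu: "u x \<le> u y" "u y < u b" using u_iff[OF xP yP] u_iff[OF yP bP] that xyb by auto
    obtain \<Phi> h K where \<Phi>: "isotopy \<Phi>" "\<Phi> 0 = id" "compact K" "\<And>t p. p \<notin> K \<Longrightarrow> \<Phi> t p = p"
      "\<And>r w. (r, w) \<in> K \<Longrightarrow> r \<le> u b" and h: "strict_mono h" "surj h" "h (u x) = u y" "h (u b) = u b"
      and \<Phi>q: "\<And>r. \<Phi> 1 (r, q r) = (h r, q (h r))"
      by (rule graph_slide[OF cq uu], rule that)
    define \<phi> where "\<phi> t p = (if p \<in> B then G (\<Phi> t (E p)) else p)" for t p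
    define k where "k z = (if z \<le> b then v (h (u z)) else z)" for z
    have hle: "h r \<le> h r' \<longleftrightarrow> r \<le> r'" "h r < h r' \<longleftrightarrow> r < r'" for r r'
      using h(1) by (auto simp: strict_mono_less_eq strict_mono_less)
    have hr: "h (u z) \<in> {u y..u b}" if "z \<in> {x..b}" for z
    proof -
      have "u z \<in> {u x..u b}" using im that by blast
      then show ?thesis using hle(1)[of "u x" "u z"] hle(1)[of "u z" "u b"] h(3,4) by simp
    qed
    have hr': "h (u z) \<in> {u x..u b}" if "z \<in> {x..b}" for z
      using hr[OF that] \<open>u x \<le> u y\<close> by auto
    have kI: "k z \<in> {y..b}" "u (k z) = h (u z)" if "z \<in> {x..b}" for z
    proof -
      show *: "u (k z) = h (u z)" using uv(1)[OF hr'[OF that]] that by (simp add: k_def)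
      have "k z \<in> {x..b}" using uv(2)[OF hr'[OF that]] that by (simp add: k_def)
      then have "k z \<in> P" using sub by blast
      then show "k z \<in> {y..b}" using hr[OF that] u_iff(2)[of y "k z"] u_iff(2)[of "k z" b] yP bP * by simp
    qed
    have xy: "{y..b} \<subseteq> {x..b}" using that by auto
    have "isotopy \<phi>"
      unfolding \<phi>_def by (rule isotopy_extension_by_id[OF B(1) EG \<Phi>(1,3)]) (rule \<Phi>(4))
    moreover have "\<phi> 0 = id" using GE \<Phi>(2) by (auto simp: \<phi>_def)
    moreover have "strict_mono_on {x..} k"
      unfolding strict_mono_on_def
    proof (intro allI impI)
      fix z z' assume z: "z \<in> {x..} \<and> z' \<in> {x..} \<and> z < z'"
      show "k z < k z'"
      proof (cases "z' \<le> b")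
        case True
        then have zb: "z \<in> {x..b}" "z' \<in> {x..b}" using z by auto
        then have zP: "z \<in> P" "z' \<in> P" "k z \<in> P" "k z' \<in> P" using sub xy kI(1) by blast+
        then have "u (k z) < u (k z')" using kI(2)[OF zb(1)] kI(2)[OF zb(2)] hle(2) u_iff(1) z by simp
        then show ?thesis using u_iff(1) zP by blast
      next
        case False
        then show ?thesis using kI(1)[of z] z by (cases "z \<le> b") (auto simp: k_def)
      qed
    qed
    moreover have "k ` {x..} = {y..}"
    proof (intro equalityI subsetI)
      fix w assume "w \<in> k ` {x..}"
      then obtain z where z: "w = k z" "x \<le> z" by auto
      then show "w \<in> {y..}" using kI(1)[of z] xyb by (cases "z \<le> b") (auto simp: k_def)
    next
      fix w assume w: "w \<in> {y..}"
      show "w \<in> k ` {x..}"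
      proof (cases "w \<le> b")
        case False
        then show ?thesis using w that by (intro image_eqI[of _ _ w]) (auto simp: k_def)
      next
        case True
        then have wP: "w \<in> {x..b}" using w that by auto
        obtain r where r: "h r = u w" using h(2) by (metis surjD)
        have "w \<in> P" using wP sub by blast
        then have "u y \<le> u w" "u w \<le> u b" using u_iff(2)[OF yP] u_iff(2)[OF _ bP] w True by auto
        then have "r \<in> {u x..u b}" using hle(1)[of "u x" r] hle(1)[of r "u b"] h r by auto
        then obtain z where z: "z \<in> {x..b}" "r = u z" using im by blast
        then have "k z = w" using r vu[OF wP] by (simp add: k_def)
        then show ?thesis using z by auto
      qed
    qed
    moreover have "\<forall>z\<ge>x. \<phi> 1 (F z) = F (k z)"
    proof (intro allI impI)
      fix z assume z: "x \<le> z"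
      show "\<phi> 1 (F z) = F (k z)"
      proof (cases "z \<le> b")
        case True
        then have zb: "z \<in> {x..b}" using z by simp
        then have "z \<in> P" using sub by blast
        then have FB: "F z \<in> B" by (simp add: P_def)
        have kb: "k z \<in> {x..b}" using kI(1)[OF zb] xy by blast
        then have "k z \<in> P" using sub by blast
        then have kB: "F (k z) \<in> B" by (simp add: P_def)
        have "\<Phi> 1 (E (F z)) = (h (u z), q (h (u z)))" using \<Phi>q[of "u z"] qu[OF zb] by (simp add: EF)
        also have "\<dots> = E (F (k z))" using qu[OF kb] kI(2)[OF zb] by (simp add: EF)
        finally show ?thesis using FB GE[OF kB] by (simp add: \<phi>_def)
      next
        case False
        then have kz: "k z = z" by (simp add: k_def)
        show ?thesis
        proof (cases "F z \<in> B")
          case True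
          then have "z \<in> P" by (simp add: P_def)
          \<comment> \<open>The support \<open>K\<close> lies over first coordinates at most
            \<open>u b\<close>, so the arc beyond \<open>b\<close> stays fixed even where it is
            still inside the box.\<close>
          then have "u b < u z" using u_iff(1)[OF bP, of z] False by simp
          then have "E (F z) \<notin> K" using \<Phi>(5)[of "u z" "Q z"] by (auto simp: EF)
          then show ?thesis using True GE[OF True] \<Phi>(4) kz by (simp add: \<phi>_def)
        qed (simp add: \<phi>_def kz)
      qed
    qed
    ultimately show ?thesis unfolding slides_def by blast
  qed
  show thesis
  proof (rule that[OF M(1,2)])
    fix x y assume "x \<in> M" "y \<in> M"
    then show "slides F x y" using slide slides_sym linear by metis
  qed
qed

text \<open>Every index from 2 on denotes the third component, so statements can range over all of
  \<open>nat\<close> without a side condition.\<close>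

definition coord :: "nat \<Rightarrow> 'a \<times> 'a \<times> 'a \<Rightarrow> 'a" where
  "coord i p = (if i = 0 then fst p else if i = 1 then fst (snd p) else snd (snd p))"

lemma coord_simps [simp]:
  "coord 0 p = fst p" "coord (Suc 0) p = fst (snd p)" "coord 2 p = snd (snd p)"
  by (simp_all add: coord_def)

lemma continuous_coord: "continuous_on S (coord i)"
proof -
  consider "i = 0" | "i = 1" | "i \<noteq> 0" "i \<noteq> 1" by blast
  then show ?thesis
    by cases (simp_all add: coord_def continuous_on_fst continuous_on_snd continuous_on_id)
qed

proposition slides_all:
  fixes F :: "'w::omega_one ray \<Rightarrow> 'v::omega_one ray \<times> 'v ray \<times> 'v ray"
  assumes F: "homeomorphism UNIV (range F) F F'"
    and inj: "\<And>s. \<exists>i N. open N \<and> s \<in> N \<and> inj_on (coord i \<circ> F) N"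
    and low: "\<And>i s. p < coord i (F s)"
  shows "slides F x y"
proof (rule connected_equivalence_relation[of UNIV x y "slides F"])
  fix s
  obtain i N where N: "open N" "s \<in> N" "inj_on (coord i \<circ> F) N" using inj by blast
  \<comment> \<open>A permutation \<open>\<sigma>\<close> of the factors moves the injective
    coordinate to the front, and \<open>slides_conjugate\<close> transports the result back. The
    identity and two transpositions suffice.\<close>
  have *: "\<exists>T. open T \<and> s \<in> T \<and> (\<forall>y\<in>T. slides F s y)"
    if hom: "homeomorphism UNIV UNIV \<sigma> \<tau>" and i: "\<And>p. coord i p = fst (\<sigma> p)"
      and low': "p < fst (\<sigma> (F s))" "p < fst (snd (\<sigma> (F s)))" "p < snd (snd (\<sigma> (F s)))" for \<sigma> \<tau>
  proof -
    have "homeomorphism (range F) (range (\<sigma> \<circ> F)) \<sigma> \<tau>"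
      using hom by (rule homeomorphism_of_subsets) (auto simp: image_comp)
    then have h: "homeomorphism UNIV (range (\<sigma> \<circ> F)) (\<sigma> \<circ> F) (F' \<circ> \<tau>)"
      by (rule homeomorphism_compose[OF F])
    have "coord i \<circ> F = fst \<circ> (\<sigma> \<circ> F)" using i by (simp add: fun_eq_iff)
    then have inj': "inj_on (fst \<circ> (\<sigma> \<circ> F)) N" using N(3) by simp
    obtain T where "open T" "s \<in> T" "\<And>x y. x \<in> T \<Longrightarrow> y \<in> T \<Longrightarrow> slides (\<sigma> \<circ> F) x y"
      by (rule slides_local_fst[OF h N(1,2) inj', of p p p]) (use low' in auto)
    then show ?thesis using slides_conjugate[OF hom] by metis
  qed
  have p: "p < fst (F s)" "p < fst (snd (F s))" "p < snd (snd (F s))"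
    using low[of 0 s] low[of 1 s] low[of 2 s] by auto
  consider "i = 0" | "i = 1" | "i \<noteq> 0" "i \<noteq> 1" by blast
  then have "\<exists>T. open T \<and> s \<in> T \<and> (\<forall>y\<in>T. slides F s y)"
  proof cases
    case 1
    show ?thesis
      by (rule *[of id id]) (use 1 p in \<open>auto intro!: homeomorphismI\<close>)
  next
    case 2
    let ?\<sigma> = "\<lambda>y :: 'v ray \<times> 'v ray \<times> 'v ray. (fst (snd y), fst y, snd (snd y))"
    show ?thesis
      by (rule *[of ?\<sigma> ?\<sigma>]) (use 2 p in \<open>auto intro!: homeomorphismI continuous_intros simp: image_iff\<close>)
  next
    case 3
    let ?\<sigma> = "\<lambda>y :: 'v ray \<times> 'v ray \<times> 'v ray. (snd (snd y), fst (snd y), fst y)"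
    show ?thesis
      by (rule *[of ?\<sigma> ?\<sigma>]) (use 3 p in \<open>auto intro!: homeomorphismI continuous_intros simp: image_iff coord_def\<close>)
  qed
  then show "\<exists>T. openin (top_of_set UNIV) T \<and> s \<in> T \<and> (\<forall>y\<in>T. slides F s y)" by simp
next
  show "slides F b a" if "slides F a b" for a b using that by (rule slides_sym)
  show "slides F a c" if "slides F a b" "slides F b c" for a b c using that by (rule slides_trans)
qed simp_all

section \<open>Continuous maps between long rays\<close>

definition unbounded :: "('x \<Rightarrow> 'y::linorder) \<Rightarrow> bool" where
  "unbounded f \<longleftrightarrow> (\<forall>b. \<exists>x. b < f x)"

text \<open>Values are bounded on the compact initial segment up to \<open>x\<close>, so large ones
  must occur beyond it.\<close>

lemma unbounded_above:
  fixes f :: "'a::omega_one ray \<Rightarrow> 'b::linorder_topology"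
  assumes c: "continuous_on UNIV f" and "unbounded f"
  shows "\<exists>y>x. b < f y"
proof -
  let ?o = "Abs_ray (LEAST a. True, 0)"
  have "compact (f ` {?o..x})" using compact_Icc_ray c by (meson compact_continuous_image continuous_on_subset subset_UNIV)
  moreover have "f ` {?o..x} \<noteq> {}" using ray_least[of x] by auto
  ultimately obtain m where m: "\<forall>v\<in>f ` {?o..x}. v \<le> m" using compact_attains_sup by blast
  obtain y where y: "max b m < f y" using assms(2) unfolding unbounded_def by blast
  have "y \<notin> {?o..x}" using m y by (auto simp: not_le dest: leD)
  then have "x < y" using ray_least[of y] by auto
  then show ?thesis using y by auto
qed

text \<open>The two maps overtake each other again and again: between consecutive stages each
  reaches the value that the other had at the earlier stage. In the limit both inequalities hold.
  With the identity or \<open>incl\<close> as \<open>g\<close> this gives fixed points.\<close>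

lemma unbounded_maps_coincide_above:
  fixes f g :: "'a::omega_one ray \<Rightarrow> 'b::linorder_topology"
  assumes f: "continuous_on UNIV f" "unbounded f" and g: "continuous_on UNIV g" "unbounded g"
  shows "\<exists>z>x. f z = g z"
proof -
  have ex: "\<exists>y>x. (\<exists>w. x \<le> w \<and> w \<le> y \<and> f x \<le> g w) \<and> (\<exists>w. x \<le> w \<and> w \<le> y \<and> g x \<le> f w)" for x
  proof -
    obtain w where w: "x < w" "g x < f w" using unbounded_above[OF f] by blast
    obtain v where v: "x < v" "f x < g v" using unbounded_above[OF g] by blast
    have "x < max v w" using w by (simp add: less_max_iff_disj)
    moreover have "x \<le> v \<and> v \<le> max v w \<and> f x \<le> g v" "x \<le> w \<and> w \<le> max v w \<and> g x \<le> f w"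
      using w v by (simp_all add: less_imp_le)
    ultimately show ?thesis by blast
  qed
  obtain z where "x < z" and z: "\<And>n::nat. \<exists>u v. u \<longlonglongrightarrow> z \<and> v \<longlonglongrightarrow> z \<and>
      (\<forall>k. x \<le> u k \<and> u k < v k \<and> v k < z \<and> (\<exists>w. u k \<le> w \<and> w \<le> v k \<and> f (u k) \<le> g w) \<and>
        (\<exists>w. u k \<le> w \<and> w \<le> v k \<and> g (u k) \<le> f w))"
    by (rule interleave[of "\<lambda>n x y. (\<exists>w. x \<le> w \<and> w \<le> y \<and> f x \<le> g w) \<and> (\<exists>w. x \<le> w \<and> w \<le> y \<and> g x \<le> f w)" x])
      (rule ex, blast)
  from z obtain u v where uv: "u \<longlonglongrightarrow> z" "v \<longlonglongrightarrow> z"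
    and "\<And>k. \<exists>w. u k \<le> w \<and> w \<le> v k \<and> f (u k) \<le> g w"
    and "\<And>k. \<exists>w. u k \<le> w \<and> w \<le> v k \<and> g (u k) \<le> f w"
    by blast
  then obtain w w' where w: "\<And>k. u k \<le> w k \<and> w k \<le> v k \<and> f (u k) \<le> g (w k)"
    and w': "\<And>k. u k \<le> w' k \<and> w' k \<le> v k \<and> g (u k) \<le> f (w' k)" by metis
  have lim: "w \<longlonglongrightarrow> z" "w' \<longlonglongrightarrow> z"
    by (rule tendsto_sandwich[OF _ _ uv]; use w w' in simp)+
  have cont: "isCont f z" "isCont g z" using f g by (auto simp: continuous_on_eq_continuous_at)
  have "f z \<le> g z"
    by (rule LIMSEQ_le[OF isCont_tendsto_compose[OF cont(1) uv(1)] isCont_tendsto_compose[OF cont(2) lim(1)]])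
      (use w in auto)
  moreover have "g z \<le> f z"
    by (rule LIMSEQ_le[OF isCont_tendsto_compose[OF cont(2) uv(1)] isCont_tendsto_compose[OF cont(1) lim(2)]])
      (use w' in auto)
  ultimately show ?thesis using \<open>x < z\<close> by (intro exI[of _ z]) auto
qed

text \<open>If every tail had oscillation at least \<open>e\<close>, pairs of points with values
  \<open>e\<close> apart would converge to a common \<open>z\<close>, against continuity there. The
  thresholds found for \<open>e = 1 / (n + 1)\<close> are countably many and so have a common upper
  bound.\<close>

lemma real_valued_eventually_constant:
  fixes f :: "'a::omega_one ray \<Rightarrow> real"
  assumes c: "continuous_on UNIV f"
  shows "\<exists>x. \<forall>y\<ge>x. f y = f x"
proof -
  have "\<exists>x. \<forall>y\<ge>x. \<forall>z\<ge>x. \<bar>f y - f z\<bar> < e" if e: "0 < e" for e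
  proof (rule ccontr)
    assume neg: "\<not> ?thesis"
    have ex: "\<exists>y>x. \<exists>v w. x \<le> v \<and> v \<le> y \<and> x \<le> w \<and> w \<le> y \<and> e \<le> \<bar>f v - f w\<bar>" for x
    proof -
      obtain v w where vw: "x \<le> v" "x \<le> w" "e \<le> \<bar>f v - f w\<bar>" using neg not_less by metis
      obtain y where "max v w < y" using gt_ex by blast
      then show ?thesis using vw by (intro exI[of _ y] conjI exI[of _ v] exI[of _ w]) (auto intro: less_imp_le)
    qed
    obtain z where "Abs_ray (LEAST a. True, 0) < z" and z: "\<And>n::nat. \<exists>u v. u \<longlonglongrightarrow> z \<and> v \<longlonglongrightarrow> z \<and>
      (\<forall>k. Abs_ray (LEAST a. True, 0) \<le> u k \<and> u k < v k \<and> v k < z \<and>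
        (\<exists>p q. u k \<le> p \<and> p \<le> v k \<and> u k \<le> q \<and> q \<le> v k \<and> e \<le> \<bar>f p - f q\<bar>))"
      by (rule interleave[of "\<lambda>n x y. \<exists>p q. x \<le> p \<and> p \<le> y \<and> x \<le> q \<and> q \<le> y \<and> e \<le> \<bar>f p - f q\<bar>"
            "Abs_ray (LEAST a. True, 0)"]) (rule ex, blast)
    from z obtain u v where uv: "u \<longlonglongrightarrow> z" "v \<longlonglongrightarrow> z"
      and "\<And>k. \<exists>p q. u k \<le> p \<and> p \<le> v k \<and> u k \<le> q \<and> q \<le> v k \<and> e \<le> \<bar>f p - f q\<bar>" by blast
    then obtain p q where pq: "\<And>k. u k \<le> p k \<and> p k \<le> v k \<and> u k \<le> q k \<and> q k \<le> v k \<and> e \<le> \<bar>f (p k) - f (q k)\<bar>"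
      by metis
    have lim: "p \<longlonglongrightarrow> z" "q \<longlonglongrightarrow> z"
      by (rule tendsto_sandwich[OF _ _ uv]; use pq in simp)+
    have fz: "isCont f z" using c by (auto simp: continuous_on_eq_continuous_at)
    have "(\<lambda>k. \<bar>f (p k) - f (q k)\<bar>) \<longlonglongrightarrow> \<bar>f z - f z\<bar>"
      by (intro tendsto_rabs tendsto_diff isCont_tendsto_compose[OF fz] lim)
    then have "e \<le> \<bar>f z - f z\<bar>" by (rule LIMSEQ_le_const) (use pq in auto)
    then show False using e by simp
  qed
  then have "\<exists>x. \<forall>y\<ge>x. \<forall>z\<ge>x. \<bar>f y - f z\<bar> < 1 / real (Suc n)" for n by simp
  then obtain X where X: "\<And>n y z. X n \<le> y \<Longrightarrow> X n \<le> z \<Longrightarrow> \<bar>f y - f z\<bar> < 1 / real (Suc n)" by metis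
  obtain x where "\<And>y. y \<in> range X \<Longrightarrow> y < x" by (rule countable_bounded_ray[of "range X"]) auto
  then have x: "X n \<le> x" for n by (auto intro: less_imp_le)
  have "f y = f x" if "x \<le> y" for y
  proof (rule ccontr)
    assume "f y \<noteq> f x"
    then have "0 < \<bar>f y - f x\<bar>" by simp
    then obtain n where "inverse (real (Suc n)) < \<bar>f y - f x\<bar>" using reals_Archimedean by blast
    moreover have "\<bar>f y - f x\<bar> < 1 / real (Suc n)" using X[of n y x] x[of n] that by auto
    ultimately show False by (simp add: inverse_eq_divide)
  qed
  then show ?thesis by blast
qed

text \<open>The strict lower bound \<open>p\<close> places the image in an open interval, which
  carries a real coordinate and so reduces the claim to real-valued maps.\<close>

lemma bounded_eventually_constant:
  fixes f :: "'a::omega_one ray \<Rightarrow> 'b::omega_one ray"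
  assumes c: "continuous_on UNIV f" and p: "\<And>x. p < f x" and "\<not> unbounded f"
  shows "\<exists>x. \<forall>y\<ge>x. f y = f x"
proof -
  obtain b where b: "\<And>x. f x \<le> b" using assms(3) by (auto simp: unbounded_def not_less)
  obtain q where q: "b < q" using gt_ex by blast
  have r: "f x \<in> {p<..<q}" for x using p[of x] b[of x] q by (auto intro: le_less_trans)
  then have "p < q" using p[of undefined] by (auto intro: less_trans)
  then obtain e :: "'b ray \<Rightarrow> real" and g where e: "homeomorphism {p<..<q} UNIV e g" by (rule ray_interval_real)
  have ce: "continuous_on {p<..<q} e" and ge: "\<And>y. y \<in> {p<..<q} \<Longrightarrow> g (e y) = y"
    using e by (auto simp: homeomorphism_def)
  have "continuous_on UNIV (\<lambda>x. e (f x))"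
    by (rule continuous_on_compose2[OF ce c]) (use r in auto)
  then obtain x where "\<forall>y\<ge>x. e (f y) = e (f x)" using real_valued_eventually_constant by blast
  then have "\<forall>y\<ge>x. f y = f x" using ge r by metis
  then show ?thesis by blast
qed

text \<open>A maximum of \<open>f\<close> on \<open>{u..v}\<close> can only be at \<open>v\<close>,
  because \<open>f\<close> increases to the right of every other point. If \<open>f u\<close> were
  not below \<open>f v\<close>, then \<open>u\<close> would be another maximum.\<close>

lemma locally_strict_mono_imp_strict_mono:
  fixes f :: "'a::omega_one ray \<Rightarrow> 'b::linorder_topology"
  assumes c: "continuous_on UNIV f"
    and loc: "\<And>y. \<beta> < y \<Longrightarrow> \<exists>N. open N \<and> y \<in> N \<and> strict_mono_on N f"
  shows "strict_mono_on {\<beta><..} f"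
  unfolding strict_mono_on_def
proof (intro allI impI)
  fix u v assume "u \<in> {\<beta><..} \<and> v \<in> {\<beta><..} \<and> u < v"
  then have uv: "\<beta> < u" "u < v" by auto
  have "compact {u..v}" by (rule compact_Icc_ray)
  moreover have "{u..v} \<noteq> {}" using uv by (auto simp: less_imp_le)
  ultimately obtain m where m: "m \<in> {u..v}" "\<forall>y\<in>{u..v}. f y \<le> f m"
    using continuous_attains_sup[of "{u..v}" f] c by (meson continuous_on_subset subset_UNIV)
  have max: "m = v" if "m \<in> {u..v}" "\<forall>y\<in>{u..v}. f y \<le> f m" for m
  proof (rule ccontr)
    assume "m \<noteq> v"
    then have mv: "m < v" "\<beta> < m" "u \<le> m" using that uv by (auto intro: less_le_trans)
    obtain N where N: "open N" "m \<in> N" "strict_mono_on N f" using loc[OF mv(2)] by blast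
    obtain b where b: "m < b" "{m..<b} \<subseteq> N" using open_right[OF N(1,2) mv(1)] by blast
    obtain y where y: "m < y" "y < min b v" using dense[of m "min b v"] b mv by auto
    have "y \<in> {m..<b}" using y by auto
    then have "y \<in> N" using b by blast
    then have "f m < f y" using N y by (auto simp: strict_mono_on_def)
    moreover have "u \<le> y" using mv(3) y(1) by (meson le_less_trans less_imp_le)
    ultimately show False using that(2) y by (auto dest: leD less_imp_le)
  qed
  have "m = v" using max m by blast
  show "f u < f v"
  proof (rule ccontr)
    assume "\<not> f u < f v"
    then have "\<forall>y\<in>{u..v}. f y \<le> f u" using m \<open>m = v\<close> by (auto simp: not_less intro: order_trans)
    then have "u = v" using max[of u] uv by (auto simp: less_imp_le)
    then show False using uv by simp
  qed
qed

section \<open>The inclusion of the long ray into its collared extension\<close>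

lemma Rep_ray_incl: "Rep_ray (incl x) = (Some (fst (Rep_ray x)), snd (Rep_ray x))"
  unfolding incl_def by (rule Abs_ray_inverse') (auto simp: Rep_ray_bounds)

lemma incl_less_iff [simp]: "incl x < incl y \<longleftrightarrow> x < y"
  by (simp add: less_ray_def Rep_ray_incl)

lemma incl_eq_iff [simp]: "incl x = incl y \<longleftrightarrow> x = y"
  by (metis incl_less_iff less_irrefl linorder_neqE)

lemma incl_le_iff [simp]: "incl x \<le> incl y \<longleftrightarrow> x \<le> y"
  by (simp add: le_less)

text \<open>Any point of the collar lies below the image of the long ray; this one serves as the
  strict lower bound \<open>p\<close> wherever an open interval must contain given points of the
  image.\<close>

definition collar_point :: long_ray' where
  "collar_point = Abs_ray (None, 1/2)"

lemma collar_point_less_incl: "collar_point < incl x"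
  by (simp add: collar_point_def less_ray_def Rep_ray_incl Abs_ray_inverse')

lemma incl_cases:
  obtains x where "y = incl x" | "\<And>x. y < incl x"
proof (cases "fst (Rep_ray y)")
  case None
  then have "y < incl x" for x by (simp add: less_ray_def Rep_ray_incl)
  then show ?thesis using that by blast
next
  case (Some a)
  let ?x = "Abs_ray (a, snd (Rep_ray y))"
  have "Rep_ray (incl ?x) = Rep_ray y"
    by (simp add: Rep_ray_incl Abs_ray_inverse' Rep_ray_bounds Some prod_eq_iff)
  then have "y = incl ?x" by (simp add: Rep_ray_inject)
  then show ?thesis using that by blast
qed

lemma range_incl_upward: "incl x \<le> y \<Longrightarrow> y \<in> range incl"
  by (cases y rule: incl_cases) (auto dest: leD)

lemma unbounded_incl: "unbounded incl"
  unfolding unbounded_def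
proof
  fix b show "\<exists>x. b < incl x"
  proof (cases b rule: incl_cases)
    case (1 y)
    then show ?thesis using gt_ex[of y] by auto
  qed blast
qed

lemma continuous_incl: "continuous_on S incl"
proof -
  have "isCont incl x" for x
    unfolding isCont_def
  proof (rule order_tendstoI)
    fix l assume l: "l < incl x"
    show "\<forall>\<^sub>F y in at x. l < incl y"
    proof (cases l rule: incl_cases)
      case (1 l')
      then have "\<forall>\<^sub>F y in at x. l' < y" using l by (intro order_tendstoD(1)[OF tendsto_ident_at]) auto
      then show ?thesis using 1 by simp
    qed simp
  next
    fix r assume r: "incl x < r"
    then obtain r' where r': "r = incl r'" using range_incl_upward[of x r] by (auto simp: less_imp_le)
    then have "\<forall>\<^sub>F y in at x. y < r'" using r by (intro order_tendstoD(2)[OF tendsto_ident_at]) auto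
    then show "\<forall>\<^sub>F y in at x. incl y < r" using r' by simp
  qed
  then show ?thesis by (simp add: continuous_at_imp_continuous_on)
qed

lemma inv_incl_incl [simp]: "inv incl (incl x) = x"
  by (rule inv_f_f) (simp add: inj_def)

lemma homeomorphism_incl: "homeomorphism UNIV (range incl) incl (inv incl)"
proof (rule homeomorphismI)
  show "continuous_on (range incl) (inv incl)"
  proof (rule continuous_onI_mono)
    have "inv incl ` range incl = UNIV" by (auto simp: image_image)
    then show "open (inv incl ` range incl)" by simp
  qed auto
qed (auto intro: continuous_incl)

lemma cube_eq_map_prod: "cube f = map_prod f (map_prod f f)"
  by (auto simp: cube_def fun_eq_iff)

lemma coord_cube [simp]: "coord i (cube f p) = f (coord i p)"
  by (cases p) (auto simp: coord_def cube_def)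

lemma homeomorphism_cube_incl:
  "homeomorphism UNIV (range (cube incl)) (cube incl) (cube (inv incl))"
proof -
  have "range (cube incl) = range incl \<times> range incl \<times> range incl"
    unfolding cube_eq_map_prod
    by (simp add: map_prod_surj_on[symmetric] UNIV_Times_UNIV[symmetric] del: UNIV_Times_UNIV)
  then show ?thesis
    using homeomorphism_Times[OF homeomorphism_incl homeomorphism_Times[OF homeomorphism_incl homeomorphism_incl]]
    by (simp add: cube_eq_map_prod)
qed

section \<open>Order automorphisms with prescribed values\<close>

text \<open>A translation in a real coordinate, extended by the identity. The bound \<open>p\<close>
  keeps both points off the least point of the ray, which every order automorphism fixes.\<close>

lemma order_automorphism_move_point:
  fixes A B :: "'a::omega_one ray"
  assumes "p < A" "p < B"
  obtains H :: "'a ray \<Rightarrow> 'a ray" where "strict_mono H" "surj H" "H A = B"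
proof -
  obtain q where q: "max A B < q" using gt_ex by blast
  have "p < q" using assms q by (auto intro: less_trans)
  then obtain e :: "'a ray \<Rightarrow> real" and g
    where e: "homeomorphism {p<..<q} UNIV e g" "strict_mono_on {p<..<q} e" "strict_mono g" by (rule ray_interval_real)
  have ge: "\<And>y. y \<in> {p<..<q} \<Longrightarrow> g (e y) = y" and eg: "\<And>r. e (g r) = r" and gI: "\<And>r. g r \<in> {p<..<q}"
    using e(1) by (auto simp: homeomorphism_def)
  have AB: "A \<in> {p<..<q}" "B \<in> {p<..<q}" using assms q by auto
  define H where "H y = (if y \<in> {p<..<q} then g (e y + (e B - e A)) else y)" for y
  have HI: "H y \<in> {p<..<q} \<longleftrightarrow> y \<in> {p<..<q}" for y using gI by (simp add: H_def)
  have "strict_mono H"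
  proof (rule strict_monoI)
    fix x y :: "'a ray" assume xy: "x < y"
    consider "x \<in> {p<..<q} \<and> y \<in> {p<..<q}" | "x \<in> {p<..<q}" "q \<le> y" | "x \<le> p" "y \<in> {p<..<q}"
      | "x \<notin> {p<..<q}" "y \<notin> {p<..<q}" using xy by (force simp: not_less)
    then show "H x < H y"
    proof cases
      case 1
      then have "e x < e y" using e(2) xy by (auto simp: strict_mono_on_def)
      then show ?thesis using 1 e(3) by (simp add: H_def strict_mono_less)
    next
      case 2
      then have "H x < q" "H y = y" using HI[of x] by (auto simp: H_def)
      then show ?thesis using 2 by simp
    next
      case 3
      then have "p < H y" "H x = x" using HI[of y] by (auto simp: H_def)
      then show ?thesis using 3 by simp
    next
      case 4
      then have "H x = x" "H y = y" by (simp_all only: H_def if_False)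
      then show ?thesis using xy by simp
    qed
  qed
  moreover have "\<exists>x. H x = y" for y
  proof (cases "y \<in> {p<..<q}")
    case True
    then show ?thesis using gI eg ge by (intro exI[of _ "g (e y - (e B - e A))"]) (simp add: H_def)
  next
    case False
    then have "H y = y" by (simp only: H_def if_False)
    then show ?thesis ..
  qed
  then have "surj H" by (metis surjI)
  moreover have "H A = B" using AB ge by (simp add: H_def)
  ultimately show thesis by (rule that)
qed

lemma order_automorphism_extend:
  fixes A B :: "'a::omega_one ray"
  assumes "p < A" "p < B" and T: "strict_mono_on {A..} T" "T ` {A..} = {B..}"
  obtains H :: "'a ray \<Rightarrow> 'a ray" where "strict_mono H" "surj H" "\<And>y. A \<le> y \<Longrightarrow> H y = T y"
proof -
  obtain H0 :: "'a ray \<Rightarrow> 'a ray" where H0: "strict_mono H0" "surj H0" "H0 A = B"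
    using order_automorphism_move_point[OF assms(1,2)] .
  define H where "H y = (if A \<le> y then T y else H0 y)" for y
  have TB: "B \<le> T y" if "A \<le> y" for y using T(2) that by auto
  have H0B: "H0 y < B \<longleftrightarrow> y < A" for y using H0(1,3) by (metis strict_mono_less)
  have "strict_mono H"
  proof (rule strict_monoI)
    fix x y :: "'a ray" assume xy: "x < y"
    consider "A \<le> x" | "x < A" "A \<le> y" | "y < A" using xy by (meson not_le)
    then show "H x < H y"
    proof cases
      case 1
      then show ?thesis using T(1) xy by (auto simp: H_def strict_mono_on_def intro: less_imp_le)
    next
      case 2
      then show ?thesis using TB[of y] H0B[of x] by (auto simp: H_def intro: less_le_trans dest: leD)
    next
      case 3
      then have "x < A" using xy by (rule less_trans[rotated])
      then show ?thesis using 3 H0(1) xy by (auto simp: H_def strict_mono_less dest: leD)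
    qed
  qed
  moreover have "\<exists>x. H x = y" for y
  proof (cases "B \<le> y")
    case True
    then obtain x where "A \<le> x" "T x = y" using T(2) by (metis atLeast_iff imageE)
    then show ?thesis by (intro exI[of _ x]) (simp add: H_def)
  next
    case False
    obtain x where "H0 x = y" using H0(2) by (metis surjD)
    then show ?thesis using False H0B[of x] by (intro exI[of _ x]) (auto simp: H_def)
  qed
  then have "surj H" by (metis surjI)
  ultimately show thesis by (rule that) (simp add: H_def)
qed

section \<open>Charts around finite sets\<close>

lemma C_infinity_on_cong:
  assumes "C_infinity_on S h" "\<And>x. x \<in> S \<Longrightarrow> h x = h' x"
  shows "C_infinity_on S h'"
proof -
  obtain D where D: "D 0 = h" "\<And>k x. x \<in> S \<Longrightarrow> (D k has_vector_derivative D (Suc k) x) (at x within S)"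
    using assms(1) by (auto simp: C_infinity_on_def)
  have "((D(0 := h')) k has_vector_derivative (D(0 := h')) (Suc k) x) (at x within S)" if x: "x \<in> S" for k x
  proof (cases "k = 0")
    case True
    have "(h' has_vector_derivative D (Suc 0) x) (at x within S)"
      by (rule has_vector_derivative_transform[OF x _ D(2)[OF x, of 0]]) (use D(1) assms(2) in simp)
    then show ?thesis using True by simp
  next
    case False
    then show ?thesis using D(2)[OF x] by simp
  qed
  then show ?thesis unfolding C_infinity_on_def by (intro exI[of _ "D(0 := h')"]) simp
qed

lemma C_infinity_on_subset:
  assumes "C_infinity_on S h" "T \<subseteq> S"
  shows "C_infinity_on T h"
proof -
  obtain D where "D 0 = h" "\<And>k x. x \<in> S \<Longrightarrow> (D k has_vector_derivative D (Suc k) x) (at x within S)"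
    using assms(1) by (auto simp: C_infinity_on_def)
  then show ?thesis unfolding C_infinity_on_def
    using assms(2) by (intro exI[of _ D]) (auto intro: has_vector_derivative_within_subset)
qed

lemma C_infinity_on_const: "C_infinity_on S (\<lambda>x. c)"
  unfolding C_infinity_on_def
  by (intro exI[of _ "\<lambda>k x. if k = 0 then c else 0"]) (auto intro: derivative_eq_intros)

lemma C_infinity_on_ident: "C_infinity_on S (\<lambda>x. x)"
proof -
  let ?D = "\<lambda>k x::real. if k = 0 then x else if k = 1 then 1 else 0"
  have "(?D k has_vector_derivative ?D (Suc k) x) (at x within S)" for k x
    by (cases "k = 0"; cases "k = 1") (simp_all add: has_vector_derivative_id)
  then show ?thesis unfolding C_infinity_on_def by (intro exI[of _ ?D]) simp
qed

lemma C_infinity_on_add_const: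
  assumes "C_infinity_on S h"
  shows "C_infinity_on S (\<lambda>x. h x + c)"
proof -
  obtain D where D: "D 0 = h" "\<And>k x. x \<in> S \<Longrightarrow> (D k has_vector_derivative D (Suc k) x) (at x within S)"
    using assms by (auto simp: C_infinity_on_def)
  let ?D = "D(0 := \<lambda>x. h x + c)"
  have "(?D k has_vector_derivative ?D (Suc k) x) (at x within S)" if x: "x \<in> S" for k x
    using D(2)[OF x, of k] D(1) by (cases "k = 0") (auto simp: has_vector_derivative_add_const)
  then show ?thesis unfolding C_infinity_on_def by (intro exI[of _ ?D]) simp
qed

lemma C_infinity_on_shift:
  assumes "C_infinity_on S h"
  shows "C_infinity_on ((\<lambda>x. x + c) ` S) (\<lambda>x. h (x - c))"
proof -
  obtain D where D: "D 0 = h" "\<And>k x. x \<in> S \<Longrightarrow> (D k has_vector_derivative D (Suc k) x) (at x within S)"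
    using assms by (auto simp: C_infinity_on_def)
  have "((\<lambda>x. D k (x - c)) has_vector_derivative D (Suc k) (x - c)) (at x within (\<lambda>x. x + c) ` S)"
    if x: "x \<in> (\<lambda>x. x + c) ` S" for k x
  proof -
    have "x - c \<in> S" using x by auto
    have im: "(\<lambda>x. x - c) ` (\<lambda>x. x + c) ` S = S" by (force simp: image_image)
    have "((\<lambda>x. x - c) has_vector_derivative 1) (at x within (\<lambda>x. x + c) ` S)"
      by (auto intro: derivative_eq_intros)
    from vector_diff_chain_within[OF this, of "D k" "D (Suc k) (x - c)"] show ?thesis
      using D(2)[OF \<open>x - c \<in> S\<close>, of k] unfolding im by (simp add: o_def)
  qed
  then show ?thesis unfolding C_infinity_on_def using D(1)
    by (intro exI[of _ "\<lambda>k x. D k (x - c)"]) simp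
qed

lemma C_infinity_on_Pair:
  assumes "C_infinity_on S f" "C_infinity_on S g"
  shows "C_infinity_on S (\<lambda>x. (f x, g x))"
proof -
  obtain D E where "D 0 = f" "\<And>k x. x \<in> S \<Longrightarrow> (D k has_vector_derivative D (Suc k) x) (at x within S)"
    and "E 0 = g" "\<And>k x. x \<in> S \<Longrightarrow> (E k has_vector_derivative E (Suc k) x) (at x within S)"
    using assms unfolding C_infinity_on_def by blast
  then show ?thesis unfolding C_infinity_on_def
    by (intro exI[of _ "\<lambda>k x. (D k x, E k x)"]) (auto intro: has_vector_derivative_Pair)
qed

text \<open>A derivative within \<open>S \<union> T\<close> depends only on nearby points, and
  \<open>P\<close> and \<open>Q\<close> keep the other piece away, so the families of derivatives
  can be glued. Disjointness alone would not be enough.\<close>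

lemma C_infinity_on_Un_separated:
  assumes "C_infinity_on S h" "C_infinity_on T h"
    and O: "open P" "open Q" "S \<subseteq> P" "T \<subseteq> Q" "P \<inter> T = {}" "Q \<inter> S = {}"
  shows "C_infinity_on (S \<union> T) h"
proof -
  obtain D E where D: "D 0 = h" "\<And>k x. x \<in> S \<Longrightarrow> (D k has_vector_derivative D (Suc k) x) (at x within S)"
    and E: "E 0 = h" "\<And>k x. x \<in> T \<Longrightarrow> (E k has_vector_derivative E (Suc k) x) (at x within T)"
    using assms unfolding C_infinity_on_def by blast
  define F where "F k x = (if x \<in> S then D k x else E k x)" for k x
  have "(F k has_vector_derivative F (Suc k) x) (at x within S \<union> T)" if "x \<in> S \<union> T" for k x
  proof (cases "x \<in> S")
    case True
    have "at x within S \<union> T = at x within S"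
      by (rule at_within_nhd[of x P]) (use O True in auto)
    then show ?thesis using True D(2)[OF True, of k]
      by (auto simp: F_def intro: has_vector_derivative_transform)
  next
    case False
    then have xT: "x \<in> T" using that by simp
    have "at x within S \<union> T = at x within T"
      by (rule at_within_nhd[of x Q]) (use O xT in auto)
    moreover have "E k y = F k y" if "y \<in> T" for y using that O by (auto simp: F_def)
    ultimately show ?thesis using xT False E(2)[OF xT, of k]
      by (auto simp: F_def intro: has_vector_derivative_transform)
  qed
  moreover have "F 0 = h" using D(1) E(1) by (auto simp: F_def)
  ultimately show ?thesis unfolding C_infinity_on_def by blast
qed

section \<open>Constructing members of a maximal atlas\<close>

lemma is_chart_iff:
  "is_chart (U, \<psi>) \<longleftrightarrow> open U \<and> origin \<in> U \<and> homeomorphism U (\<psi> ` U) \<psi> (inv_into U \<psi>)"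
proof -
  have "homeomorphism U (\<psi> ` U) \<psi> (inv_into U \<psi>)" if "homeomorphism U (\<psi> ` U) \<psi> \<psi>'" for \<psi>'
  proof -
    have "inj_on \<psi> U" using that by (auto simp: homeomorphism_def intro: inj_on_inverseI)
    then have eq: "inv_into U \<psi> y = \<psi>' y" if "y \<in> \<psi> ` U" for y
      using that \<open>homeomorphism U (\<psi> ` U) \<psi> \<psi>'\<close> by (auto simp: homeomorphism_def)
    show ?thesis
      by (rule homeomorphism_cong[OF that]) (use eq in auto)
  qed
  then show ?thesis by (auto simp: is_chart_def)
qed

lemma compatible_sym: "compatible c d \<longleftrightarrow> compatible d c"
  by (auto simp: compatible_def Int_commute split: prod.splits)

lemma maximal_atlas_memI:
  assumes "maximal_atlas \<A>" "is_chart c" "compatible c c" "\<And>d. d \<in> \<A> \<Longrightarrow> compatible c d"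
  shows "c \<in> \<A>"
proof -
  have "is_atlas (insert c \<A>)"
    unfolding is_atlas_def
  proof (intro conjI ballI)
    have A: "is_atlas \<A>" using assms(1) by (simp add: maximal_atlas_def)
    show "is_chart d" if "d \<in> insert c \<A>" for d using that A assms(2) by (auto simp: is_atlas_def)
    show "(\<Union>(U, \<psi>)\<in>insert c \<A>. U) = UNIV" using A by (auto simp: is_atlas_def)
    show "compatible d e" if "d \<in> insert c \<A>" "e \<in> insert c \<A>" for d e
      using that A assms(3,4) compatible_sym[of d c] unfolding is_atlas_def by blast
  qed
  then have "insert c \<A> = \<A>" using assms(1) by (auto simp: maximal_atlas_def)
  then show ?thesis by blast
qed

lemma chart_openin_image:
  assumes "is_chart (U, \<psi>)" "open W" "W \<subseteq> U"
  obtains P where "open P" "\<psi> ` W = \<psi> ` U \<inter> P"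
proof -
  have "openin (top_of_set (\<psi> ` U)) (\<psi> ` W)"
    by (rule homeomorphism_imp_open_map[of U _ _ "inv_into U \<psi>"])
      (use assms in \<open>auto simp: is_chart_iff intro: open_subset\<close>)
  then show thesis using that by (auto simp: openin_open)
qed

text \<open>A chart domain need not be connected, so charts around two points are combined by shrinking them to
  disjoint sets and translating one image away from the other.\<close>

lemma maximal_atlas_chart_insert:
  assumes A: "maximal_atlas \<A>" and V: "(V, \<eta>) \<in> \<A>" "X \<subseteq> V" "finite X" "origin \<in> X"
    and U: "(U, \<psi>) \<in> \<A>" "x \<in> U" "x \<notin> X"
  obtains W \<theta> where "(W, \<theta>) \<in> \<A>" "insert x X \<subseteq> W"
proof -
  have chart: "is_chart (V, \<eta>)" "is_chart (U, \<psi>)" using A V U by (auto simp: maximal_atlas_def is_atlas_def)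
  have hV: "homeomorphism V (\<eta> ` V) \<eta> (inv_into V \<eta>)" and hU: "homeomorphism U (\<psi> ` U) \<psi> (inv_into U \<psi>)"
    and oV: "open V" and oU: "open U" using chart by (auto simp: is_chart_iff)
  have injV: "inj_on \<eta> V" and injU: "inj_on \<psi> U"
    using hV hU by (auto simp: homeomorphism_def intro: inj_on_inverseI)
  have c\<eta>: "continuous_on V \<eta>" and c\<psi>: "continuous_on U \<psi>" using hV hU by (auto simp: homeomorphism_def)
  have "open (UNIV - X)" "x \<in> UNIV - X" using V(3) U(3) by (auto simp: finite_imp_closed open_Diff)
  then obtain a b M where M: "open M" "x \<in> M" "M \<subseteq> {a..<b}" "{a..b} \<subseteq> UNIV - X" by (rule ray_neighbourhood)
  define m where "m = Max ((\<lambda>y. \<bar>\<eta> y\<bar>) ` X) + 1"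
  have m: "\<bar>\<eta> y\<bar> < m" if "y \<in> X" for y
  proof -
    have "\<bar>\<eta> y\<bar> \<le> Max ((\<lambda>y. \<bar>\<eta> y\<bar>) ` X)" using V(3) that by (intro Max_ge) auto
    then show ?thesis by (simp add: m_def)
  qed
  have "0 < m" using m[OF V(4)] by linarith
  \<comment> \<open>Removing the closed interval \<open>{a..b}\<close> keeps \<open>V'\<close> open
    and disjoint from \<open>U'\<close>, which lies in \<open>M\<close>. Both chart images are made
    bounded so that a translation can separate them.\<close>
  define V' where "V' = (V \<inter> \<eta> -` {-m<..<m}) \<inter> - {a..b}"
  define U' where "U' = (U \<inter> \<psi> -` {\<psi> x - 1<..<\<psi> x + 1}) \<inter> M"
  have oV': "open V'" unfolding V'_def
    by (intro open_Int continuous_open_preimage[OF c\<eta> oV]) auto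
  have oU': "open U'" unfolding U'_def
    by (intro open_Int continuous_open_preimage[OF c\<psi> oU]) (use M in auto)
  have disj: "V' \<inter> U' = {}"
  proof -
    have "{a..<b} \<subseteq> {a..b}" by auto
    then show ?thesis using M(3) unfolding V'_def U'_def by blast
  qed
  have XV': "X \<subseteq> V'"
  proof
    fix y assume y: "y \<in> X"
    then have "y \<in> V" "y \<notin> {a..b}" using V(2) M(4) by blast+
    then show "y \<in> V'" using m[OF y] by (simp add: V'_def abs_less_iff)
  qed
  have xU': "x \<in> U'" using U(2) M(2) by (simp add: U'_def)
  have sub: "V' \<subseteq> V" "U' \<subseteq> U" by (auto simp: V'_def U'_def)
  \<comment> \<open>On \<open>U'\<close> the values of \<open>\<psi>\<close> differ from
    \<open>\<psi> x\<close> by less than 1, so the shifted values lie strictly between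
    \<open>m\<close> and \<open>m + 2\<close>, while those of \<open>\<eta>\<close> on
    \<open>V'\<close> lie between \<open>-m\<close> and \<open>m\<close>.\<close>
  define c where "c = m + 1 - \<psi> x"
  define W where "W = V' \<union> U'"
  define \<theta> where "\<theta> y = (if y \<in> V' then \<eta> y else \<psi> y + c)" for y
  have \<theta>V: "\<theta> y = \<eta> y" if "y \<in> V'" for y using that by (simp add: \<theta>_def)
  have \<theta>U: "\<theta> y = \<psi> y + c" if "y \<in> U'" for y using that disj by (auto simp: \<theta>_def)
  have imV: "\<theta> ` V' \<subseteq> {..<m}" and imU: "\<theta> ` U' \<subseteq> {m<..}"
    by (auto simp: \<theta>V \<theta>U) (auto simp: V'_def U'_def c_def)
  have injW: "inj_on \<theta> W"
  proof -
    have "inj_on \<theta> V'" using inj_on_subset[OF injV sub(1)] \<theta>V by (simp add: inj_on_def)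
    moreover have "inj_on \<theta> U'" using inj_on_subset[OF injU sub(2)] \<theta>U by (simp add: inj_on_def)
    moreover have "\<theta> ` (V' - U') \<inter> \<theta> ` (U' - V') = {}" using imV imU by (auto 0 4 dest: less_trans)
    ultimately show ?thesis unfolding W_def by (simp add: inj_on_Un)
  qed
  have invV: "inv_into W \<theta> (\<theta> y) = y" if "y \<in> W" for y using injW that by simp
  have invV': "inv_into W \<theta> r = inv_into V \<eta> r" if r: "r \<in> \<theta> ` V'" for r
  proof -
    obtain y where y: "y \<in> V'" "r = \<theta> y" using r by blast
    have "inv_into W \<theta> r = y" unfolding y(2) by (rule invV) (use y in \<open>simp add: W_def\<close>)
    moreover have "inv_into V \<eta> r = y" unfolding y(2) \<theta>V[OF y(1)] using y sub(1) injV by (auto intro: inv_into_f_f)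
    ultimately show ?thesis by simp
  qed
  have invU': "inv_into W \<theta> r = inv_into U \<psi> (r - c)" if r: "r \<in> \<theta> ` U'" for r
  proof -
    obtain y where y: "y \<in> U'" "r = \<theta> y" using r by blast
    have "inv_into W \<theta> r = y" unfolding y(2) by (rule invV) (use y in \<open>simp add: W_def\<close>)
    moreover have "inv_into U \<psi> (r - c) = y"
      unfolding y(2) \<theta>U[OF y(1)] using y sub(2) injU by (auto intro: inv_into_f_f)
    ultimately show ?thesis by simp
  qed
  have imW: "\<theta> ` W = \<theta> ` V' \<union> \<theta> ` U'" by (auto simp: W_def)
  have "continuous_on (V' \<union> U') \<theta>"
  proof (rule continuous_on_open_Un[OF oV' oU'])
    show "continuous_on V' \<theta>"
      by (rule continuous_on_eq[OF continuous_on_subset[OF c\<eta> sub(1)]]) (simp add: \<theta>V)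
    have "continuous_on U' (\<lambda>y. \<psi> y + c)" by (intro continuous_intros continuous_on_subset[OF c\<psi> sub(2)])
    then show "continuous_on U' \<theta>" by (rule continuous_on_eq) (simp add: \<theta>U)
  qed
  moreover have "continuous_on (\<theta> ` V' \<union> \<theta> ` U') (inv_into W \<theta>)"
  proof (rule continuous_on_Un_local_open)
    have "\<theta> ` V' = (\<theta> ` V' \<union> \<theta> ` U') \<inter> {..<m}" "\<theta> ` U' = (\<theta> ` V' \<union> \<theta> ` U') \<inter> {m<..}"
      using imV imU by (force dest: less_trans)+
    then show "openin (top_of_set (\<theta> ` V' \<union> \<theta> ` U')) (\<theta> ` V')" "openin (top_of_set (\<theta> ` V' \<union> \<theta> ` U')) (\<theta> ` U')"
      by (metis openin_open_Int open_lessThan, metis openin_open_Int open_greaterThan)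
    have "continuous_on (\<eta> ` V) (inv_into V \<eta>)" using hV by (simp add: homeomorphism_def)
    then have "continuous_on (\<theta> ` V') (inv_into V \<eta>)"
      by (rule continuous_on_subset) (use sub \<theta>V in auto)
    then show "continuous_on (\<theta> ` V') (inv_into W \<theta>)" by (rule continuous_on_eq) (simp add: invV')
    have "continuous_on (\<psi> ` U) (inv_into U \<psi>)" using hU by (simp add: homeomorphism_def)
    then have "continuous_on (\<theta> ` U') (\<lambda>r. inv_into U \<psi> (r - c))"
      by (rule continuous_on_compose2) (use sub \<theta>U in \<open>auto intro!: continuous_intros\<close>)
    then show "continuous_on (\<theta> ` U') (inv_into W \<theta>)" by (rule continuous_on_eq) (simp add: invU')
  qed
  ultimately have "homeomorphism W (\<theta> ` W) \<theta> (inv_into W \<theta>)"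
    unfolding W_def[symmetric] imW[symmetric]
    by (intro homeomorphismI) (auto simp: invV image_image f_inv_into_f)
  then have chW: "is_chart (W, \<theta>)"
    using oV' oU' XV' V(4) by (auto simp: is_chart_iff W_def)
  have "compatible (W, \<theta>) (Z, \<zeta>)" if Z: "(Z, \<zeta>) \<in> \<A>" for Z \<zeta>
  proof -
    have chZ: "is_chart (Z, \<zeta>)" using Z A by (auto simp: maximal_atlas_def is_atlas_def)
    then have oZ: "open Z" and hZ: "homeomorphism Z (\<zeta> ` Z) \<zeta> (inv_into Z \<zeta>)" by (auto simp: is_chart_iff)
    have injZ: "inj_on \<zeta> Z" using hZ by (auto simp: homeomorphism_def intro: inj_on_inverseI)
    have "compatible (V, \<eta>) (Z, \<zeta>)" "compatible (U, \<psi>) (Z, \<zeta>)"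
      using A V U Z by (auto simp: maximal_atlas_def is_atlas_def)
    then have cV: "C_infinity_on (\<eta> ` (V \<inter> Z)) (\<zeta> \<circ> inv_into V \<eta>)" "C_infinity_on (\<zeta> ` (V \<inter> Z)) (\<eta> \<circ> inv_into Z \<zeta>)"
      and cU: "C_infinity_on (\<psi> ` (U \<inter> Z)) (\<zeta> \<circ> inv_into U \<psi>)" "C_infinity_on (\<zeta> ` (U \<inter> Z)) (\<psi> \<circ> inv_into Z \<zeta>)"
      by (auto simp: compatible_def)
    have "C_infinity_on (\<theta> ` (V' \<inter> Z) \<union> \<theta> ` (U' \<inter> Z)) (\<zeta> \<circ> inv_into W \<theta>)"
    proof (rule C_infinity_on_Un_separated)
      have "C_infinity_on (\<theta> ` (V' \<inter> Z)) (\<zeta> \<circ> inv_into V \<eta>)"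
        by (rule C_infinity_on_subset[OF cV(1)]) (use sub \<theta>V in auto)
      then show "C_infinity_on (\<theta> ` (V' \<inter> Z)) (\<zeta> \<circ> inv_into W \<theta>)"
        by (rule C_infinity_on_cong) (use invV' in auto)
      have "C_infinity_on (\<theta> ` (U' \<inter> Z)) (\<lambda>r. (\<zeta> \<circ> inv_into U \<psi>) (r - c))"
        by (rule C_infinity_on_subset[OF C_infinity_on_shift[OF cU(1)]]) (use sub \<theta>U in auto)
      then show "C_infinity_on (\<theta> ` (U' \<inter> Z)) (\<zeta> \<circ> inv_into W \<theta>)"
        by (rule C_infinity_on_cong) (use invU' in auto)
      show "\<theta> ` (V' \<inter> Z) \<subseteq> {..<m}" "\<theta> ` (U' \<inter> Z) \<subseteq> {m<..}" using imV imU by auto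
      then show "{..<m} \<inter> \<theta> ` (U' \<inter> Z) = {}" "{m<..} \<inter> \<theta> ` (V' \<inter> Z) = {}" by (auto dest: less_trans)
    qed auto
    moreover have "C_infinity_on (\<zeta> ` (V' \<inter> Z) \<union> \<zeta> ` (U' \<inter> Z)) (\<theta> \<circ> inv_into Z \<zeta>)"
    proof -
      obtain P where P: "open P" "\<zeta> ` (V' \<inter> Z) = \<zeta> ` Z \<inter> P"
        by (rule chart_openin_image[OF chZ, of "V' \<inter> Z"]) (use oV' oZ in auto)
      obtain Q where Q: "open Q" "\<zeta> ` (U' \<inter> Z) = \<zeta> ` Z \<inter> Q"
        by (rule chart_openin_image[OF chZ, of "U' \<inter> Z"]) (use oU' oZ in auto)
      have d: "\<zeta> ` (V' \<inter> Z) \<inter> \<zeta> ` (U' \<inter> Z) = {}"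
        using disj injZ by (auto dest: inj_onD)
      have inv: "inv_into Z \<zeta> (\<zeta> y) = y" if "y \<in> Z" for y using injZ that by simp
      have "C_infinity_on (\<zeta> ` (V' \<inter> Z)) (\<eta> \<circ> inv_into Z \<zeta>)"
        by (rule C_infinity_on_subset[OF cV(2)]) (use sub in auto)
      then have 1: "C_infinity_on (\<zeta> ` (V' \<inter> Z)) (\<theta> \<circ> inv_into Z \<zeta>)"
        by (rule C_infinity_on_cong) (use inv \<theta>V in auto)
      have "C_infinity_on (\<zeta> ` (U' \<inter> Z)) (\<lambda>r. (\<psi> \<circ> inv_into Z \<zeta>) r + c)"
        by (rule C_infinity_on_add_const[OF C_infinity_on_subset[OF cU(2)]]) (use sub in auto)
      then have 2: "C_infinity_on (\<zeta> ` (U' \<inter> Z)) (\<theta> \<circ> inv_into Z \<zeta>)"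
        by (rule C_infinity_on_cong) (use inv \<theta>U in auto)
      show ?thesis
        by (rule C_infinity_on_Un_separated[OF 1 2 P(1) Q(1)]) (use P(2) Q(2) d in blast)+
    qed
    moreover have "W \<inter> Z = (V' \<inter> Z) \<union> (U' \<inter> Z)" by (auto simp: W_def)
    ultimately show ?thesis by (simp add: compatible_def image_Un)
  qed
  moreover have "C_infinity_on (\<theta> ` W) (\<theta> \<circ> inv_into W \<theta>)"
    by (rule C_infinity_on_cong[OF C_infinity_on_ident]) (simp add: f_inv_into_f)
  then have "compatible (W, \<theta>) (W, \<theta>)" by (simp add: compatible_def)
  ultimately have "(W, \<theta>) \<in> \<A>" using maximal_atlas_memI[OF A chW] by auto
  moreover have "insert x X \<subseteq> W" using XV' xU' by (auto simp: W_def)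
  ultimately show thesis by (rule that)
qed

text \<open>The third power has only charts on \<open>V \<times> V \<times> V\<close>, so a single
  \<open>V\<close> must contain all three coordinates of a point; near a fixed point it must contain
  the parameter as well. The induction carries \<open>origin\<close> along because every chart
  domain has to contain it.\<close>

lemma maximal_atlas_chart_finite:
  assumes A: "maximal_atlas \<A>" and "finite X"
  obtains V \<eta> where "(V, \<eta>) \<in> \<A>" "X \<subseteq> V"
proof -
  have ex: "\<exists>U \<psi>. (U, \<psi>) \<in> \<A> \<and> x \<in> U" for x
  proof -
    have "x \<in> (\<Union>(U, \<psi>)\<in>\<A>. U)" using A by (simp add: maximal_atlas_def is_atlas_def)
    then show ?thesis by auto
  qed
  have "\<exists>V \<eta>. (V, \<eta>) \<in> \<A> \<and> insert origin X \<subseteq> V"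
    using assms(2)
  proof induction
    case empty
    then show ?case using ex[of origin] by auto
  next
    case (insert x X)
    then obtain V \<eta> where V: "(V, \<eta>) \<in> \<A>" "insert origin X \<subseteq> V" by blast
    obtain U \<psi> where U: "(U, \<psi>) \<in> \<A>" "x \<in> U" using ex by blast
    show ?case
    proof (cases "x \<in> insert origin X")
      case True
      then show ?thesis using V by (intro exI[of _ V] exI[of _ \<eta>]) auto
    next
      case False
      obtain W \<theta> where "(W, \<theta>) \<in> \<A>" "insert x (insert origin X) \<subseteq> W"
        by (rule maximal_atlas_chart_insert[OF A V _ _ U False]) (use insert in auto)
      then show ?thesis by (intro exI[of _ W] exI[of _ \<theta>]) auto
    qed
  qed
  then show thesis using that by auto
qed

section \<open>Local behaviour of knots\<close>

lemma knotD:
  assumes "f \<in> knots \<A>"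
  obtains f' where "homeomorphism UNIV (range f) f f'"
  using assms by (auto simp: knots_def smooth_embedding_def)

lemma continuous_knot: "f \<in> knots \<A> \<Longrightarrow> continuous_on S f"
  by (rule knotD) (auto simp: homeomorphism_def intro: continuous_on_subset)

lemma continuous_knot_coord: "f \<in> knots \<A> \<Longrightarrow> continuous_on S (coord i \<circ> f)"
  by (intro continuous_on_compose continuous_knot continuous_coord)

lemma bounded_linear_coord: "bounded_linear (coord i :: 'a::real_normed_vector \<times> 'a \<times> 'a \<Rightarrow> 'a)"
proof -
  consider "i = 0" | "i = 1" | "i \<noteq> 0" "i \<noteq> 1" by blast
  then show ?thesis
    by cases (simp_all add: coord_def[abs_def] bounded_linear_fst bounded_linear_snd
        bounded_linear_compose[OF bounded_linear_fst bounded_linear_snd]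
        bounded_linear_compose[OF bounded_linear_snd bounded_linear_snd])
qed

lemma coord_eqI: "coord 0 p = coord 0 q \<Longrightarrow> coord 1 p = coord 1 q \<Longrightarrow> coord 2 p = coord 2 q \<Longrightarrow> p = q"
  by (cases p; cases q) (simp add: coord_def)

lemma mem_cube_iff: "p \<in> V \<times> V \<times> V \<longleftrightarrow> (\<forall>i. coord i p \<in> V)"
proof
  show "p \<in> V \<times> V \<times> V \<Longrightarrow> \<forall>i. coord i p \<in> V" by (auto simp: coord_def)
  assume *: "\<forall>i. coord i p \<in> V"
  show "p \<in> V \<times> V \<times> V"
    using *[rule_format, of 0] *[rule_format, of 1] *[rule_format, of 2] by (auto simp: mem_Times_iff)
qed

text \<open>The ray has no greatest element, so even at the boundary point there are points close to
  \<open>s\<close> on its right. Hence derivatives within the image of a chart are unique.\<close>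

lemma chart_image_no_isolated_point:
  assumes "is_chart (U, \<psi>)" "open W" "W \<subseteq> U" "s \<in> W"
  shows "at (\<psi> s) within \<psi> ` W \<noteq> bot"
proof -
  have h: "homeomorphism U (\<psi> ` U) \<psi> (inv_into U \<psi>)" using assms by (simp add: is_chart_iff)
  have inj: "inj_on \<psi> U" using h by (auto simp: homeomorphism_def intro: inj_on_inverseI)
  have c: "continuous_on W \<psi>" using h assms(3) by (auto simp: homeomorphism_def intro: continuous_on_subset)
  have "\<psi> s islimpt \<psi> ` W"
    unfolding islimpt_def
  proof (intro allI impI)
    fix T assume T: "\<psi> s \<in> T" "open T"
    have "open (W \<inter> \<psi> -` T)" by (rule continuous_open_preimage[OF c assms(2) T(2)])
    moreover have "s \<in> W \<inter> \<psi> -` T" using T assms by auto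
    moreover obtain q where "s < q" using gt_ex by blast
    ultimately obtain b where b: "s < b" "{s..<b} \<subseteq> W \<inter> \<psi> -` T" using open_right by metis
    obtain y where y: "s < y" "y < b" using dense b by blast
    have "y \<in> {s..<b}" using y by auto
    then have "y \<in> W" "\<psi> y \<in> T" using b by auto
    moreover have "\<psi> y \<noteq> \<psi> s" using inj y assms \<open>y \<in> W\<close> by (auto dest!: inj_onD)
    ultimately show "\<exists>r\<in>\<psi> ` W. r \<in> T \<and> r \<noteq> \<psi> s" by blast
  qed
  then show ?thesis by (simp add: trivial_limit_within)
qed

lemma knot_chart_derivative:
  assumes f: "f \<in> knots \<A>" and A: "maximal_atlas \<A>"
    and U: "(U, \<psi>) \<in> \<A>" "s \<in> U" and V: "(V, \<eta>) \<in> \<A>" "\<And>i. coord i (f s) \<in> V"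
  obtains W D where "open W" "s \<in> W" "W \<subseteq> U" "\<And>y i. y \<in> W \<Longrightarrow> coord i (f y) \<in> V"
    "\<And>i. continuous_on (\<psi> ` W) (\<lambda>r. coord i (D r))"
    "\<And>y i. y \<in> W \<Longrightarrow>
      ((\<lambda>r. \<eta> (coord i (f (inv_into U \<psi> r)))) has_vector_derivative coord i (D (\<psi> y))) (at (\<psi> y) within \<psi> ` W)"
    "\<And>y. y \<in> W \<Longrightarrow> D (\<psi> y) \<noteq> 0"
proof -
  have chU: "is_chart (U, \<psi>)" and chV: "is_chart (V, \<eta>)" using A U V by (auto simp: maximal_atlas_def is_atlas_def)
  then have oU: "open U" and oV: "open V" by (auto simp: is_chart_iff)
  define W where "W = U \<inter> f -` (V \<times> V \<times> V)"
  define h where "h = cube \<eta> \<circ> f \<circ> inv_into U \<psi>"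
  have W: "open W"
    unfolding W_def using oV by (intro open_Int oU open_vimage continuous_knot[OF f] open_Times)
  have "C_infinity_on (\<psi> ` W) h \<and> (\<forall>x\<in>\<psi> ` W. vector_derivative h (at x within \<psi> ` W) \<noteq> 0)"
    using f U V unfolding knots_def smooth_embedding_def Let_def W_def h_def by blast
  then obtain E where E: "E 0 = h" "\<And>k x. x \<in> \<psi> ` W \<Longrightarrow> (E k has_vector_derivative E (Suc k) x) (at x within \<psi> ` W)"
    and nz: "\<And>x. x \<in> \<psi> ` W \<Longrightarrow> vector_derivative h (at x within \<psi> ` W) \<noteq> 0"
    by (auto simp: C_infinity_on_def)
  have WU: "W \<subseteq> U" by (simp add: W_def)
  show thesis
  proof (rule that[OF W _ WU])
    show "s \<in> W" using U V by (auto simp: W_def mem_cube_iff)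
    show "coord i (f y) \<in> V" if "y \<in> W" for y i using that by (auto simp: W_def mem_cube_iff)
    \<comment> \<open>Continuity of the first derivative comes from its own differentiability, the
      case \<open>k = 1\<close>.\<close>
    have "continuous_on (\<psi> ` W) (E 1)"
      using E(2)[of _ 1] by (auto simp: continuous_on_eq_continuous_within intro: has_vector_derivative_continuous)
    then show "continuous_on (\<psi> ` W) (\<lambda>r. coord i (E 1 r))" for i
      using continuous_on_compose[OF _ continuous_coord] by (simp add: o_def)
    fix y assume y: "y \<in> W"
    have d: "(h has_vector_derivative E 1 (\<psi> y)) (at (\<psi> y) within \<psi> ` W)"
      using E(2)[of "\<psi> y" 0] E(1) y by simp
    from bounded_linear.has_vector_derivative[OF bounded_linear_coord this]
    show "((\<lambda>r. \<eta> (coord i (f (inv_into U \<psi> r)))) has_vector_derivative coord i (E 1 (\<psi> y))) (at (\<psi> y) within \<psi> ` W)" for i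
      by (simp add: h_def)
    have "vector_derivative h (at (\<psi> y) within \<psi> ` W) = E 1 (\<psi> y)"
      by (rule vector_derivative_within[OF chart_image_no_isolated_point[OF chU W WU y] d])
    then show "E 1 (\<psi> y) \<noteq> 0" using nz y by force
  qed
qed

text \<open>The comparison is between values of \<open>\<psi>\<close>, since a chart may reverse the
  order of the ray. The mean value theorem needs a segment inside the image of \<open>W\<close>, and
  the connected image of an interval around \<open>s\<close> provides one.\<close>

lemma chart_positive_derivative_increasing:
  fixes h d :: "real \<Rightarrow> real"
  assumes ch: "is_chart (U, \<psi>)" and W: "open W" "W \<subseteq> U" "s \<in> W"
    and c: "continuous_on (\<psi> ` W) d" and pos: "0 < d (\<psi> s)"
    and h: "\<And>y. y \<in> W \<Longrightarrow> (h has_vector_derivative d (\<psi> y)) (at (\<psi> y) within \<psi> ` W)"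
  obtains M where "open M" "s \<in> M" "M \<subseteq> W" "\<And>y z. y \<in> M \<Longrightarrow> z \<in> M \<Longrightarrow> \<psi> y < \<psi> z \<Longrightarrow> h (\<psi> y) < h (\<psi> z)"
proof -
  have hom: "homeomorphism U (\<psi> ` U) \<psi> (inv_into U \<psi>)" using ch by (simp add: is_chart_iff)
  have c\<psi>: "continuous_on W \<psi>" using hom W(2) by (auto simp: homeomorphism_def intro: continuous_on_subset)
  have "continuous_on W (d \<circ> \<psi>)" by (rule continuous_on_compose[OF c\<psi> c])
  then have "open (W \<inter> (d \<circ> \<psi>) -` {0<..})" by (rule continuous_open_preimage[OF _ W(1)]) simp
  moreover have "s \<in> W \<inter> (d \<circ> \<psi>) -` {0<..}" using pos W by simp
  ultimately obtain a b M where M: "open M" "s \<in> M" "M \<subseteq> {a..<b}" and ab: "{a..b} \<subseteq> W \<inter> (d \<circ> \<psi>) -` {0<..}"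
    by (rule ray_neighbourhood)
  have "{a..<b} \<subseteq> {a..b}" by auto
  then have MW: "M \<subseteq> {a..b}" using M(3) by blast
  show thesis
  proof (rule that[OF M(1,2)])
    show "M \<subseteq> W" using MW ab by blast
    fix y z assume yz: "y \<in> M" "z \<in> M" "\<psi> y < \<psi> z"
    have "connected (\<psi> ` {a..b})"
      by (rule connected_continuous_image[OF continuous_on_subset[OF c\<psi>]]) (use ab in auto)
    then have sub: "{\<psi> y..\<psi> z} \<subseteq> \<psi> ` {a..b}"
      by (rule connected_contains_Icc) (use yz MW in auto)
    then have subW: "{\<psi> y..\<psi> z} \<subseteq> \<psi> ` W" using ab by blast
    have der: "(h has_derivative (\<lambda>r. r * d x)) (at x within {\<psi> y..\<psi> z})" if "\<psi> y \<le> x" "x \<le> \<psi> z" for x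
    proof -
      have "x \<in> \<psi> ` W" using subW that by auto
      then have "(h has_vector_derivative d x) (at x within \<psi> ` W)" using h by auto
      then have "(h has_vector_derivative d x) (at x within {\<psi> y..\<psi> z})"
        using subW by (rule has_vector_derivative_within_subset)
      then show ?thesis by (simp add: has_vector_derivative_def)
    qed
    obtain x where x: "x \<in> {\<psi> y<..<\<psi> z}" "h (\<psi> z) - h (\<psi> y) = (\<psi> z - \<psi> y) * d x"
      using mvt_simple[OF yz(3) der] by blast
    have "x \<in> \<psi> ` {a..b}" using sub x(1) by auto
    then have "0 < d x" using ab by auto
    then have "0 < (\<psi> z - \<psi> y) * d x" using yz(3) by simp
    then show "h (\<psi> y) < h (\<psi> z)" using x(2) by simp
  qed
qed

lemma knot_locally_coord_inj:
  assumes f: "f \<in> knots \<A>" and A: "maximal_atlas \<A>"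
  shows "\<exists>i N. open N \<and> s \<in> N \<and> inj_on (coord i \<circ> f) N"
proof -
  obtain U \<psi> where U: "(U, \<psi>) \<in> \<A>" "{s} \<subseteq> U" by (rule maximal_atlas_chart_finite[OF A, of "{s}"]) auto
  obtain V \<eta> where V: "(V, \<eta>) \<in> \<A>" "{coord 0 (f s), coord 1 (f s), coord 2 (f s)} \<subseteq> V"
    by (rule maximal_atlas_chart_finite[OF A, of "{coord 0 (f s), coord 1 (f s), coord 2 (f s)}"]) auto
  have Vi: "coord i (f s) \<in> V" for i using V(2) by (auto simp: coord_def)
  have ch: "is_chart (U, \<psi>)" using A U by (auto simp: maximal_atlas_def is_atlas_def)
  have hom: "homeomorphism U (\<psi> ` U) \<psi> (inv_into U \<psi>)" using ch by (simp add: is_chart_iff)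
  have inj: "inj_on \<psi> U" using hom by (auto simp: homeomorphism_def intro: inj_on_inverseI)
  have sU: "s \<in> U" using U by simp
  obtain W D where W: "open W" "s \<in> W" "W \<subseteq> U" "\<And>y i. y \<in> W \<Longrightarrow> coord i (f y) \<in> V"
    and c: "\<And>i. continuous_on (\<psi> ` W) (\<lambda>r. coord i (D r))"
    and d: "\<And>y i. y \<in> W \<Longrightarrow> ((\<lambda>r. \<eta> (coord i (f (inv_into U \<psi> r)))) has_vector_derivative coord i (D (\<psi> y))) (at (\<psi> y) within \<psi> ` W)"
    and nz: "\<And>y. y \<in> W \<Longrightarrow> D (\<psi> y) \<noteq> 0"
    by (rule knot_chart_derivative[OF f A U(1) sU V(1) Vi], rule that)
  have "\<exists>i. coord i (D (\<psi> s)) \<noteq> 0"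
  proof (rule ccontr)
    assume "\<nexists>i. coord i (D (\<psi> s)) \<noteq> 0"
    then have "coord i (D (\<psi> s)) = coord i 0" for i by (auto simp: coord_def)
    then have "D (\<psi> s) = 0" by (intro coord_eqI)
    then show False using nz W(2) by blast
  qed
  then obtain i where i: "coord i (D (\<psi> s)) \<noteq> 0" by blast
  let ?h = "\<lambda>r. \<eta> (coord i (f (inv_into U \<psi> r)))"
  obtain M where M: "open M" "s \<in> M" "M \<subseteq> W"
    "\<And>y z. y \<in> M \<Longrightarrow> z \<in> M \<Longrightarrow> \<psi> y < \<psi> z \<Longrightarrow> ?h (\<psi> y) \<noteq> ?h (\<psi> z)"
  proof (cases "0 < coord i (D (\<psi> s))")
    case True
    obtain M where "open M" "s \<in> M" "M \<subseteq> W"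
      "\<And>y z. y \<in> M \<Longrightarrow> z \<in> M \<Longrightarrow> \<psi> y < \<psi> z \<Longrightarrow> ?h (\<psi> y) < ?h (\<psi> z)"
      by (rule chart_positive_derivative_increasing[OF ch W(1,3,2) c[of i] True d], assumption, rule that)
    then show thesis using that by (metis less_irrefl)
  next
    case False
    then have pos: "0 < - coord i (D (\<psi> s))" using i by simp
    have c': "continuous_on (\<psi> ` W) (\<lambda>r. - coord i (D r))" by (intro continuous_intros c)
    have d': "((\<lambda>r. - ?h r) has_vector_derivative - coord i (D (\<psi> y))) (at (\<psi> y) within \<psi> ` W)" if "y \<in> W" for y
      using d[OF that] by (rule has_vector_derivative_minus)
    obtain M where "open M" "s \<in> M" "M \<subseteq> W"
      "\<And>y z. y \<in> M \<Longrightarrow> z \<in> M \<Longrightarrow> \<psi> y < \<psi> z \<Longrightarrow> - ?h (\<psi> y) < - ?h (\<psi> z)"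
      by (rule chart_positive_derivative_increasing[OF ch W(1,3,2) c' pos d'], assumption, rule that)
    then show thesis using that by (metis less_irrefl)
  qed
  have "inj_on (coord i \<circ> f) M"
  proof (rule inj_onI)
    fix y z assume yz: "y \<in> M" "z \<in> M" "(coord i \<circ> f) y = (coord i \<circ> f) z"
    have "inv_into U \<psi> (\<psi> w) = w" if "w \<in> M" for w
      using that M(3) W(3) inj by (intro inv_into_f_f) auto
    then have "?h (\<psi> y) = ?h (\<psi> z)" using yz by simp
    then have "\<not> \<psi> y < \<psi> z" "\<not> \<psi> z < \<psi> y" using M(4)[of y z] M(4)[of z y] yz(1,2) by auto
    then have "\<psi> y = \<psi> z" by simp
    then show "y = z" using inj yz(1,2) M(3) W(3) by (auto dest: inj_onD)
  qed
  then show ?thesis using M(1,2) by blast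
qed

text \<open>In a chart used for both source and target, fixed points accumulating at \<open>z\<close> force the
  derivative of the coordinate at \<open>z\<close> to be one.\<close>

lemma knot_coord_increasing_at_limit_of_fixed_points:
  assumes f: "f \<in> knots \<A>" and A: "maximal_atlas \<A>"
    and x: "x \<longlonglongrightarrow> z" "\<And>k. x k < z" "\<And>k. coord i (f (x k)) = x k"
  shows "\<exists>N. open N \<and> z \<in> N \<and> strict_mono_on N (coord i \<circ> f)"
proof -
  have cf: "continuous_on UNIV (coord i \<circ> f)" by (rule continuous_knot_coord[OF f])
  have fz: "coord i (f z) = z"
  proof (rule LIMSEQ_unique[OF _ x(1)])
    have "(\<lambda>k. (coord i \<circ> f) (x k)) \<longlonglongrightarrow> (coord i \<circ> f) z"
      using cf x(1) by (auto simp: continuous_on_eq_continuous_at intro: isCont_tendsto_compose)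
    then show "x \<longlonglongrightarrow> coord i (f z)" using x(3) by simp
  qed
  obtain V \<eta> where V: "(V, \<eta>) \<in> \<A>" "{z, coord 0 (f z), coord 1 (f z), coord 2 (f z)} \<subseteq> V"
    by (rule maximal_atlas_chart_finite[OF A, of "{z, coord 0 (f z), coord 1 (f z), coord 2 (f z)}"]) auto
  have zV: "z \<in> V" and Vi: "coord j (f z) \<in> V" for j using V(2) by (auto simp: coord_def)
  have ch: "is_chart (V, \<eta>)" using A V by (auto simp: maximal_atlas_def is_atlas_def)
  have hom: "homeomorphism V (\<eta> ` V) \<eta> (inv_into V \<eta>)" and oV: "open V" using ch by (auto simp: is_chart_iff)
  have inj: "inj_on \<eta> V" using hom by (auto simp: homeomorphism_def intro: inj_on_inverseI)
  have c\<eta>: "continuous_on V \<eta>" using hom by (simp add: homeomorphism_def)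
  obtain W D where W: "open W" "z \<in> W" "W \<subseteq> V" "\<And>y i. y \<in> W \<Longrightarrow> coord i (f y) \<in> V"
    and c: "\<And>i. continuous_on (\<eta> ` W) (\<lambda>r. coord i (D r))"
    and d: "\<And>y i. y \<in> W \<Longrightarrow> ((\<lambda>r. \<eta> (coord i (f (inv_into V \<eta> r)))) has_vector_derivative coord i (D (\<eta> y))) (at (\<eta> y) within \<eta> ` W)"
    and "\<And>y. y \<in> W \<Longrightarrow> D (\<eta> y) \<noteq> 0"
    by (rule knot_chart_derivative[OF f A V(1) zV V(1) Vi], rule that)
  define h where "h r = \<eta> (coord i (f (inv_into V \<eta> r)))" for r
  have h\<eta>: "h (\<eta> y) = \<eta> (coord i (f y))" if "y \<in> V" for y using inj that by (simp add: h_def)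
  have dh: "(h has_vector_derivative coord i (D (\<eta> y))) (at (\<eta> y) within \<eta> ` W)" if "y \<in> W" for y
    using d[OF that, of i] by (simp add: h_def[abs_def])
  have evW: "\<forall>\<^sub>F k in sequentially. x k \<in> W" using x(1) W(1,2) by (rule topological_tendstoD)
  have "(\<lambda>k. \<eta> (x k)) \<longlonglongrightarrow> \<eta> z"
    by (rule continuous_on_tendsto_compose[OF c\<eta> x(1) zV]) (use evW W(3) in \<open>auto elim: eventually_mono\<close>)
  moreover have ne: "\<eta> (x k) \<noteq> \<eta> z" if "x k \<in> W" for k
    using inj that W(3) zV x(2)[of k] by (auto dest!: inj_onD)
  ultimately have "filterlim (\<lambda>k. \<eta> (x k)) (at (\<eta> z) within \<eta> ` W) sequentially"
    unfolding filterlim_at using evW by (auto elim!: eventually_mono)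
  moreover have "((\<lambda>r. (h r - h (\<eta> z)) / (r - \<eta> z)) \<longlongrightarrow> coord i (D (\<eta> z))) (at (\<eta> z) within \<eta> ` W)"
    using dh[OF W(2)] by (simp add: has_real_derivative_iff_has_vector_derivative[symmetric] has_field_derivative_iff)
  ultimately have "(\<lambda>k. (h (\<eta> (x k)) - h (\<eta> z)) / (\<eta> (x k) - \<eta> z)) \<longlonglongrightarrow> coord i (D (\<eta> z))"
    by (rule filterlim_compose[rotated])
  moreover have "\<forall>\<^sub>F k in sequentially. (h (\<eta> (x k)) - h (\<eta> z)) / (\<eta> (x k) - \<eta> z) = 1"
    using evW
  proof eventually_elim
    case (elim k)
    then have "x k \<in> V" using W(3) by blast
    then show ?case using ne[OF elim] zV x(3) fz by (simp add: h\<eta>)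
  qed
  then have "(\<lambda>k. (h (\<eta> (x k)) - h (\<eta> z)) / (\<eta> (x k) - \<eta> z)) \<longlonglongrightarrow> 1" by (rule tendsto_eventually)
  ultimately have "coord i (D (\<eta> z)) = 1" by (rule LIMSEQ_unique)
  then have pos: "0 < coord i (D (\<eta> z))" by simp
  obtain M where M: "open M" "z \<in> M" "M \<subseteq> W"
    "\<And>y w. y \<in> M \<Longrightarrow> w \<in> M \<Longrightarrow> \<eta> y < \<eta> w \<Longrightarrow> h (\<eta> y) < h (\<eta> w)"
    by (rule chart_positive_derivative_increasing[OF ch W(1,3,2) c[of i] pos dh], assumption, rule that)
  obtain a b M' where M': "open M'" "z \<in> M'" "M' \<subseteq> {a..<b}" and ab: "{a..b} \<subseteq> V"
    using oV zV by (rule ray_neighbourhood)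
  have "{a..<b} \<subseteq> {a..b}" by auto
  then have M'ab: "M' \<subseteq> {a..b}" using M'(3) by blast
  \<comment> \<open>Both a point and its coordinate value must lie in \<open>{a..b}\<close>, where
    \<open>\<eta>\<close> is monotone; this is possible near \<open>z\<close> because
    \<open>z\<close> is a fixed point of the coordinate.\<close>
  define N where "N = M \<inter> M' \<inter> (coord i \<circ> f) -` M'"
  have "open N" unfolding N_def by (intro open_Int M(1) M'(1) open_vimage[OF M'(1) cf])
  moreover have "z \<in> N" using M M' fz by (simp add: N_def)
  moreover have "strict_mono_on N (coord i \<circ> f)"
    unfolding strict_mono_on_def
  proof (intro allI impI)
    fix y w assume yw: "y \<in> N \<and> w \<in> N \<and> y < w"
    then have I: "y \<in> {a..b}" "w \<in> {a..b}" "coord i (f y) \<in> {a..b}" "coord i (f w) \<in> {a..b}"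
      using M'ab by (auto simp: N_def)
    have MM: "y \<in> M" "w \<in> M" using yw by (auto simp: N_def)
    have hy: "h (\<eta> y) = \<eta> (coord i (f y))" "h (\<eta> w) = \<eta> (coord i (f w))" using I ab by (auto intro: h\<eta>)
    \<comment> \<open>The chart may reverse the order. Being used for both source and target, it
      then reverses twice, and the effects cancel.\<close>
    have "strict_mono_on {a..b} \<eta> \<or> strict_antimono_on {a..b} \<eta>"
      by (rule inj_on_Icc_monotone[OF continuous_on_subset[OF c\<eta> ab] inj_on_subset[OF inj ab]])
    then show "(coord i \<circ> f) y < (coord i \<circ> f) w"
    proof
      assume sm: "strict_mono_on {a..b} \<eta>"
      then have "\<eta> y < \<eta> w" using I yw by (auto simp: strict_mono_on_def)
      then have "\<eta> (coord i (f y)) < \<eta> (coord i (f w))" using M(4)[OF MM] hy by simp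
      then show ?thesis using strict_mono_on_less[OF sm I(3,4)] by simp
    next
      assume sa: "strict_antimono_on {a..b} \<eta>"
      then have "\<eta> w < \<eta> y" using I yw by (auto simp: monotone_on_def)
      then have less: "\<eta> (coord i (f w)) < \<eta> (coord i (f y))" using M(4)[OF MM(2,1)] hy by simp
      show ?thesis
      proof (rule ccontr)
        assume "\<not> ?thesis"
        then have "coord i (f w) = coord i (f y) \<or> coord i (f w) < coord i (f y)" by auto
        then have "\<eta> (coord i (f y)) \<le> \<eta> (coord i (f w))" using sa I by (auto simp: monotone_on_def intro: less_imp_le)
        then show False using less by simp
      qed
    qed
  qed
  ultimately show ?thesis by blast
qed

lemma unbounded_id_long_ray: "unbounded (\<lambda>x::long_ray. x)"
  by (simp add: unbounded_def gt_ex)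

lemma knot_unbounded_coord_increasing:
  assumes f: "f \<in> knots \<A>" and A: "maximal_atlas \<A>" and unb: "unbounded (coord i \<circ> f)"
  shows "\<exists>\<beta>. strict_mono_on {\<beta>..} (coord i \<circ> f)"
proof -
  define good where "good y \<longleftrightarrow> (\<exists>N. open N \<and> y \<in> N \<and> strict_mono_on N (coord i \<circ> f))" for y
  have cf: "continuous_on UNIV (coord i \<circ> f)" by (rule continuous_knot_coord[OF f])
  have fixed: "\<exists>y>x. coord i (f y) = y" for x
    using unbounded_maps_coincide_above[OF cf unb continuous_on_id unbounded_id_long_ray, of x] by auto
  have "\<exists>\<beta>. \<forall>y>\<beta>. good y"
  proof (rule ccontr)
    assume "\<nexists>\<beta>. \<forall>y>\<beta>. good y"
    then have bad: "\<exists>y>x. \<not> good y" for x by blast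
    let ?o = "Abs_ray (LEAST a. True, 0) :: long_ray"
    \<comment> \<open>Requirement 0 asks for a fixed point, all others for a point that is not good.
      Interleaving makes both kinds accumulate at one and the same \<open>z\<close>.\<close>
    let ?Q = "\<lambda>(n::nat) (x::long_ray) y. if n = 0 then coord i (f y) = y else \<not> good y"
    have ex: "\<exists>y>x. ?Q n x y" for n x by (cases "n = 0") (use fixed bad in auto)
    obtain z where "?o < z"
      and z: "\<And>n. \<exists>u v. u \<longlonglongrightarrow> z \<and> v \<longlonglongrightarrow> z \<and> (\<forall>k. ?o \<le> u k \<and> u k < v k \<and> v k < z \<and> ?Q n (u k) (v k))"
      by (rule interleave[of ?Q ?o]) (rule ex, blast)
    from z[of 0] obtain v where v: "v \<longlonglongrightarrow> z" "\<And>k. v k < z" "\<And>k. coord i (f (v k)) = v k" by auto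
    from z[of 1] obtain w where w: "w \<longlonglongrightarrow> z" "\<And>k. \<not> good (w k)" by auto
    obtain N where N: "open N" "z \<in> N" "strict_mono_on N (coord i \<circ> f)"
      using knot_coord_increasing_at_limit_of_fixed_points[OF f A v] by blast
    have "\<forall>\<^sub>F k in sequentially. w k \<in> N" using w(1) N(1,2) by (rule topological_tendstoD)
    then obtain k where "w k \<in> N" by (auto simp: eventually_sequentially)
    then have "good (w k)" using N unfolding good_def by blast
    then show False using w(2) by blast
  qed
  then obtain \<beta> where \<beta>: "\<And>y. \<beta> < y \<Longrightarrow> good y" by blast
  have "strict_mono_on {\<beta><..} (coord i \<circ> f)"
    by (rule locally_strict_mono_imp_strict_mono[OF cf]) (use \<beta> in \<open>simp add: good_def\<close>)
  moreover obtain \<gamma> where "\<beta> < \<gamma>" using gt_ex by blast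
  then have "{\<gamma>..} \<subseteq> {\<beta><..}" by auto
  ultimately show ?thesis by (meson monotone_on_subset)
qed

lemma unbounded_incl_iff: "unbounded (\<lambda>x. incl (u x)) \<longleftrightarrow> unbounded u"
proof
  show "unbounded (\<lambda>x. incl (u x)) \<Longrightarrow> unbounded u" unfolding unbounded_def by (metis incl_less_iff)
  assume u: "unbounded u"
  show "unbounded (\<lambda>x. incl (u x))" unfolding unbounded_def
  proof
    fix b
    obtain y where "b < incl y" using unbounded_incl by (auto simp: unbounded_def)
    moreover obtain x where "y < u x" using u by (auto simp: unbounded_def)
    ultimately show "\<exists>x. b < incl (u x)" by (meson incl_less_iff less_trans)
  qed
qed

text \<open>The coordinate may take the value \<open>origin\<close>, which has nothing below it.
  After inclusion into the collared ray all values lie strictly above \<open>collar_point\<close>,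
  as \<open>bounded_eventually_constant\<close> demands.\<close>

lemma knot_bounded_coord_constant:
  assumes f: "f \<in> knots \<A>" and "\<not> unbounded (coord i \<circ> f)"
  shows "\<exists>\<beta>. \<forall>y\<ge>\<beta>. coord i (f y) = coord i (f \<beta>)"
proof -
  have "continuous_on UNIV (\<lambda>x. incl ((coord i \<circ> f) x))"
    by (rule continuous_on_compose2[OF continuous_incl continuous_knot_coord[OF f]]) auto
  then obtain \<beta> where "\<forall>y\<ge>\<beta>. incl ((coord i \<circ> f) y) = incl ((coord i \<circ> f) \<beta>)"
    using bounded_eventually_constant[OF _ collar_point_less_incl] assms(2) unbounded_incl_iff by blast
  then show ?thesis by auto
qed

lemma knot_tail:
  assumes f: "f \<in> knots \<A>" and A: "maximal_atlas \<A>"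
  obtains \<beta> where "\<And>s i. \<beta> \<le> s \<Longrightarrow> unbounded (coord i \<circ> f) \<Longrightarrow> strict_mono_on {s..} (coord i \<circ> f)"
    "\<And>s i y. \<beta> \<le> s \<Longrightarrow> \<not> unbounded (coord i \<circ> f) \<Longrightarrow> s \<le> y \<Longrightarrow> coord i (f y) = coord i (f s)"
proof -
  have "\<exists>\<beta>. \<forall>s\<ge>\<beta>. (unbounded (coord i \<circ> f) \<longrightarrow> strict_mono_on {s..} (coord i \<circ> f)) \<and>
     (\<not> unbounded (coord i \<circ> f) \<longrightarrow> (\<forall>y\<ge>s. coord i (f y) = coord i (f s)))" for i
  proof (cases "unbounded (coord i \<circ> f)")
    case True
    obtain \<beta> where "strict_mono_on {\<beta>..} (coord i \<circ> f)" using knot_unbounded_coord_increasing[OF f A True] ..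
    then show ?thesis using True by (intro exI[of _ \<beta>]) (auto intro: monotone_on_subset)
  next
    case False
    obtain \<beta> where "\<forall>y\<ge>\<beta>. coord i (f y) = coord i (f \<beta>)" using knot_bounded_coord_constant[OF f False] ..
    then have "\<forall>s\<ge>\<beta>. \<forall>y\<ge>s. coord i (f y) = coord i (f s)" by (metis order_trans)
    then show ?thesis using False by blast
  qed
  then obtain B where B: "\<And>i s. B i \<le> s \<Longrightarrow> (unbounded (coord i \<circ> f) \<longrightarrow> strict_mono_on {s..} (coord i \<circ> f)) \<and>
     (\<not> unbounded (coord i \<circ> f) \<longrightarrow> (\<forall>y\<ge>s. coord i (f y) = coord i (f s)))" by metis
  obtain \<beta> where "\<And>x. x \<in> range B \<Longrightarrow> x < \<beta>" by (rule countable_bounded_ray[of "range B"]) auto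
  then have \<beta>: "B i \<le> \<beta>" for i by (auto intro: less_imp_le)
  show thesis
    by (rule that[of \<beta>]) (use B \<beta> in \<open>meson order_trans\<close>)+
qed

section \<open>Classification\<close>

text \<open>Indices above 2 repeat the third coordinate and are cut off.\<close>

definition unbounded_coords :: "(long_ray \<Rightarrow> long_ray \<times> long_ray \<times> long_ray) \<Rightarrow> nat set" where
  "unbounded_coords f = {i\<in>{0, 1, 2}. unbounded (coord i \<circ> f)}"

lemma unbounded_coords_nonempty:
  assumes f: "f \<in> knots \<A>" and A: "maximal_atlas \<A>"
  shows "unbounded_coords f \<noteq> {}"
proof
  assume e: "unbounded_coords f = {}"
  obtain \<beta> where \<beta>: "\<And>s i y. \<beta> \<le> s \<Longrightarrow> \<not> unbounded (coord i \<circ> f) \<Longrightarrow> s \<le> y \<Longrightarrow> coord i (f y) = coord i (f s)"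
    using knot_tail[OF f A] by metis
  obtain y where y: "\<beta> < y" using gt_ex by blast
  have "coord i (f y) = coord i (f \<beta>)" if "i \<in> {0, 1, 2}" for i
    using \<beta>[of \<beta> i y] y e that by (auto simp: unbounded_coords_def)
  from this[of 0] this[of 1] this[of 2] have "f y = f \<beta>" by (intro coord_eqI) auto
  moreover obtain f' where "homeomorphism UNIV (range f) f f'" using f by (rule knotD)
  ultimately have "y = \<beta>" by (metis UNIV_I homeomorphism_apply1)
  then show False using y by simp
qed

lemma knot_equiv_if_unbounded_coords_eq:
  assumes A: "maximal_atlas \<A>" and f: "f \<in> knots \<A>" and g: "g \<in> knots \<A>"
    and eq: "unbounded_coords f = unbounded_coords g"
  shows "(f, g) \<in> knot_equiv \<A>"
proof -
  let ?o = "Abs_ray (LEAST a. True, 0) :: long_ray"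
  have o: "{?o..} = UNIV" using ray_least by auto
  have slide: "\<exists>\<phi> k. isotopy \<phi> \<and> \<phi> 0 = id \<and> strict_mono_on UNIV k \<and> range k = {s..} \<and>
      (\<forall>z. \<phi> 1 (cube incl (f z)) = cube incl (f (k z)))" if f: "f \<in> knots \<A>" for f s
  proof -
    obtain f' where f': "homeomorphism UNIV (range f) f f'" using f by (rule knotD)
    have "homeomorphism (range f) (range (cube incl \<circ> f)) (cube incl) (cube (inv incl))"
      by (rule homeomorphism_of_subsets[OF homeomorphism_cube_incl]) (auto simp: image_comp)
    then have "homeomorphism UNIV (range (cube incl \<circ> f)) (cube incl \<circ> f) (f' \<circ> cube (inv incl))"
      by (rule homeomorphism_compose[OF f'])
    then have "slides (cube incl \<circ> f) ?o s"
    proof (rule slides_all)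
      fix s
      obtain i N where N: "open N" "s \<in> N" "inj_on (coord i \<circ> f) N"
        using knot_locally_coord_inj[OF f A] by blast
      then have "inj_on (coord i \<circ> (cube incl \<circ> f)) N" by (simp add: inj_on_def)
      then show "\<exists>i N. open N \<and> s \<in> N \<and> inj_on (coord i \<circ> (cube incl \<circ> f)) N" using N by blast
      show "collar_point < coord i ((cube incl \<circ> f) s)" for i by (simp add: collar_point_less_incl)
    qed
    then show ?thesis using ray_least unfolding slides_def o comp_apply by blast
  qed
  obtain \<beta> where \<beta>: "\<And>s i. \<beta> \<le> s \<Longrightarrow> unbounded (coord i \<circ> f) \<Longrightarrow> strict_mono_on {s..} (coord i \<circ> f)"
    "\<And>s i y. \<beta> \<le> s \<Longrightarrow> \<not> unbounded (coord i \<circ> f) \<Longrightarrow> s \<le> y \<Longrightarrow> coord i (f y) = coord i (f s)"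
    by (rule knot_tail[OF f A], rule that)
  obtain \<gamma> where \<gamma>: "\<And>s i. \<gamma> \<le> s \<Longrightarrow> unbounded (coord i \<circ> g) \<Longrightarrow> strict_mono_on {s..} (coord i \<circ> g)"
    "\<And>s i y. \<gamma> \<le> s \<Longrightarrow> \<not> unbounded (coord i \<circ> g) \<Longrightarrow> s \<le> y \<Longrightarrow> coord i (g y) = coord i (g s)"
    by (rule knot_tail[OF g A], rule that)
  define s where "s = max \<beta> \<gamma>"
  have s: "\<beta> \<le> s" "\<gamma> \<le> s" by (auto simp: s_def)
  obtain \<phi> k where \<phi>: "isotopy \<phi>" "\<phi> 0 = id" "strict_mono_on UNIV k" "range k = {s..}"
    "\<And>z. \<phi> 1 (cube incl (f z)) = cube incl (f (k z))"
    using slide[OF f, of s] by blast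
  obtain \<theta> l where \<theta>: "isotopy \<theta>" "\<theta> 0 = id" "strict_mono_on UNIV l" "range l = {s..}"
    "\<And>z. \<theta> 1 (cube incl (g z)) = cube incl (g (l z))"
    using slide[OF g, of s] by blast
  obtain \<theta>' where \<theta>': "isotopy \<theta>'" "\<theta>' 0 = id" "\<And>y. \<theta>' 1 (\<theta> 1 y) = y"
    by (rule isotopy_inverse[OF \<theta>(1,2)]) blast
  \<comment> \<open>By unboundedness and the intermediate value theorem an increasing coordinate
    takes every value above its first one. Its image is a full final segment, so a correspondence
    between two such tails extends to an order automorphism.\<close>
  have tail: "strict_mono (\<lambda>z. coord i (f (k z))) \<and> range (\<lambda>z. coord i (f (k z))) = {coord i (f s)..}"
    if f: "f \<in> knots \<A>" and u: "unbounded (coord i \<circ> f)" and m: "strict_mono_on {s..} (coord i \<circ> f)"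
      and k: "strict_mono_on UNIV k" "range k = {s..}" for i f k
  proof
    have ks: "s \<le> k z" for z using k(2) by auto
    show "strict_mono (\<lambda>z. coord i (f (k z)))"
      using m k(1) ks by (auto simp: strict_mono_on_def strict_mono_def)
    have cf: "continuous_on UNIV (coord i \<circ> f)" by (rule continuous_knot_coord[OF f])
    have "(coord i \<circ> f) ` {s..} = {coord i (f s)..}"
    proof (intro equalityI subsetI)
      fix r assume "r \<in> (coord i \<circ> f) ` {s..}"
      then obtain y where "r = coord i (f y)" "s \<le> y" by auto
      then show "r \<in> {coord i (f s)..}" using strict_mono_on_leD[OF m, of s y] by simp
    next
      fix r assume r: "r \<in> {coord i (f s)..}"
      obtain b where b: "s < b" "r < (coord i \<circ> f) b" using unbounded_above[OF cf u] by blast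
      obtain y where "s \<le> y" "(coord i \<circ> f) y = r"
        using IVT'[of "coord i \<circ> f" s r b] r b continuous_on_subset[OF cf subset_UNIV] by (auto simp: less_imp_le)
      then show "r \<in> (coord i \<circ> f) ` {s..}" by auto
    qed
    then show "range (\<lambda>z. coord i (f (k z))) = {coord i (f s)..}"
      using k(2) by (metis (no_types, lifting) comp_apply image_cong image_image)
  qed
  have mem: "i \<in> unbounded_coords h \<longleftrightarrow> unbounded (coord i \<circ> h)" if "i \<in> {0, 1, 2}" for i h
    using that by (simp add: unbounded_coords_def)
  have H: "\<exists>H. strict_mono H \<and> surj H \<and> (\<forall>z. H (incl (coord i (f (k z)))) = incl (coord i (g (l z))))"
    if i: "i \<in> {0, 1, 2}" for i
  proof (cases "unbounded (coord i \<circ> f)")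
    case True
    have True': "unbounded (coord i \<circ> g)" using True eq mem[OF i] by blast
    define a where "a z = coord i (f (k z))" for z
    define b where "b z = coord i (g (l z))" for z
    have a: "strict_mono a" "range a = {coord i (f s)..}"
      using tail[OF f True \<beta>(1)[OF s(1) True] \<phi>(3,4)] by (auto simp: a_def[abs_def])
    have b: "strict_mono b" "range b = {coord i (g s)..}"
      using tail[OF g True' \<gamma>(1)[OF s(2) True'] \<theta>(3,4)] by (auto simp: b_def[abs_def])
    have img: "(\<lambda>z. incl (u z)) ` UNIV = {incl v..}" if u: "range u = {v..}" for u :: "long_ray \<Rightarrow> long_ray" and v
    proof (intro equalityI subsetI)
      fix y assume "y \<in> range (\<lambda>z. incl (u z))"
      then obtain z where z: "y = incl (u z)" by blast
      have "u z \<in> {v..}" using u by blast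
      then show "y \<in> {incl v..}" using z by simp
    next
      fix y assume y: "y \<in> {incl v..}"
      then obtain x where x: "y = incl x" using range_incl_upward by blast
      then have "x \<in> range u" using y u by simp
      then show "y \<in> range (\<lambda>z. incl (u z))" using x by auto
    qed
    \<comment> \<open>\<open>T\<close> matches values with equal parameter \<open>z\<close>. Since
      \<open>z\<close> is common to the three coordinates, the product map will carry the point
      \<open>f (k z)\<close> to the point \<open>g (l z)\<close>.\<close>
    define T where "T y = incl (b (inv a (inv incl y)))" for y
    have inja: "inj a" using a(1) by (rule strict_mono_imp_inj_on)
    have T: "T (incl (a z)) = incl (b z)" for z using inja by (simp add: T_def)
    have ia: "{incl (coord i (f s))..} = range (\<lambda>z. incl (a z))" using img[OF a(2)] by simp
    have ib: "{incl (coord i (g s))..} = range (\<lambda>z. incl (b z))" using img[OF b(2)] by simp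
    have Tm: "strict_mono_on {incl (coord i (f s))..} T"
      unfolding ia strict_mono_on_def using a(1) b(1) T by (auto simp: strict_mono_less)
    have Ti: "T ` {incl (coord i (f s))..} = {incl (coord i (g s))..}"
      unfolding ia ib using T by (auto simp: image_image)
    obtain H where "strict_mono H" "surj H" "\<And>y. incl (coord i (f s)) \<le> y \<Longrightarrow> H y = T y"
      by (rule order_automorphism_extend[OF collar_point_less_incl collar_point_less_incl Tm Ti], rule that)
    moreover have "incl (coord i (f s)) \<le> incl (a z)" for z
    proof -
      have "a z \<in> {coord i (f s)..}" using a(2) by blast
      then show ?thesis by simp
    qed
    ultimately show ?thesis using T unfolding a_def b_def by metis
  next
    case False
    have False': "\<not> unbounded (coord i \<circ> g)" using False eq mem[OF i] by blast
    obtain H where "strict_mono H" "surj H" "H (incl (coord i (f s))) = incl (coord i (g s))"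
      by (rule order_automorphism_move_point[OF collar_point_less_incl collar_point_less_incl], rule that)
    moreover have "coord i (f (k z)) = coord i (f s)" for z
    proof -
      have "k z \<in> {s..}" using \<phi>(4) by blast
      then show ?thesis using \<beta>(2)[OF s(1) False, of "k z"] by simp
    qed
    moreover have "coord i (g (l z)) = coord i (g s)" for z
    proof -
      have "l z \<in> {s..}" using \<theta>(4) by blast
      then show ?thesis using \<gamma>(2)[OF s(2) False', of "l z"] by simp
    qed
    ultimately show ?thesis by auto
  qed
  have "\<exists>L. isotopy L \<and> L 0 = id \<and> (\<forall>z. L 1 (incl (coord i (f (k z)))) = incl (coord i (g (l z))))"
    if i: "i \<in> {0, 1, 2}" for i
  proof -
    obtain H where H': "strict_mono H" "surj H" "\<And>z. H (incl (coord i (f (k z)))) = incl (coord i (g (l z)))"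
      using H[OF i] by blast
    obtain L where "isotopy L" "L 0 = id" "L 1 = H" using order_automorphism_isotopy[OF H'(1,2)] .
    then show ?thesis using H'(3) by auto
  qed
  then obtain L where L: "\<And>i. i \<in> {0, 1, 2} \<Longrightarrow> isotopy (L i) \<and> L i 0 = id \<and>
      (\<forall>z. L i 1 (incl (coord i (f (k z)))) = incl (coord i (g (l z))))" by metis
  define \<Lambda> where "\<Lambda> t = map_prod (L 0 t) (map_prod (L 1 t) (L 2 t))" for t
  have "isotopy \<Lambda>"
    unfolding \<Lambda>_def by (intro isotopy_map_prod) (use L in auto)
  \<comment> \<open>Pull \<open>f\<close> into its tail, match the tails coordinate by coordinate,
    and undo the pulling of \<open>g\<close>.\<close>
  define \<Xi> where "\<Xi> t = \<theta>' t \<circ> (\<Lambda> t \<circ> \<phi> t)" for t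
  have "isotopy \<Xi>" unfolding \<Xi>_def by (intro isotopy_compose \<phi>(1) \<theta>'(1) \<open>isotopy \<Lambda>\<close>)
  moreover have "\<Xi> 0 = id" using L \<phi>(2) \<theta>'(2) by (simp add: \<Xi>_def \<Lambda>_def prod.map_id0)
  moreover have "\<Xi> 1 \<circ> (cube incl \<circ> f) = cube incl \<circ> g"
  proof
    fix z
    have "\<Lambda> 1 (cube incl (f (k z))) = cube incl (g (l z))"
      using L[of 0] L[of 1] L[of 2] by (intro coord_eqI) (simp_all add: \<Lambda>_def cube_eq_map_prod)
    then show "(\<Xi> 1 \<circ> (cube incl \<circ> f)) z = (cube incl \<circ> g) z"
      using \<phi>(5)[of z] \<theta>(5)[of z] \<theta>'(3)[of "cube incl (g z)"] by (simp add: \<Xi>_def)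
  qed
  ultimately show ?thesis unfolding knot_equiv_def using f g by blast
qed

section \<open>Invariance of the set of unbounded coordinates\<close>

lemma isotopy_preserves_unbounded:
  fixes \<gamma> :: "real \<Rightarrow> long_ray \<Rightarrow> long_ray'"
  assumes c: "continuous_on (UNIV \<times> {0..1}) (\<lambda>(x, t). \<gamma> t x)" and u: "unbounded (\<gamma> 0)"
  shows "unbounded (\<gamma> 1)"
proof (rule ccontr)
  assume nu: "\<not> unbounded (\<gamma> 1)"
  have cx: "continuous_on UNIV (\<gamma> t)" if "t \<in> {0..1}" for t
  proof -
    have "continuous_on UNIV (\<lambda>x::long_ray. (x, t))" by (intro continuous_intros)
    moreover have "range (\<lambda>x::long_ray. (x, t)) \<subseteq> UNIV \<times> {0..1}" using that by auto
    ultimately show ?thesis using continuous_on_compose2[OF c, of UNIV "\<lambda>x. (x, t)"] by simp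
  qed
  have ct: "continuous_on {0..1} (\<lambda>t. \<gamma> t x)" for x
  proof -
    have "continuous_on {0..1} (\<lambda>t::real. (x, t))" by (intro continuous_intros)
    moreover have "(\<lambda>t. (x, t)) ` {0..1} \<subseteq> UNIV \<times> {0..1::real}" by auto
    ultimately show ?thesis using continuous_on_compose2[OF c, of "{0..1}" "\<lambda>t. (x, t)"] by simp
  qed
  \<comment> \<open>A time with unbounded map asks for agreement with \<open>incl\<close>, any other
    time contributes a bound. Countably many such demands can be met by one \<open>z\<close>. Both
    end times are included, to control the two ends of the path.\<close>
  define R where "R = {0..1} \<inter> (\<rat> :: real set)"
  have R: "countable R" "0 \<in> R" "1 \<in> R" by (auto simp: R_def countable_rat)
  define r where "r = from_nat_into R"
  have rR: "range r = R" unfolding r_def using R by (intro range_from_nat_into) auto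
  then have r01: "r n \<in> {0..1}" for n by (auto simp: R_def)
  have "\<exists>b. \<not> unbounded (\<gamma> (r n)) \<longrightarrow> (\<forall>x. \<gamma> (r n) x \<le> b)" for n by (auto simp: unbounded_def not_less)
  then obtain B where B: "\<And>n x. \<not> unbounded (\<gamma> (r n)) \<Longrightarrow> \<gamma> (r n) x \<le> B n" by metis
  obtain b where "\<And>x. x \<in> range B \<Longrightarrow> x < b" by (rule countable_bounded_ray[of "range B"]) auto
  then have b: "\<gamma> (r n) x \<le> b" if "\<not> unbounded (\<gamma> (r n))" for n x
    using B[OF that, of x] by (meson less_imp_le order_trans rangeI)
  obtain x0 where x0: "b < incl x0" using unbounded_incl by (auto simp: unbounded_def)
  have ex: "\<exists>y>x. unbounded (\<gamma> (r n)) \<longrightarrow> \<gamma> (r n) y = incl y" for n x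
  proof (cases "unbounded (\<gamma> (r n))")
    case True
    then show ?thesis using unbounded_maps_coincide_above[OF cx[OF r01] True continuous_incl unbounded_incl] by blast
  next
    case False
    then show ?thesis using gt_ex by blast
  qed
  obtain z where "x0 < z" and z: "\<And>n. \<exists>u v. u \<longlonglongrightarrow> z \<and> v \<longlonglongrightarrow> z \<and>
      (\<forall>k. x0 \<le> u k \<and> u k < v k \<and> v k < z \<and> (unbounded (\<gamma> (r n)) \<longrightarrow> \<gamma> (r n) (v k) = incl (v k)))"
    by (rule interleave[of "\<lambda>n x y. unbounded (\<gamma> (r n)) \<longrightarrow> \<gamma> (r n) y = incl y" x0]) (rule ex, blast)
  have bz: "b < incl z" using x0 \<open>x0 < z\<close> by (meson incl_less_iff less_trans)
  have fixed: "\<gamma> (r n) z = incl z" if un: "unbounded (\<gamma> (r n))" for n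
  proof -
    obtain v where v: "v \<longlonglongrightarrow> z" "\<And>k. \<gamma> (r n) (v k) = incl (v k)" using z[of n] un by blast
    have "isCont (\<gamma> (r n)) z" "isCont incl z"
      using cx[OF r01] continuous_incl[of UNIV] by (auto simp: continuous_on_eq_continuous_at)
    then have "(\<lambda>k. \<gamma> (r n) (v k)) \<longlonglongrightarrow> \<gamma> (r n) z" "(\<lambda>k. incl (v k)) \<longlonglongrightarrow> incl z"
      using v(1) by (auto intro: isCont_tendsto_compose)
    then show ?thesis using v(2) LIMSEQ_unique by simp
  qed
  \<comment> \<open>The admissible values of the path: there is a nonempty gap between
    \<open>b\<close> and \<open>incl z\<close>, which the connected path would have to
    cross.\<close>
  define C where "C = {..b} \<union> {incl z}"
  have "closed C" by (simp add: C_def)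
  have CR: "\<gamma> t z \<in> C" if t: "t \<in> R" for t
  proof -
    obtain n where "t = r n" using t rR by auto
    then show ?thesis using b fixed by (cases "unbounded (\<gamma> t)") (auto simp: C_def)
  qed
  \<comment> \<open>As \<open>C\<close> is closed, leaving it at one time would mean leaving it on a
    relatively open set of times, which contains a rational one.\<close>
  have C01: "\<gamma> t z \<in> C" if t: "t \<in> {0..1}" for t
  proof (rule ccontr)
    assume "\<gamma> t z \<notin> C"
    moreover have "((\<lambda>t. \<gamma> t z) \<longlongrightarrow> \<gamma> t z) (at t within {0..1})" using ct t by (simp add: continuous_on_def)
    ultimately have "\<forall>\<^sub>F s in at t within {0..1}. \<gamma> s z \<in> - C"
      using \<open>closed C\<close> by (intro topological_tendstoD) auto
    then obtain e where e: "0 < e" "\<And>s. s \<in> {0..1} \<Longrightarrow> s \<noteq> t \<Longrightarrow> dist s t < e \<Longrightarrow> \<gamma> s z \<notin> C"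
      by (auto simp: eventually_at)
    have "max 0 (t - e) < min 1 (t + e)" using t e(1) by auto
    then obtain q where q: "q \<in> \<rat>" "max 0 (t - e) < q" "q < min 1 (t + e)" using Rats_dense_in_real by blast
    then have "dist q t < e" by (auto simp: dist_real_def abs_less_iff)
    then have "\<gamma> q z \<notin> C" using e(2)[of q] q \<open>\<gamma> t z \<notin> C\<close> by (cases "q = t") auto
    then show False using CR[of q] q by (auto simp: R_def)
  qed
  have "\<gamma> 0 z = incl z" "\<gamma> 1 z \<le> b"
  proof -
    obtain n m where "r n = 0" "r m = 1" using R(2,3) rR by (metis imageE)
    then show "\<gamma> 0 z = incl z" "\<gamma> 1 z \<le> b" using fixed[of n] b[of m z] u nu by auto
  qed
  obtain m where m: "b < m" "m < incl z" using dense bz by blast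
  have cn: "connected ((\<lambda>t. \<gamma> t z) ` {0..1})" by (rule connected_continuous_image[OF ct]) simp
  have "\<gamma> 1 z \<in> (\<lambda>t. \<gamma> t z) ` {0..1}" "\<gamma> 0 z \<in> (\<lambda>t. \<gamma> t z) ` {0..1}" by auto
  moreover have "\<gamma> 1 z \<le> m" "m \<le> \<gamma> 0 z" using m \<open>\<gamma> 0 z = incl z\<close> \<open>\<gamma> 1 z \<le> b\<close> by auto
  ultimately have "m \<in> (\<lambda>t. \<gamma> t z) ` {0..1}" using connectedD_interval[OF cn] by blast
  then obtain t where "t \<in> {0..1}" "\<gamma> t z = m" by auto
  then have "m \<in> C" using C01 by blast
  then show False using m by (auto simp: C_def)
qed

lemma knot_equiv_unbounded_coords_le:
  assumes "(f, g) \<in> knot_equiv \<A>"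
  shows "unbounded_coords f \<subseteq> unbounded_coords g"
proof
  fix i assume i: "i \<in> unbounded_coords f"
  obtain \<phi> :: "real \<Rightarrow> long_ray' \<times> long_ray' \<times> long_ray' \<Rightarrow> long_ray' \<times> long_ray' \<times> long_ray'"
    where f: "f \<in> knots \<A>" and iso: "isotopy \<phi>" and 0: "\<phi> 0 = id"
      and 1: "\<phi> 1 \<circ> (cube incl \<circ> f) = cube incl \<circ> g"
    using assms by (auto simp: knot_equiv_def)
  define \<gamma> where "\<gamma> t x = coord i (\<phi> t (cube incl (f x)))" for t x
  have c\<phi>: "continuous_on (UNIV \<times> {0..1}) (\<lambda>(y, t). \<phi> t y)" using iso by (simp add: isotopy_def)
  have ccube: "continuous_on UNIV (cube incl)" using homeomorphism_cube_incl by (simp add: homeomorphism_def)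
  have "continuous_on (UNIV \<times> {0..1}) (\<lambda>p. coord i ((\<lambda>(y, t). \<phi> t y) (cube incl (f (fst p)), snd p)))"
    by (intro continuous_on_compose2[OF continuous_coord] continuous_on_compose2[OF c\<phi>]
        continuous_on_compose2[OF ccube] continuous_on_compose2[OF continuous_knot[OF f]] continuous_intros subset_UNIV)
      auto
  then have "continuous_on (UNIV \<times> {0..1}) (\<lambda>(x, t). \<gamma> t x)" by (simp add: \<gamma>_def case_prod_unfold)
  moreover have "\<gamma> 0 = (\<lambda>x. incl ((coord i \<circ> f) x))" by (simp add: \<gamma>_def 0 fun_eq_iff)
  then have "unbounded (\<gamma> 0)" using i by (simp add: unbounded_incl_iff unbounded_coords_def del: o_apply)
  ultimately have "unbounded (\<gamma> 1)" by (rule isotopy_preserves_unbounded)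
  moreover have "\<gamma> 1 = (\<lambda>x. incl ((coord i \<circ> g) x))"
    using fun_cong[OF 1] by (simp add: \<gamma>_def fun_eq_iff)
  ultimately show "i \<in> unbounded_coords g"
    using i by (simp add: unbounded_incl_iff unbounded_coords_def del: o_apply)
qed

lemma knot_equiv_iff:
  assumes A: "maximal_atlas \<A>" and f: "f \<in> knots \<A>" and g: "g \<in> knots \<A>"
  shows "(f, g) \<in> knot_equiv \<A> \<longleftrightarrow> unbounded_coords f = unbounded_coords g"
proof
  assume fg: "(f, g) \<in> knot_equiv \<A>"
  then have "(g, f) \<in> knot_equiv \<A>" using equiv_knot_equiv[of \<A>] by (meson equiv_def symD)
  then show "unbounded_coords f = unbounded_coords g"
    using fg knot_equiv_unbounded_coords_le by blast
qed (rule knot_equiv_if_unbounded_coords_eq[OF A f g])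

section \<open>Diagonal knots\<close>

text \<open>Constant coordinates take the value \<open>origin\<close> because every chart domain
  contains it; hence membership of a knot point in a product chart depends on the running parameter
  alone.\<close>

definition diagonal_knot :: "nat set \<Rightarrow> long_ray \<Rightarrow> long_ray \<times> long_ray \<times> long_ray" where
  "diagonal_knot I x = (if 0 \<in> I then x else origin, if 1 \<in> I then x else origin, if 2 \<in> I then x else origin)"

lemma coord_diagonal_knot: "i \<in> {0, 1, 2} \<Longrightarrow> coord i (diagonal_knot I x) = (if i \<in> I then x else origin)"
  by (auto simp: diagonal_knot_def)

lemma unbounded_coords_diagonal_knot:
  assumes "I \<subseteq> {0, 1, 2}"
  shows "unbounded_coords (diagonal_knot I) = I"
proof -
  have "unbounded (coord i \<circ> diagonal_knot I) \<longleftrightarrow> i \<in> I" if i: "i \<in> {0, 1, 2}" for i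
  proof -
    have "coord i \<circ> diagonal_knot I = (if i \<in> I then (\<lambda>x. x) else (\<lambda>x. origin))"
      using coord_diagonal_knot[OF i] by (auto simp: fun_eq_iff)
    moreover have "\<not> unbounded (\<lambda>x::long_ray. origin)" by (auto simp: unbounded_def)
    ultimately show ?thesis using unbounded_id_long_ray by auto
  qed
  then show ?thesis using assms by (auto simp: unbounded_coords_def)
qed

lemma diagonal_knot_in_knots:
  assumes A: "maximal_atlas \<A>" and I: "i \<in> I" "i \<in> {0, 1, 2}"
  shows "diagonal_knot I \<in> knots \<A>"
proof -
  let ?f = "diagonal_knot I"
  have fi: "coord i (?f x) = x" for x using coord_diagonal_knot[OF I(2)] I(1) by simp
  have "continuous_on UNIV (\<lambda>x. if j \<in> I then x else origin)" for j by (cases "j \<in> I") auto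
  then have cf: "continuous_on UNIV ?f"
    unfolding diagonal_knot_def by (intro continuous_on_Pair)
  have hom: "homeomorphism UNIV (range ?f) ?f (coord i)"
    by (rule homeomorphismI) (auto simp: fi cf continuous_coord)
  have "C_infinity_on S h \<and> (\<forall>x\<in>S. vector_derivative h (at x within S) \<noteq> 0)"
    if U: "(U, \<psi>) \<in> \<A>" and V: "(V, \<eta>) \<in> \<A>"
      and S: "S = \<psi> ` (U \<inter> ?f -` (V \<times> V \<times> V))" and h: "h = cube \<eta> \<circ> ?f \<circ> inv_into U \<psi>" for U \<psi> V \<eta> S h
  proof -
    have ch: "is_chart (U, \<psi>)" "is_chart (V, \<eta>)" and comp: "compatible (U, \<psi>) (V, \<eta>)"
      using A U V by (auto simp: maximal_atlas_def is_atlas_def)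
    then have o: "open U" "open V" "origin \<in> V" by (auto simp: is_chart_iff)
    have injU: "inj_on \<psi> U" and injV: "inj_on \<eta> V"
      using ch by (auto simp: is_chart_iff homeomorphism_def intro: inj_on_inverseI)
    have "?f x \<in> V \<times> V \<times> V \<longleftrightarrow> x \<in> V" for x
    proof
      assume "?f x \<in> V \<times> V \<times> V"
      then have "coord i (?f x) \<in> V" by (simp add: mem_cube_iff)
      then show "x \<in> V" by (simp add: fi)
    qed (use o in \<open>simp add: diagonal_knot_def\<close>)
    then have S': "S = \<psi> ` (U \<inter> V)" using S by (auto simp: vimage_def)
    \<comment> \<open>\<open>k\<close> and \<open>m\<close> are the mutually inverse transition maps
      of the two charts. A zero derivative of the knot would force one for \<open>k\<close>, its
      coordinate \<open>i\<close>, and by the chain rule for the identity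
      \<open>m \<circ> k\<close>.\<close>
    define k where "k = \<eta> \<circ> inv_into U \<psi>"
    define m where "m = \<psi> \<circ> inv_into V \<eta>"
    have k: "C_infinity_on S k" and m: "C_infinity_on (\<eta> ` (U \<inter> V)) m"
      using comp by (auto simp: compatible_def S' k_def m_def)
    have comps: "C_infinity_on S (\<lambda>r. if j \<in> I then k r else \<eta> origin)" for j
      using k C_infinity_on_const[of S "\<eta> origin"] by (cases "j \<in> I") simp_all
    have "h = (\<lambda>r. (if 0 \<in> I then k r else \<eta> origin, if 1 \<in> I then k r else \<eta> origin, if 2 \<in> I then k r else \<eta> origin))"
      by (auto simp: h k_def cube_def diagonal_knot_def fun_eq_iff)
    then have C: "C_infinity_on S h" by (simp only:) (intro C_infinity_on_Pair comps)
    moreover have "vector_derivative h (at x within S) \<noteq> 0" if x: "x \<in> S" for x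
    proof
      assume 0: "vector_derivative h (at x within S) = 0"
      obtain y where y: "y \<in> U \<inter> V" "x = \<psi> y" using x S' by blast
      have nb: "at x within S \<noteq> bot"
        unfolding y(2) S' by (rule chart_image_no_isolated_point[OF ch(1)]) (use o y in auto)
      obtain D where "(h has_vector_derivative D) (at x within S)" using C x unfolding C_infinity_on_def by metis
      moreover from this have "D = 0" using vector_derivative_within[OF nb] 0 by metis
      ultimately have "((\<lambda>r. coord i (h r)) has_vector_derivative coord i 0) (at x within S)"
        using bounded_linear.has_vector_derivative[OF bounded_linear_coord] by blast
      moreover have "(\<lambda>r. coord i (h r)) = k" by (simp add: h k_def fi fun_eq_iff)
      moreover have "coord i (0 :: real \<times> real \<times> real) = 0" by (simp add: coord_def)
      ultimately have dk: "(k has_vector_derivative 0) (at x within S)" by simp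
      have kS: "k ` S = \<eta> ` (U \<inter> V)" using injU by (auto simp: S' k_def image_iff)
      obtain e where "(m has_vector_derivative e) (at (k x) within k ` S)"
        using m x kS unfolding C_infinity_on_def by (metis image_eqI)
      from vector_diff_chain_within[OF dk this]
      have "((m \<circ> k) has_vector_derivative 0) (at x within S)" by simp
      moreover have "(m \<circ> k) r = r" if "r \<in> S" for r
        using that injU injV by (auto simp: S' k_def m_def)
      ultimately have "((\<lambda>r. r) has_vector_derivative 0) (at x within S)"
        using x by (metis (no_types, lifting) has_vector_derivative_transform)
      moreover have "((\<lambda>r::real. r) has_vector_derivative 1) (at x within S)" by (rule has_vector_derivative_id)
      ultimately have "(0::real) = 1" using vector_derivative_within[OF nb] by metis
      then show False by simp
    qed
    ultimately show ?thesis by blast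
  qed
  then show ?thesis using hom unfolding knots_def smooth_embedding_def Let_def by blast
qed

theorem theorem3p8:
  fixes \<A> :: "chart set"
  assumes "maximal_atlas \<A>"
  shows "card (knots \<A> // knot_equiv \<A>) = 2 ^ 3 - 1"
proof -
  let ?P = "Pow {0, 1, 2} - {{}} :: nat set set"
  let ?c = "\<lambda>I. knot_equiv \<A> `` {diagonal_knot I}"
  have dk: "diagonal_knot I \<in> knots \<A>" if "I \<in> ?P" for I
    using that diagonal_knot_in_knots[OF assms] by blast
  have "bij_betw ?c ?P (knots \<A> // knot_equiv \<A>)"
  proof (rule bij_betw_imageI)
    show "inj_on ?c ?P"
    proof (rule inj_onI)
      fix I J assume IJ: "I \<in> ?P" "J \<in> ?P" "?c I = ?c J"
      then have "(diagonal_knot I, diagonal_knot J) \<in> knot_equiv \<A>"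
        using eq_equiv_class_iff[OF equiv_knot_equiv] dk by blast
      then show "I = J"
        using knot_equiv_iff[OF assms dk[OF IJ(1)] dk[OF IJ(2)]] unbounded_coords_diagonal_knot IJ by auto
    qed
    show "?c ` ?P = knots \<A> // knot_equiv \<A>"
    proof (intro equalityI subsetI)
      fix X assume "X \<in> ?c ` ?P"
      then show "X \<in> knots \<A> // knot_equiv \<A>" using dk by (auto intro: quotientI)
    next
      fix X assume "X \<in> knots \<A> // knot_equiv \<A>"
      then obtain f where f: "f \<in> knots \<A>" "X = knot_equiv \<A> `` {f}" by (rule quotientE)
      have I: "unbounded_coords f \<in> ?P"
        using unbounded_coords_nonempty[OF f(1) assms] by (auto simp: unbounded_coords_def)
      then have "unbounded_coords (diagonal_knot (unbounded_coords f)) = unbounded_coords f"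
        by (intro unbounded_coords_diagonal_knot) auto
      then have "(diagonal_knot (unbounded_coords f), f) \<in> knot_equiv \<A>"
        using knot_equiv_iff[OF assms dk[OF I] f(1)] by simp
      then have "?c (unbounded_coords f) = X"
        unfolding f(2) by (rule equiv_class_eq[OF equiv_knot_equiv])
      then show "X \<in> ?c ` ?P" using I by blast
    qed
  qed
  then have "card (knots \<A> // knot_equiv \<A>) = card ?P" by (simp add: bij_betw_same_card)
  also have "\<dots> = 2 ^ 3 - 1" by (subst card_Diff_singleton) (auto simp: card_Pow)
  finally show ?thesis .
qed

end
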